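(* Let $X,Y\in\mathcal O(\Gamma)$ and let $f:X\to Y$ be a straight map. Then there is a weakly optimal map $g_0:X\to Y$ such that $$d_\infty(f,g_0)\le \operatorname{vol}(X)\,\bigl(\operatorname{Lip}(f)-\Lambda(X,Y)\bigr).$$ Moreover, for any weakly optimal map $\varphi:X\to Y$ and for any $\varepsilon>0$ there is an optimal map $g:X\to Y$ such that $d_\infty(g,\varphi)<\varepsilon$.
   Context: **Setting.** $\Gamma=\bigsqcup_{i=1}^k\Gamma_i$ is a finite disjoint union of connected finite graphs of groups with trivial edge groups and non-trivial fundamental groups $H_i=\pi_1(\Gamma_i)$ (as graphs of groups), each $H_i$ being equipped with the free splitting given by the vertex groups of $\Gamma_i$. $\mathcal O(\Gamma_i)$ is the set of equivariant isometry classes of minimal metric simplicial $H_i$-trees (simplicial isometric actions) with trivial edge stabilisers such that: for each non-trivial vertex group $V$ of $\Gamma_i$ there is exactly one orbit of vertices with stabiliser conjugate to $V$ (non-free vertices); every other vertex has trivial stabiliser (free vertices); no free vertex has valence two. (If $H_i$ is itself a vertex group, this is a single point.) $\mathcal O(\Gamma)=\prod_i\mathcal O(\Gamma_i)$; a point $X=(X_1,\dots,X_k)$ is regarded as the forest $\bigsqcup_i X_i$. $\operatorname{vol}(X)$ is the sum of the edge lengths of the quotient metric graph $\bigsqcup_i H_i\backslash X_i$. **Maps.** For $X,Y\in\mathcal O(\Gamma)$ an $\mathcal O$-map $f:X\to Y$ is a tuple of Lipschitz $H_i$-equivariant maps $f_i:X_i\to Y_i$. It is straight if on each edge $e$ it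 has constant speed $\lambda_e(f)\ge 0$, i.e. $d_Y(f(a),f(b))=\lambda_e(f)\,d_X(a,b)$ for all $a,b\in e$. $\Lambda(X,Y)=\min\operatorname{Lip}(f)$ over all $\mathcal O$-maps $f:X\to Y$. For $\mathcal O$-maps $f,g:X\to Y$, $d_\infty(f,g)=\max_{x\in X}d_Y(f(x),g(x))$. **Tension graph, gates, optimality.** For a straight map $f$, $\operatorname{Lip}(f)=\max_e\lambda_e(f)$, and the tension graph $X_{\max}(f)$ is the union of the edges $e$ with $\lambda_e(f)=\operatorname{Lip}(f)$. Two germs of edges at the same vertex are in the same gate (of the gate structure induced by $f$) if they have the same non-degenerate $f$-image. A straight map $f:X\to Y$ is weakly optimal if $\operatorname{Lip}(f)=\Lambda(X,Y)$. It is optimal if each vertex of $X_{\max}(f)$ has at least two gates in $X_{\max}(f)$. *)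

theory Defs
  imports
    "HOL-Analysis.Abstract_Metric_Spaces"
    "HOL-Algebra.Group_Action"
    "Graph_Theory.Digraph_Component"
begin

section \<open>Graphs of groups with trivial edge groups\<close>

text \<open>
  The underlying graph (loops and multiple edges allowed) is given with an arbitrary orientation
  of its edges. As all edge groups are trivial, only the vertex groups are recorded. The base
  vertex is the one used for the fundamental group.
\<close>

record ('v, 'e, 'g) graph_of_groups =
  gog_graph :: "('v, 'e) pre_digraph"
  vertex_group :: "'v \<Rightarrow> 'g monoid"
  base_vertex :: 'v

definition connected_finite_gog :: "('v, 'e, 'g) graph_of_groups \<Rightarrow> bool" where
  "connected_finite_gog \<Gamma> \<longleftrightarrow>
     fin_digraph (gog_graph \<Gamma>) \<and> Digraph_Component.connected (gog_graph \<Gamma>) \<and>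
     base_vertex \<Gamma> \<in> verts (gog_graph \<Gamma>) \<and>
     (\<forall>v \<in> verts (gog_graph \<Gamma>). group (vertex_group \<Gamma> v))"

text \<open>\<open>Traverse e True\<close> runs along the arc \<open>e\<close> in its direction, \<open>Traverse e False\<close> against it.\<close>

datatype ('v, 'e, 'g) letter = Elt 'v 'g | Traverse 'e bool

inductive gog_path ::
    "('v, 'e, 'g) graph_of_groups \<Rightarrow> 'v \<Rightarrow> ('v, 'e, 'g) letter list \<Rightarrow> 'v \<Rightarrow> bool"
  for \<Gamma> where
  Nil: "v \<in> verts (gog_graph \<Gamma>) \<Longrightarrow> gog_path \<Gamma> v [] v"
| Elt: "gog_path \<Gamma> v p w \<Longrightarrow> a \<in> carrier (vertex_group \<Gamma> v) \<Longrightarrow> gog_path \<Gamma> v (Elt v a # p) w"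
| Fwd: "gog_path \<Gamma> (head (gog_graph \<Gamma>) e) p w \<Longrightarrow> e \<in> arcs (gog_graph \<Gamma>) \<Longrightarrow>
          gog_path \<Gamma> (tail (gog_graph \<Gamma>) e) (Traverse e True # p) w"
| Bwd: "gog_path \<Gamma> (tail (gog_graph \<Gamma>) e) p w \<Longrightarrow> e \<in> arcs (gog_graph \<Gamma>) \<Longrightarrow>
          gog_path \<Gamma> (head (gog_graph \<Gamma>) e) (Traverse e False # p) w"

inductive gog_step ::
    "('v, 'e, 'g) graph_of_groups \<Rightarrow> ('v, 'e, 'g) letter list \<Rightarrow> ('v, 'e, 'g) letter list \<Rightarrow> bool"
  for \<Gamma> where
  one: "v \<in> verts (gog_graph \<Gamma>) \<Longrightarrow>
          gog_step \<Gamma> (p @ Elt v \<one>\<^bsub>vertex_group \<Gamma> v\<^esub> # q) (p @ q)"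
| mult: "v \<in> verts (gog_graph \<Gamma>) \<Longrightarrow> a \<in> carrier (vertex_group \<Gamma> v) \<Longrightarrow>
          b \<in> carrier (vertex_group \<Gamma> v) \<Longrightarrow>
          gog_step \<Gamma> (p @ Elt v a # Elt v b # q) (p @ Elt v (a \<otimes>\<^bsub>vertex_group \<Gamma> v\<^esub> b) # q)"
| backtrack: "e \<in> arcs (gog_graph \<Gamma>) \<Longrightarrow>
          gog_step \<Gamma> (p @ Traverse e d # Traverse e (\<not> d) # q) (p @ q)"

text \<open>
  \<open>equivclp (gog_step \<Gamma>)\<close> is equality of words in the free product of all vertex groups and the
  free group on the edges. Following Serre, the fundamental group consists of the elements of
  this group that are represented by loops at the base vertex.
\<close>

definition gog_loops :: "('v, 'e, 'g) graph_of_groups \<Rightarrow> ('v, 'e, 'g) letter list set" where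
  "gog_loops \<Gamma> = {p. gog_path \<Gamma> (base_vertex \<Gamma>) p (base_vertex \<Gamma>)}"

definition loop_class ::
    "('v, 'e, 'g) graph_of_groups \<Rightarrow> ('v, 'e, 'g) letter list \<Rightarrow> ('v, 'e, 'g) letter list set" where
  "loop_class \<Gamma> p = {q \<in> gog_loops \<Gamma>. equivclp (gog_step \<Gamma>) p q}"

definition pi1 :: "('v, 'e, 'g) graph_of_groups \<Rightarrow> ('v, 'e, 'g) letter list set monoid" where
  "pi1 \<Gamma> = \<lparr>carrier = loop_class \<Gamma> ` gog_loops \<Gamma>,
            monoid.mult = (\<lambda>A B. \<Union>p\<in>A. \<Union>q\<in>B. loop_class \<Gamma> (p @ q)),
            one = loop_class \<Gamma> []\<rparr>"

fun inv_letter :: "('v, 'e, 'g) graph_of_groups \<Rightarrow> ('v, 'e, 'g) letter \<Rightarrow> ('v, 'e, 'g) letter" where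
  "inv_letter \<Gamma> (Elt v a) = Elt v (inv\<^bsub>vertex_group \<Gamma> v\<^esub> a)"
| "inv_letter \<Gamma> (Traverse e d) = Traverse e (\<not> d)"

definition inv_path ::
    "('v, 'e, 'g) graph_of_groups \<Rightarrow> ('v, 'e, 'g) letter list \<Rightarrow> ('v, 'e, 'g) letter list" where
  "inv_path \<Gamma> p = rev (map (inv_letter \<Gamma>) p)"

text \<open>
  The vertex group at \<open>v\<close> becomes a subgroup of the fundamental group after the choice of a path
  \<open>p\<close> from the base vertex to \<open>v\<close>. Prepending a loop to \<open>p\<close> conjugates this subgroup, and all
  choices of \<open>p\<close> arise in this way up to homotopy; so the subgroups obtained from all \<open>p\<close> are
  exactly the conjugates of the vertex group.
\<close>

definition vertex_subgroup ::
    "('v, 'e, 'g) graph_of_groups \<Rightarrow> 'v \<Rightarrow> ('v, 'e, 'g) letter list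
      \<Rightarrow> ('v, 'e, 'g) letter list set set" where
  "vertex_subgroup \<Gamma> v p =
     (\<lambda>a. loop_class \<Gamma> (p @ [Elt v a] @ inv_path \<Gamma> p)) ` carrier (vertex_group \<Gamma> v)"

definition conj_to_vertex_group ::
    "('v, 'e, 'g) graph_of_groups \<Rightarrow> 'v \<Rightarrow> ('v, 'e, 'g) letter list set set \<Rightarrow> bool" where
  "conj_to_vertex_group \<Gamma> v S \<longleftrightarrow>
     (\<exists>p. gog_path \<Gamma> (base_vertex \<Gamma>) p v \<and> S = vertex_subgroup \<Gamma> v p)"

definition nontrivial_vertices :: "('v, 'e, 'g) graph_of_groups \<Rightarrow> 'v set" where
  "nontrivial_vertices \<Gamma> =
     {v \<in> verts (gog_graph \<Gamma>). carrier (vertex_group \<Gamma> v) \<noteq> {\<one>\<^bsub>vertex_group \<Gamma> v\<^esub>}}"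


section \<open>Metric simplicial trees with a group action\<close>

definition geod_seg :: "'x metric \<Rightarrow> 'x \<Rightarrow> 'x \<Rightarrow> 'x set" where
  "geod_seg m x y = {z \<in> mspace m. mdist m x z + mdist m z y = mdist m x y}"

text \<open>
  A metric tree: any two points are joined by a geodesic, and every arc is the geodesic segment
  between its endpoints.
\<close>

definition metric_tree :: "'x metric \<Rightarrow> bool" where
  "metric_tree m \<longleftrightarrow> mspace m \<noteq> {} \<and>
     (\<forall>x \<in> mspace m. \<forall>y \<in> mspace m. \<exists>c :: real \<Rightarrow> 'x.
        c ` {0..mdist m x y} \<subseteq> mspace m \<and> c 0 = x \<and> c (mdist m x y) = y \<and>
        (\<forall>s \<in> {0..mdist m x y}. \<forall>t \<in> {0..mdist m x y}. mdist m (c s) (c t) = \<bar>s - t\<bar>)) \<and>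
     (\<forall>c :: real \<Rightarrow> 'x. continuous_map (top_of_set {0..1}) (mtopology_of m) c \<and> inj_on c {0..1} \<longrightarrow>
        c ` {0..1} = geod_seg m (c 0) (c 1))"

record ('h, 'x) gtree =
  met :: "'x metric"
  vset :: "'x set"
  act :: "'h \<Rightarrow> 'x \<Rightarrow> 'x"

abbreviation pts :: "('h, 'x) gtree \<Rightarrow> 'x set" where
  "pts X \<equiv> mspace (met X)"

abbreviation tdist :: "('h, 'x) gtree \<Rightarrow> 'x \<Rightarrow> 'x \<Rightarrow> real" where
  "tdist X \<equiv> mdist (met X)"

text \<open>Edges are closed and unoriented.\<close>

definition edges :: "('h, 'x) gtree \<Rightarrow> 'x set set" where
  "edges X = {geod_seg (met X) u w | u w. u \<in> vset X \<and> w \<in> vset X \<and> u \<noteq> w \<and>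
                geod_seg (met X) u w \<inter> vset X = {u, w}}"

definition metric_simplicial_tree :: "('h, 'x) gtree \<Rightarrow> bool" where
  "metric_simplicial_tree X \<longleftrightarrow> metric_tree (met X) \<and> vset X \<subseteq> pts X \<and>
     pts X = vset X \<union> \<Union>(edges X) \<and>
     (\<forall>e \<in> edges X. \<forall>e' \<in> edges X. e \<noteq> e' \<longrightarrow> e \<inter> e' \<subseteq> vset X) \<and>
     (\<forall>x \<in> pts X. \<forall>y \<in> pts X. finite (geod_seg (met X) x y \<inter> vset X))"

definition simplicial_isometric_action :: "'h monoid \<Rightarrow> ('h, 'x) gtree \<Rightarrow> bool" where
  "simplicial_isometric_action H X \<longleftrightarrow> group_action H (pts X) (act X) \<and>
     (\<forall>h \<in> carrier H. act X h ` vset X = vset X \<and>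
        (\<forall>x \<in> pts X. \<forall>y \<in> pts X. tdist X (act X h x) (act X h y) = tdist X x y))"

text \<open>A subtree is determined by its vertices, which form a geodesically closed set.\<close>

definition minimal_action :: "'h monoid \<Rightarrow> ('h, 'x) gtree \<Rightarrow> bool" where
  "minimal_action H X \<longleftrightarrow>
     (\<forall>W \<subseteq> vset X. W \<noteq> {} \<and> (\<forall>h \<in> carrier H. act X h ` W \<subseteq> W) \<and>
        (\<forall>u \<in> W. \<forall>w \<in> W. geod_seg (met X) u w \<inter> vset X \<subseteq> W) \<longrightarrow> W = vset X)"

text \<open>
  The stabiliser of an edge is its setwise stabiliser, so that there are no inversions either.
\<close>

definition trivial_edge_stabilisers :: "'h monoid \<Rightarrow> ('h, 'x) gtree \<Rightarrow> bool" where
  "trivial_edge_stabilisers H X \<longleftrightarrow>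
     (\<forall>e \<in> edges X. \<forall>h \<in> carrier H. act X h ` e = e \<longrightarrow> h = \<one>\<^bsub>H\<^esub>)"

definition free_vertices :: "'h monoid \<Rightarrow> ('h, 'x) gtree \<Rightarrow> 'x set" where
  "free_vertices H X = {x \<in> vset X. stabilizer H (act X) x = {\<one>\<^bsub>H\<^esub>}}"

definition vertices_over ::
    "('v, 'e, 'g) graph_of_groups \<Rightarrow> (('v, 'e, 'g) letter list set, 'x) gtree \<Rightarrow> 'v \<Rightarrow> 'x set" where
  "vertices_over \<Gamma> X v =
     {x \<in> vset X. conj_to_vertex_group \<Gamma> v (stabilizer (pi1 \<Gamma>) (act X) x)}"

text \<open>
  Points are represented by trees rather than by equivariant isometry classes of trees. Note that
  \<open>card\<close> is 0 for infinite sets, so a vertex of infinite valence does not have valence two here.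
\<close>

definition outer_space_component ::
    "('v, 'e, 'g) graph_of_groups \<Rightarrow> (('v, 'e, 'g) letter list set, 'x) gtree set" where
  "outer_space_component \<Gamma> = {X.
     metric_simplicial_tree X \<and>
     simplicial_isometric_action (pi1 \<Gamma>) X \<and>
     minimal_action (pi1 \<Gamma>) X \<and>
     trivial_edge_stabilisers (pi1 \<Gamma>) X \<and>
     (\<forall>v \<in> nontrivial_vertices \<Gamma>. \<exists>!B. B \<in> orbit (pi1 \<Gamma>) (act X) ` vertices_over \<Gamma> X v) \<and>
     vset X = free_vertices (pi1 \<Gamma>) X \<union> (\<Union>v \<in> nontrivial_vertices \<Gamma>. vertices_over \<Gamma> X v) \<and>
     (\<forall>x \<in> free_vertices (pi1 \<Gamma>) X. card {e \<in> edges X. x \<in> e} \<noteq> 2)}"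

definition outer_space ::
    "nat \<Rightarrow> (nat \<Rightarrow> ('v, 'e, 'g) graph_of_groups)
      \<Rightarrow> (nat \<Rightarrow> (('v, 'e, 'g) letter list set, 'x) gtree) set" where
  "outer_space k \<Gamma> = {X. \<forall>i \<in> {1..k}. X i \<in> outer_space_component (\<Gamma> i)}"

definition edge_length :: "('h, 'x) gtree \<Rightarrow> 'x set \<Rightarrow> real" where
  "edge_length X e = (SUP (a, b) \<in> e \<times> e. tdist X a b)"

text \<open>
  The edges of the quotient graph are the orbits of edges; the edge length is constant on each
  orbit.
\<close>

definition edge_orbits :: "'h monoid \<Rightarrow> ('h, 'x) gtree \<Rightarrow> 'x set set set" where
  "edge_orbits H X = {{act X h ` e | h. h \<in> carrier H} | e. e \<in> edges X}"

definition vol ::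
    "nat \<Rightarrow> (nat \<Rightarrow> ('v, 'e, 'g) graph_of_groups)
      \<Rightarrow> (nat \<Rightarrow> (('v, 'e, 'g) letter list set, 'x) gtree) \<Rightarrow> real" where
  "vol k \<Gamma> X =
     (\<Sum>i = 1..k. \<Sum>E \<in> edge_orbits (pi1 (\<Gamma> i)) (X i). the_elem (edge_length (X i) ` E))"


section \<open>Maps between forests\<close>

definition O_map ::
    "nat \<Rightarrow> (nat \<Rightarrow> ('v, 'e, 'g) graph_of_groups)
      \<Rightarrow> (nat \<Rightarrow> (('v, 'e, 'g) letter list set, 'x) gtree)
      \<Rightarrow> (nat \<Rightarrow> (('v, 'e, 'g) letter list set, 'y) gtree) \<Rightarrow> (nat \<Rightarrow> 'x \<Rightarrow> 'y) \<Rightarrow> bool" where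
  "O_map k \<Gamma> X Y f \<longleftrightarrow> (\<forall>i \<in> {1..k}.
     Lipschitz_continuous_map (met (X i)) (met (Y i)) (f i) \<and>
     (\<forall>h \<in> carrier (pi1 (\<Gamma> i)). \<forall>x \<in> pts (X i). f i (act (X i) h x) = act (Y i) h (f i x)))"

definition Lip ::
    "nat \<Rightarrow> (nat \<Rightarrow> ('h, 'x) gtree) \<Rightarrow> (nat \<Rightarrow> ('h, 'y) gtree) \<Rightarrow> (nat \<Rightarrow> 'x \<Rightarrow> 'y) \<Rightarrow> real" where
  "Lip k X Y f = Inf {L. 0 \<le> L \<and> (\<forall>i \<in> {1..k}. \<forall>a \<in> pts (X i). \<forall>b \<in> pts (X i).
                      tdist (Y i) (f i a) (f i b) \<le> L * tdist (X i) a b)}"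

definition Lambda ::
    "nat \<Rightarrow> (nat \<Rightarrow> ('v, 'e, 'g) graph_of_groups)
      \<Rightarrow> (nat \<Rightarrow> (('v, 'e, 'g) letter list set, 'x) gtree)
      \<Rightarrow> (nat \<Rightarrow> (('v, 'e, 'g) letter list set, 'y) gtree) \<Rightarrow> real" where
  "Lambda k \<Gamma> X Y = Inf {Lip k X Y f | f. O_map k \<Gamma> X Y f}"

definition d_inf ::
    "nat \<Rightarrow> (nat \<Rightarrow> ('h, 'x) gtree) \<Rightarrow> (nat \<Rightarrow> ('h, 'y) gtree)
      \<Rightarrow> (nat \<Rightarrow> 'x \<Rightarrow> 'y) \<Rightarrow> (nat \<Rightarrow> 'x \<Rightarrow> 'y) \<Rightarrow> real" where
  "d_inf k X Y f g = (SUP (i, x) \<in> (SIGMA i : {1..k}. pts (X i)). tdist (Y i) (f i x) (g i x))"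

definition has_speed ::
    "('h, 'x) gtree \<Rightarrow> ('h, 'y) gtree \<Rightarrow> ('x \<Rightarrow> 'y) \<Rightarrow> 'x set \<Rightarrow> real \<Rightarrow> bool" where
  "has_speed X Y f e l \<longleftrightarrow> (\<forall>a \<in> e. \<forall>b \<in> e. tdist Y (f a) (f b) = l * tdist X a b)"

definition straight ::
    "nat \<Rightarrow> (nat \<Rightarrow> ('v, 'e, 'g) graph_of_groups)
      \<Rightarrow> (nat \<Rightarrow> (('v, 'e, 'g) letter list set, 'x) gtree)
      \<Rightarrow> (nat \<Rightarrow> (('v, 'e, 'g) letter list set, 'y) gtree) \<Rightarrow> (nat \<Rightarrow> 'x \<Rightarrow> 'y) \<Rightarrow> bool" where
  "straight k \<Gamma> X Y f \<longleftrightarrow> O_map k \<Gamma> X Y f \<and>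
     (\<forall>i \<in> {1..k}. \<forall>e \<in> edges (X i). \<exists>l \<ge> 0. has_speed (X i) (Y i) (f i) e l)"

definition tension_edges ::
    "nat \<Rightarrow> (nat \<Rightarrow> ('h, 'x) gtree) \<Rightarrow> (nat \<Rightarrow> ('h, 'y) gtree)
      \<Rightarrow> (nat \<Rightarrow> 'x \<Rightarrow> 'y) \<Rightarrow> nat \<Rightarrow> 'x set set" where
  "tension_edges k X Y f i = {e \<in> edges (X i). has_speed (X i) (Y i) (f i) e (Lip k X Y f)}"

text \<open>
  An edge has one germ at each of its endpoints, so a germ at \<open>v\<close> is represented by the edge
  \<open>e \<ni> v\<close>. A straight map is constant or injective on \<open>e\<close>, so that the germ at \<open>f v\<close> of the
  image \<open>f ` e\<close> is the image of the germ. A germ with degenerate image shares its gate with no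
  other germ.
\<close>

definition same_gate ::
    "('h, 'x) gtree \<Rightarrow> ('h, 'y) gtree \<Rightarrow> ('x \<Rightarrow> 'y) \<Rightarrow> 'x \<Rightarrow> 'x set \<Rightarrow> 'x set \<Rightarrow> bool" where
  "same_gate X Y f v e e' \<longleftrightarrow> e = e' \<or>
     f ` e \<noteq> {f v} \<and> f ` e' \<noteq> {f v} \<and>
     (\<exists>r > 0. f ` e \<inter> mball_of (met Y) (f v) r = f ` e' \<inter> mball_of (met Y) (f v) r)"

definition weakly_optimal ::
    "nat \<Rightarrow> (nat \<Rightarrow> ('v, 'e, 'g) graph_of_groups)
      \<Rightarrow> (nat \<Rightarrow> (('v, 'e, 'g) letter list set, 'x) gtree)
      \<Rightarrow> (nat \<Rightarrow> (('v, 'e, 'g) letter list set, 'y) gtree) \<Rightarrow> (nat \<Rightarrow> 'x \<Rightarrow> 'y) \<Rightarrow> bool" where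
  "weakly_optimal k \<Gamma> X Y f \<longleftrightarrow> straight k \<Gamma> X Y f \<and> Lip k X Y f = Lambda k \<Gamma> X Y"

definition optimal ::
    "nat \<Rightarrow> (nat \<Rightarrow> ('v, 'e, 'g) graph_of_groups)
      \<Rightarrow> (nat \<Rightarrow> (('v, 'e, 'g) letter list set, 'x) gtree)
      \<Rightarrow> (nat \<Rightarrow> (('v, 'e, 'g) letter list set, 'y) gtree) \<Rightarrow> (nat \<Rightarrow> 'x \<Rightarrow> 'y) \<Rightarrow> bool" where
  "optimal k \<Gamma> X Y f \<longleftrightarrow> straight k \<Gamma> X Y f \<and>
     (\<forall>i \<in> {1..k}. \<forall>v \<in> vset (X i). v \<in> \<Union>(tension_edges k X Y f i) \<longrightarrow>
        (\<exists>e \<in> tension_edges k X Y f i. \<exists>e' \<in> tension_edges k X Y f i.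
           v \<in> e \<and> v \<in> e' \<and> \<not> same_gate (X i) (Y i) (f i) v e e'))"

end

theory Submission
  imports Defs
begin

text \<open>
  Let \<open>f\<close> be straight with tension graph \<open>T\<close>. A vertex with a single gate in \<open>T\<close> is free, since
  its stabiliser fixes the gate, so its image can be moved equivariantly in the direction of that
  gate, which slows down the edges of \<open>T\<close> at this vertex. Discard these edges and repeat. If
  vertices discarded earlier are moved further, by \<open>\<eta>\<close> times the volume present at that time, all
  discarded edges are slowed down by at least \<open>\<eta>\<close> and no point moves more than \<open>\<eta> vol(X)\<close>. What
  remains is a core \<open>C\<close> with two gates at every vertex. If \<open>C\<close> is nonempty then
  \<open>Lip(f) \<le> Lip(h)\<close> for every \<open>h\<close>: at a vertex of \<open>C\<close> maximising \<open>d(f v, h v)\<close> the image of some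
  edge of \<open>C\<close> points away from \<open>h v\<close>, and the distance would increase along that edge if \<open>h\<close>
  stretched less.

  So as long as \<open>Lip(f) > \<Lambda>\<close> the core is empty and \<open>f\<close> can be improved at the rate demanded by the
  theorem; as straight maps form a complete space (minimal actions are cocompact here, so edge
  lengths are bounded below), the variational principle of Caristi and Ekeland yields \<open>g0\<close>. If
  \<open>Lip(f) = \<Lambda>\<close>, one round with small \<open>\<eta>\<close> turns the tension graph into its core.
\<close>

section \<open>Metric trees\<close>

text \<open>Vertex groups may be infinite, so the trees need not be locally finite, and a limit of
  maps cannot be extracted by compactness of balls. It comes from completeness instead, and
  completeness from a positive lower bound for edge lengths. That bound rests on finiteness of the
  set of edge orbits, which has to be derived from minimality and from the generation of
  \<open>pi1\<close> by the vertex groups and finitely many further elements.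

  The constant \<open>vol\<close> comes from the volume in the size of the moves. An edge discarded
  at \<open>v\<close> gets shorter by \<eta> vol(S) at that end, where \<open>S\<close> is the
  subgraph then present, and can regain at most \<eta> vol(S') at the other end, where
  \<open>S'\<close> is the subgraph left over. The volumes differ by at least the length of the
  edge, so its speed drops by at least \<eta>.

  A map with Lipschitz constant 0 offers no gate to move into, as all germs are degenerate. It is
  treated separately, using that a minimal tree has no leaves.\<close>

lemma mdist_self: "x \<in> mspace m \<Longrightarrow> mdist m x x = 0"
  by simp

text \<open>Supplies the continuity hypothesis of the arc clause in \<open>metric_tree\<close>,
  where paths are parametrised by the unit interval.\<close>

lemma continuous_map_01_of_Lipschitz:
  fixes c :: "real \<Rightarrow> 'x"
  assumes "c \<in> {0..1} \<rightarrow> mspace m"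
    and "\<And>s t. s \<in> {0..1} \<Longrightarrow> t \<in> {0..1} \<Longrightarrow> mdist m (c s) (c t) \<le> B * \<bar>s - t\<bar>"
  shows "continuous_map (top_of_set {0..1}) (mtopology_of m) c"
proof -
  have "Lipschitz_continuous_map (submetric euclidean_metric {0..1}) m c"
    unfolding Lipschitz_continuous_map_def
    using assms by (auto simp: dist_real_def intro!: exI[of _ B])
  from Lipschitz_continuous_imp_continuous_map[OF this] show ?thesis
    by (simp add: mtopology_of_submetric)
qed

text \<open>The arc clause of \<open>metric_tree\<close>, carried over to intervals of any length by
  rescaling. For \<open>L = 0\<close> the rescaled path is constant and not injective, so that case
  is computed by hand.\<close>

lemma metric_tree_path_image:
  fixes q :: "real \<Rightarrow> 'x"
  assumes tree: "metric_tree m" and L: "0 \<le> L"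
    and q: "q \<in> {0..L} \<rightarrow> mspace m" "inj_on q {0..L}"
    and lip: "\<And>s t. s \<in> {0..L} \<Longrightarrow> t \<in> {0..L} \<Longrightarrow> mdist m (q s) (q t) \<le> \<bar>s - t\<bar>"
  shows "q ` {0..L} = geod_seg m (q 0) (q L)"
proof (cases "L = 0")
  case True
  have q0: "q 0 \<in> mspace m" using q L by (auto simp: Pi_iff)
  have "z = q 0" if "z \<in> geod_seg m (q 0) (q 0)" for z
  proof -
    from that have "z \<in> mspace m" "mdist m (q 0) z + mdist m z (q 0) = mdist m (q 0) (q 0)"
      by (auto simp: geod_seg_def)
    then show ?thesis using q0 mdist_nonneg[of m z "q 0"] mdist_nonneg[of m "q 0" z]
      by (metis add_nonneg_eq_0_iff mdist_zero)
  qed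
  moreover have "q 0 \<in> geod_seg m (q 0) (q 0)"
    using q0 by (simp add: geod_seg_def)
  ultimately show ?thesis using True by auto
next
  case False
  then have L0: "L > 0" using L by simp
  define r where "r t = q (L * t)" for t
  have img: "(*) L ` {0..1} = {0..L}"
    using L0 by (simp add: image_mult_atLeastAtMost)
  have in01: "L * t \<in> {0..L}" if "t \<in> {0..1}" for t using that img by blast
  have "continuous_map (top_of_set {0..1}) (mtopology_of m) r"
  proof (rule continuous_map_01_of_Lipschitz)
    show "r \<in> {0..1} \<rightarrow> mspace m" using q(1) in01 unfolding r_def by blast
    fix s t :: real assume "s \<in> {0..1}" "t \<in> {0..1}"
    then have "mdist m (r s) (r t) \<le> \<bar>L * s - L * t\<bar>" unfolding r_def using lip in01 by blast
    also have "\<dots> = L * \<bar>s - t\<bar>" using L0 by (simp add: abs_mult flip: right_diff_distrib)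
    finally show "mdist m (r s) (r t) \<le> L * \<bar>s - t\<bar>" .
  qed
  moreover have "inj_on r {0..1}"
  proof (rule inj_onI)
    fix s t :: real assume "s \<in> {0..1}" "t \<in> {0..1}" "r s = r t"
    then have "L * s = L * t" using q(2) in01 unfolding r_def by (meson inj_onD)
    then show "s = t" using L0 by simp
  qed
  ultimately have "r ` {0..1} = geod_seg m (r 0) (r 1)"
    using tree unfolding metric_tree_def by blast
  moreover have "r ` {0..1} = q ` {0..L}"
    unfolding r_def img[symmetric] by (simp add: image_image)
  ultimately show ?thesis by (simp add: r_def)
qed

lemma metric_tree_geodesic:
  fixes m :: "'x metric"
  assumes "metric_tree m" and "x \<in> mspace m" "y \<in> mspace m"
  obtains c :: "real \<Rightarrow> 'x" where "c ` {0..mdist m x y} = geod_seg m x y"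
    and "c 0 = x" "c (mdist m x y) = y"
    and "\<And>s t. s \<in> {0..mdist m x y} \<Longrightarrow> t \<in> {0..mdist m x y} \<Longrightarrow> mdist m (c s) (c t) = \<bar>s - t\<bar>"
proof -
  obtain c :: "real \<Rightarrow> 'x" where c: "c ` {0..mdist m x y} \<subseteq> mspace m" "c 0 = x" "c (mdist m x y) = y"
    and iso: "\<And>s t. s \<in> {0..mdist m x y} \<Longrightarrow> t \<in> {0..mdist m x y} \<Longrightarrow> mdist m (c s) (c t) = \<bar>s - t\<bar>"
    using assms unfolding metric_tree_def by meson
  have "c ` {0..mdist m x y} = geod_seg m (c 0) (c (mdist m x y))"
  proof (rule metric_tree_path_image[OF assms(1)])
    show "inj_on c {0..mdist m x y}"
    proof (rule inj_onI)
      fix s t assume st: "s \<in> {0..mdist m x y}" "t \<in> {0..mdist m x y}" "c s = c t"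
      then have "c t \<in> mspace m" using c by blast
      then have "\<bar>s - t\<bar> = 0" using iso[OF st(1,2)] st(3) mdist_zero by metis
      then show "s = t" by simp
    qed
  qed (use c iso in auto)
  then show thesis using that c iso by simp
qed

text \<open>Follow the geodesics from \<open>p\<close> to \<open>a\<close> and to \<open>b\<close>
  up to the last time \<open>g\<close> at which they agree. Going back from \<open>a\<close> to that
  point and on to \<open>b\<close> visits no point twice, so this path is an arc and its image is
  the segment from \<open>a\<close> to \<open>b\<close>. The branch point therefore lies on all
  three sides.\<close>

lemma metric_tree_median:
  fixes m :: "'x metric"
  assumes tree: "metric_tree m" and p: "p \<in> mspace m" and a: "a \<in> mspace m" and b: "b \<in> mspace m"
  shows "\<exists>z \<in> mspace m. z \<in> geod_seg m p a \<and> z \<in> geod_seg m p b \<and> z \<in> geod_seg m a b"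
proof -
  define \<alpha> where "\<alpha> = mdist m p a"
  define \<beta> where "\<beta> = mdist m p b"
  obtain c where c: "c ` {0..\<alpha>} = geod_seg m p a" "c 0 = p" "c \<alpha> = a"
    and ciso: "\<And>s t. s \<in> {0..\<alpha>} \<Longrightarrow> t \<in> {0..\<alpha>} \<Longrightarrow> mdist m (c s) (c t) = \<bar>s - t\<bar>"
    using metric_tree_geodesic[OF tree p a] unfolding \<alpha>_def by metis
  obtain c' where c': "c' ` {0..\<beta>} = geod_seg m p b" "c' 0 = p" "c' \<beta> = b"
    and ciso': "\<And>s t. s \<in> {0..\<beta>} \<Longrightarrow> t \<in> {0..\<beta>} \<Longrightarrow> mdist m (c' s) (c' t) = \<bar>s - t\<bar>"
    using metric_tree_geodesic[OF tree p b] unfolding \<beta>_def by metis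
  have nn: "0 \<le> \<alpha>" "0 \<le> \<beta>" by (simp_all add: \<alpha>_def \<beta>_def)
  have cM: "c s \<in> mspace m" if "s \<in> {0..\<alpha>}" for s
    using c(1) that unfolding geod_seg_def by blast
  have cM': "c' s \<in> mspace m" if "s \<in> {0..\<beta>}" for s
    using c'(1) that unfolding geod_seg_def by blast
  define G where "G = {s. 0 \<le> s \<and> s \<le> \<alpha> \<and> s \<le> \<beta> \<and> c s = c' s}"
  have G0: "0 \<in> G" using nn c c' by (simp add: G_def)
  have bdd: "bdd_above G" by (rule bdd_aboveI[of _ \<alpha>]) (simp add: G_def)
  define g where "g = Sup G"
  have g0: "0 \<le> g" unfolding g_def using G0 bdd by (rule cSup_upper)
  have ga: "g \<le> \<alpha>" "g \<le> \<beta>" unfolding g_def using G0 by (auto intro!: cSup_least simp: G_def)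
  \<comment> \<open>The supremum is attained, since both geodesics move at unit speed and agree at
    times arbitrarily close to \<open>g\<close>.\<close>
  have cg: "c g = c' g"
  proof -
    have "mdist m (c g) (c' g) \<le> 0 + e" if "e > 0" for e
    proof -
      obtain s where s: "s \<in> G" "g - e/2 < s"
        using less_cSupD[of G "g - e/2"] G0 \<open>e > 0\<close> unfolding g_def by auto
      have "s \<le> g" unfolding g_def using s(1) bdd by (rule cSup_upper)
      moreover have "mdist m (c g) (c' g) \<le> mdist m (c g) (c s) + mdist m (c' s) (c' g)"
        using s(1) mdist_triangle[of "c g" m "c s" "c' g"] cM cM' g0 ga by (simp add: G_def)
      moreover have "mdist m (c g) (c s) = \<bar>g - s\<bar>" "mdist m (c' s) (c' g) = \<bar>s - g\<bar>"
        using s(1) g0 ga ciso[of g s] ciso'[of s g] by (simp_all add: G_def)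
      ultimately show ?thesis using s(2) by linarith
    qed
    then have "mdist m (c g) (c' g) \<le> 0" by (rule field_le_epsilon)
    then have "mdist m (c g) (c' g) = 0" by (simp add: order_antisym)
    then show ?thesis using cM[of g] cM'[of g] g0 ga by simp
  qed
  \<comment> \<open>\<open>q\<close> runs \<open>c\<close> backwards from \<open>a\<close> to the
    branch point, reached at time \<open>\<alpha> - g\<close>, and then \<open>c'\<close> forwards
    to \<open>b\<close>; the shift makes both pieces meet at parameter \<open>g\<close>.\<close>
  define L where "L = \<alpha> + \<beta> - 2 * g"
  define q where "q t = (if t \<le> \<alpha> - g then c (\<alpha> - t) else c' (t - \<alpha> + 2 * g))" for t
  have qM: "q \<in> {0..L} \<rightarrow> mspace m"
    using cM cM' g0 ga by (auto simp: q_def L_def)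
  have p_dist: "mdist m p (c s) = s" if "s \<in> {0..\<alpha>}" for s
    using ciso[of 0 s] that nn c(2) by simp
  have p_dist': "mdist m p (c' s) = s" if "s \<in> {0..\<beta>}" for s
    using ciso'[of 0 s] that nn c'(2) by simp
  \<comment> \<open>A common point of the two halves has one distance from \<open>p\<close>, so it
    would be an agreement of \<open>c\<close> and \<open>c'\<close> at a parameter beyond
    \<open>g\<close>.\<close>
  have ne: "q s \<noteq> q t" if "0 \<le> s" "s \<le> \<alpha> - g" "\<alpha> - g < t" "t \<le> L" for s t
  proof
    assume "q s = q t"
    then have eq: "c (\<alpha> - s) = c' (t - \<alpha> + 2 * g)" using that by (simp add: q_def)
    then have st: "\<alpha> - s = t - \<alpha> + 2 * g"
      using that g0 ga p_dist[of "\<alpha> - s"] p_dist'[of "t - \<alpha> + 2 * g"] by (simp add: L_def)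
    have "\<alpha> - s \<le> \<beta>" using st that by (simp add: L_def)
    then have "t - \<alpha> + 2 * g \<in> G"
      using eq that g0 ga unfolding G_def mem_Collect_eq st[symmetric] by auto
    then have "t - \<alpha> + 2 * g \<le> g" unfolding g_def using bdd by (rule cSup_upper)
    then show False using that by simp
  qed
  have lip: "mdist m (q s) (q t) \<le> \<bar>s - t\<bar>" if "s \<in> {0..L}" "t \<in> {0..L}" "s \<le> t" for s t
  proof -
    consider "t \<le> \<alpha> - g" | "s \<le> \<alpha> - g" "\<alpha> - g < t" | "\<alpha> - g < s" using that by linarith
    then show ?thesis
    proof cases
      case 1
      then show ?thesis using that ciso[of "\<alpha> - s" "\<alpha> - t"] g0 by (simp add: q_def)
    next
      case 2
      then have "mdist m (q s) (q t) \<le> mdist m (c (\<alpha> - s)) (c g) + mdist m (c g) (c' (t - \<alpha> + 2 * g))"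
        using that g0 ga cM[of "\<alpha> - s"] cM[of g] cM'[of "t - \<alpha> + 2 * g"]
        by (simp add: q_def mdist_triangle L_def)
      moreover have "mdist m (c (\<alpha> - s)) (c g) = \<alpha> - s - g" using ciso[of "\<alpha> - s" g] 2 that g0 ga
        by simp
      moreover have "mdist m (c g) (c' (t - \<alpha> + 2 * g)) = t - \<alpha> + g"
        using ciso'[of g "t - \<alpha> + 2 * g"] 2 that g0 ga cg by (simp add: L_def)
      ultimately show ?thesis using that by simp
    next
      case 3
      then show ?thesis using that ciso'[of "s - \<alpha> + 2 * g" "t - \<alpha> + 2 * g"] g0 ga
        by (simp add: q_def L_def)
    qed
  qed
  have lip': "mdist m (q s) (q t) \<le> \<bar>s - t\<bar>" if "s \<in> {0..L}" "t \<in> {0..L}" for s t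
    using lip[of s t] lip[of t s] that by (cases "s \<le> t") (auto simp: mdist_commute)
  have inj: "inj_on q {0..L}"
  proof (rule linorder_inj_onI)
    fix s t assume st: "s < t" "s \<in> {0..L}" "t \<in> {0..L}"
    have qt: "q t \<in> mspace m" using qM st by blast
    consider "t \<le> \<alpha> - g" | "s \<le> \<alpha> - g" "\<alpha> - g < t" | "\<alpha> - g < s" using st by linarith
    then show "q s \<noteq> q t"
    proof cases
      case 1
      then have "mdist m (q s) (q t) = t - s" using st ciso[of "\<alpha> - s" "\<alpha> - t"] g0
        by (simp add: q_def)
      then show ?thesis using st(1) mdist_zero[OF qt qt] by auto
    next
      case 2
      then show ?thesis using ne st by auto
    next
      case 3
      then have "mdist m (q s) (q t) = t - s"
        using st ciso'[of "s - \<alpha> + 2 * g" "t - \<alpha> + 2 * g"] g0 ga by (simp add: q_def L_def)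
      then show ?thesis using st(1) mdist_zero[OF qt qt] by auto
    qed
  qed auto
  have "0 \<le> L" using ga by (simp add: L_def)
  then have "q ` {0..L} = geod_seg m (q 0) (q L)"
    using metric_tree_path_image[OF tree] qM inj lip' by blast
  moreover have "q 0 = a" "q L = b"
    using c(3) c'(3) ga cg g0 by (auto simp: q_def L_def)
  moreover have "c g \<in> q ` {0..L}"
  proof (rule image_eqI)
    show "c g = q (\<alpha> - g)" by (simp add: q_def)
    show "\<alpha> - g \<in> {0..L}" using ga by (simp add: L_def)
  qed
  ultimately have "c g \<in> geod_seg m a b" by simp
  moreover have "c g \<in> geod_seg m p a" using c(1) g0 ga by auto
  moreover have "c g \<in> geod_seg m p b" using c'(1) g0 ga cg by auto
  ultimately show ?thesis by (auto simp: geod_seg_def)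
qed

text \<open>
  A geodesic space is a tree if and only if it satisfies the four-point condition; all
  geometric facts about trees below reduce to linear arithmetic through it.
\<close>

locale tree_metric =
  fixes m :: "'x metric"
  assumes nonempty: "mspace m \<noteq> {}"
    and geodesic_point: "\<lbrakk>x \<in> mspace m; y \<in> mspace m; 0 \<le> s; s \<le> mdist m x y\<rbrakk> \<Longrightarrow>
      \<exists>z \<in> mspace m. mdist m x z = s \<and> mdist m z y = mdist m x y - s"
    and four_point: "\<lbrakk>a \<in> mspace m; b \<in> mspace m; c \<in> mspace m; e \<in> mspace m\<rbrakk> \<Longrightarrow>
      mdist m a b + mdist m c e \<le> max (mdist m a c + mdist m b e) (mdist m a e + mdist m b c)"

text \<open>For the four-point condition take the median \<open>z\<close> of \<open>a\<close>,
  \<open>b\<close>, \<open>c\<close> and the median \<open>w\<close> of \<open>a\<close>,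
  \<open>b\<close>, \<open>e\<close>. Both lie on the segment from \<open>a\<close> to
  \<open>b\<close>. The route from \<open>c\<close> to \<open>e\<close> through them bounds
  \<open>mdist m c e\<close>, and their order on the segment decides which of the two sums is large
  enough.\<close>

lemma metric_tree_imp_tree_metric:
  fixes m :: "'x metric"
  assumes tree: "metric_tree m"
  shows "tree_metric m"
proof
  show "mspace m \<noteq> {}" using tree by (simp add: metric_tree_def)
next
  fix x y s assume xy: "x \<in> mspace m" "y \<in> mspace m" "0 \<le> s" "s \<le> mdist m x y"
  obtain c where c: "c ` {0..mdist m x y} = geod_seg m x y" "c 0 = x" "c (mdist m x y) = y"
    and iso: "\<And>s t. s \<in> {0..mdist m x y} \<Longrightarrow> t \<in> {0..mdist m x y} \<Longrightarrow> mdist m (c s) (c t) = \<bar>s - t\<bar>"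
    using metric_tree_geodesic[OF tree xy(1,2)] by metis
  have "c s \<in> geod_seg m x y" using c(1) xy by auto
  moreover have "mdist m x (c s) = s" using iso[of 0 s] xy c by simp
  ultimately show "\<exists>z \<in> mspace m. mdist m x z = s \<and> mdist m z y = mdist m x y - s"
    by (intro bexI[of _ "c s"]) (auto simp: geod_seg_def)
next
  fix a b c e assume *: "a \<in> mspace m" "b \<in> mspace m" "c \<in> mspace m" "e \<in> mspace m"
  obtain z where z: "z \<in> mspace m" "z \<in> geod_seg m a b" "z \<in> geod_seg m a c" "z \<in> geod_seg m b c"
    using metric_tree_median[OF tree *(1-3)] by blast
  obtain w where w: "w \<in> mspace m" "w \<in> geod_seg m a b" "w \<in> geod_seg m a e" "w \<in> geod_seg m b e"
    using metric_tree_median[OF tree *(1,2,4)] by blast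
  obtain q where q: "q ` {0..mdist m a b} = geod_seg m a b" "q 0 = a" "q (mdist m a b) = b"
    and iso: "\<And>s t. s \<in> {0..mdist m a b} \<Longrightarrow> t \<in> {0..mdist m a b} \<Longrightarrow> mdist m (q s) (q t) = \<bar>s - t\<bar>"
    using metric_tree_geodesic[OF tree *(1,2)] by metis
  obtain s t where st: "s \<in> {0..mdist m a b}" "t \<in> {0..mdist m a b}" "z = q s" "w = q t"
    using z(2) w(2) unfolding q(1)[symmetric] by blast
  have "mdist m z w = \<bar>s - t\<bar>" "mdist m a z = s" "mdist m a w = t"
    using iso[OF st(1,2)] iso[of 0 s] iso[of 0 t] st q(2) by auto
  moreover have "mdist m c e \<le> mdist m c z + mdist m z w + mdist m w e"
    using mdist_triangle[of c m z e] mdist_triangle[of z m w e] * z(1) w(1) by linarith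
  ultimately show "mdist m a b + mdist m c e \<le> max (mdist m a c + mdist m b e) (mdist m a e + mdist m b c)"
    using z(2-4) w(2-4) by (auto simp: geod_seg_def mdist_commute)
qed

section \<open>Segments, projections and convexity of the metric\<close>

context tree_metric
begin

abbreviation (input) d where "d \<equiv> mdist m"

lemma four_point_le:
  assumes "a \<in> mspace m" "b \<in> mspace m" "c \<in> mspace m" "e \<in> mspace m"
  shows "d a b + d c e \<le> d a c + d b e \<or> d a b + d c e \<le> d a e + d b c"
  using four_point[OF assms] by linarith

text \<open>The triangle inequality gives one direction, the four-point condition for
  \<open>a\<close>, \<open>b\<close>, \<open>x\<close>, \<open>c\<close> the other. Projections and
  thin triangles are computed from this formula.\<close>

lemma dist_to_segment:
  assumes "a \<in> mspace m" "b \<in> mspace m" "x \<in> geod_seg m a b" "c \<in> mspace m"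
  shows "d c x = max (d c a - d a x) (d c b - d x b)"
proof -
  have x: "x \<in> mspace m" "d a x + d x b = d a b" using assms(3) by (auto simp: geod_seg_def)
  show ?thesis
    using four_point_le[OF assms(1,2) x(1) assms(4)] mdist_triangle[OF assms(4) x(1) assms(1)]
      mdist_triangle[OF assms(4) x(1) assms(2)] x(2) mdist_commute[of m]
    by (smt (verit))
qed

lemma dist_on_segment:
  assumes "a \<in> mspace m" "b \<in> mspace m" "x \<in> geod_seg m a b" "y \<in> geod_seg m a b"
  shows "d x y = \<bar>d a x - d a y\<bar>"
proof -
  have "d x a = d a x" "d x b = d a b - d a x" "d y b = d a b - d a y" "d y a = d a y"
    "y \<in> mspace m" "x \<in> mspace m"
    using assms(3,4) by (auto simp: geod_seg_def mdist_commute)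
  then show ?thesis using dist_to_segment[OF assms(1,2,4), of x] by (auto simp: max_def)
qed

lemma segment_eqI:
  assumes "a \<in> mspace m" "b \<in> mspace m" "x \<in> geod_seg m a b" "y \<in> geod_seg m a b" "d a x = d a y"
  shows "x = y"
  using dist_on_segment[OF assms(1-4)] assms(3-5) by (auto simp: geod_seg_def)

lemma segment_commute: "geod_seg m a b = geod_seg m b a"
  by (auto simp: geod_seg_def mdist_commute)

lemma segment_sub: "geod_seg m a b \<subseteq> mspace m"
  by (auto simp: geod_seg_def)

lemma ends_in_segment:
  assumes "a \<in> mspace m" "b \<in> mspace m"
  shows "a \<in> geod_seg m a b" "b \<in> geod_seg m a b"
  using assms by (auto simp: geod_seg_def)

lemma segment_le:
  assumes "x \<in> geod_seg m a b"
  shows "d a x \<le> d a b" "d x b \<le> d a b"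
  using assms mdist_nonneg[of m a x] mdist_nonneg[of m x b] unfolding geod_seg_def mem_Collect_eq
  by linarith+

lemma segment_mono:
  assumes "a \<in> mspace m" "b \<in> mspace m" "x \<in> geod_seg m a b"
  shows "geod_seg m a x \<subseteq> geod_seg m a b"
proof
  fix y assume y: "y \<in> geod_seg m a x"
  then show "y \<in> geod_seg m a b"
    using assms mdist_triangle[of y m x b] mdist_triangle[of a m y b] by (auto simp: geod_seg_def)
qed

lemma segment_point:
  assumes "x \<in> mspace m" "y \<in> mspace m" "0 \<le> s" "s \<le> d x y"
  obtains z where "z \<in> geod_seg m x y" "d x z = s" "d z y = d x y - s"
  using geodesic_point[OF assms] by (auto simp: geod_seg_def)

lemma segment_proj:
  assumes "a \<in> mspace m" "b \<in> mspace m" "c \<in> mspace m"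
  obtains z where "z \<in> geod_seg m a b" "z \<in> geod_seg m a c" "z \<in> geod_seg m b c"
    and "\<And>x. x \<in> geod_seg m a b \<Longrightarrow> d c x = d c z + d z x"
proof -
  \<comment> \<open>The Gromov product of \<open>b\<close> and \<open>c\<close> at \<open>a\<close>,
    which is the distance from \<open>a\<close> at which the sides to \<open>b\<close> and to
    \<open>c\<close> part. There the two terms of the maximum in \<open>dist_to_segment\<close>
    agree.\<close>
  define s where "s = (d a b + d a c - d b c) / 2"
  have s: "0 \<le> s" "s \<le> d a b"
    using mdist_triangle[of b m a c] mdist_triangle[of a m b c] assms
    by (auto simp: s_def mdist_commute)
  obtain z where z: "z \<in> geod_seg m a b" "d a z = s" "d z b = d a b - s"
    using segment_point[OF assms(1,2) s] .
  have zM: "z \<in> mspace m" using z(1) segment_sub by blast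
  have cz: "d c z = max (d c a - s) (d c b - d a b + s)"
    using dist_to_segment[OF assms(1,2) z(1) assms(3)] z by simp
  have eq: "d c a - s = d c b - d a b + s" by (simp add: s_def mdist_commute field_simps)
  show thesis
  proof
    show "z \<in> geod_seg m a b" by fact
    show "z \<in> geod_seg m a c" "z \<in> geod_seg m b c"
      using z cz eq zM by (auto simp: geod_seg_def mdist_commute)
    fix x assume x: "x \<in> geod_seg m a b"
    have "d c x = max (d c a - d a x) (d c b - d x b)"
      by (rule dist_to_segment[OF assms(1,2) x assms(3)])
    moreover have "d z x = \<bar>d a z - d a x\<bar>" by (rule dist_on_segment[OF assms(1,2) z(1) x])
    moreover have "d x b = d a b - d a x" using x by (simp add: geod_seg_def)
    ultimately show "d c x = d c z + d z x" using cz eq z by linarith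
  qed
qed

lemma segment_union:
  assumes "a \<in> mspace m" "b \<in> mspace m" "c \<in> mspace m"
  shows "geod_seg m a b \<subseteq> geod_seg m a c \<union> geod_seg m c b"
proof
  fix x assume x: "x \<in> geod_seg m a b"
  have "d c x = max (d c a - d a x) (d c b - d x b)"
    by (rule dist_to_segment[OF assms(1,2) x assms(3)])
  then show "x \<in> geod_seg m a c \<union> geod_seg m c b" using x
    by (auto simp: geod_seg_def mdist_commute max_def split: if_splits)
qed

lemma segment_split:
  assumes "a \<in> mspace m" "b \<in> mspace m" "c \<in> geod_seg m a b"
  shows "geod_seg m a b = geod_seg m a c \<union> geod_seg m c b"
proof -
  have "c \<in> geod_seg m b a" "c \<in> mspace m" using assms(3) segment_commute segment_sub by blast+
  then show ?thesis
    using segment_union[OF assms(1,2), of c] segment_mono[OF assms] segment_mono[OF assms(2,1), of c]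
      segment_commute[of b] segment_commute[of c] by blast
qed

text \<open>In a tree, two geodesics that overlap in a nondegenerate segment join to a single one.
  If \<open>x\<close> and \<open>y\<close> coincided, the path could turn back there.\<close>

lemma geodesic_extend:
  assumes "a \<in> mspace m" "b \<in> mspace m" "x \<in> mspace m" "y \<in> mspace m" "x \<noteq> y"
    and "d a y = d a x + d x y" "d x b = d x y + d y b"
  shows "d a b = d a x + d x y + d y b"
  using four_point_le[of a y x b] mdist_triangle[of a m x b] mdist_triangle[of a m y b]
    mdist_zero[of x m y] mdist_nonneg[of m x y] assms mdist_commute[of m] by (smt (verit))

text \<open>By two applications of \<open>dist_to_segment\<close>, \<open>d x y\<close> is the
  largest of \<open>d p x - d p y\<close>, its negative and \<open>d a b - d x a - d y b\<close>.
  The first two scale by \<open>t\<close>; the third is at most \<open>t * d a b\<close> because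
  \<open>d a b \<le> d p a + d p b\<close>.\<close>

lemma thin_triangle:
  assumes "p \<in> mspace m" "a \<in> mspace m" "b \<in> mspace m" "x \<in> geod_seg m p a" "y \<in> geod_seg m p b"
    and t: "0 \<le> t" "t \<le> 1" "d p x = t * d p a" "d p y = t * d p b"
  shows "d x y \<le> t * d a b"
proof -
  obtain z where z: "z \<in> geod_seg m p a" "z \<in> geod_seg m p b" "z \<in> geod_seg m a b"
    using segment_proj[OF assms(2,3,1)] segment_commute by metis
  have xM: "x \<in> mspace m" and yM: "y \<in> mspace m" using assms(4,5) segment_sub by auto
  have zM: "z \<in> mspace m" using z segment_sub by auto
  have xa: "d x a = d p a - d p x" and yb: "d y b = d p b - d p y" using assms(4,5)
    by (auto simp: geod_seg_def)
  have xb: "d b x = max (d b p - d p x) (d b a - d x a)"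
    by (rule dist_to_segment[OF assms(1,2,4,3)])
  have xy: "d x y = max (d x p - d p y) (d x b - d y b)"
    by (rule dist_to_segment[OF assms(1,3,5) xM])
  have tri: "\<bar>d p a - d p b\<bar> \<le> d a b"
    using mdist_triangle[OF assms(1-3)] mdist_triangle[OF assms(1,3,2)]
    by (auto simp: mdist_commute)
  have A: "d p x - d p y \<le> t * d a b" "d p y - d p x \<le> t * d a b"
    using mult_left_mono[of "d p a - d p b" "d a b" t] mult_left_mono[of "d p b - d p a" "d a b" t] tri t
    by (simp_all add: algebra_simps)
  have "0 \<le> (1 - t) * (d p a + d p b - d a b)"
    using mdist_triangle[OF assms(2,1,3)] t by (simp add: mdist_commute)
  then have B: "d a b - d x a - d y b \<le> t * d a b" unfolding xa yb t(3,4)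
    by (simp add: algebra_simps)
  show ?thesis unfolding xy using A B xb yb mdist_commute[of m] by (auto simp: max_def)
qed

text \<open>Both geodesics are compared with the diagonal from \<open>a\<close> to \<open>b'\<close>.\<close>

lemma dist_convex:
  assumes "a \<in> mspace m" "b \<in> mspace m" "a' \<in> mspace m" "b' \<in> mspace m"
    and "x \<in> geod_seg m a b" "x' \<in> geod_seg m a' b'"
    and t: "0 \<le> t" "t \<le> 1" "d a x = t * d a b" "d a' x' = t * d a' b'"
  shows "d x x' \<le> max (d a a') (d b b')"
proof -
  have "0 \<le> t * d a b'" "t * d a b' \<le> d a b'" using t by (auto intro: mult_left_le_one_le)
  then obtain z where z: "z \<in> geod_seg m a b'" "d a z = t * d a b'" "d z b' = d a b' - t * d a b'"
    using segment_point[OF assms(1,4)] by metis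
  have M: "x \<in> mspace m" "x' \<in> mspace m" "z \<in> mspace m" using assms z segment_sub by auto
  have "d x z \<le> t * d b b'" by (rule thin_triangle[OF assms(1,2,4,5) z(1) t(1-3) z(2)])
  moreover have "d z x' \<le> (1 - t) * d a a'"
  proof (rule thin_triangle[OF assms(4,1,3)])
    show "z \<in> geod_seg m b' a" "x' \<in> geod_seg m b' a'" using z assms segment_commute by auto
    show "d b' z = (1 - t) * d b' a" "d b' x' = (1 - t) * d b' a'"
      using z assms(6) t(4) by (auto simp: geod_seg_def mdist_commute algebra_simps)
  qed (use t in auto)
  ultimately have "d x x' \<le> t * d b b' + (1 - t) * d a a'"
    using mdist_triangle[OF M(1,3,2)] by linarith
  also have "\<dots> \<le> max (d a a') (d b b')" using t by (intro convex_bound_le) auto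
  finally show ?thesis .
qed

end

section \<open>Simplicial trees\<close>

text \<open>\<open>edges\<close> consists of unoriented point sets. An adjacent pair is an edge with
  an order on its endpoints, the form in which computations on edges are carried out.\<close>

definition adjacent :: "('h, 'x) gtree \<Rightarrow> 'x \<Rightarrow> 'x \<Rightarrow> bool" where
  "adjacent X u w \<longleftrightarrow> u \<in> vset X \<and> w \<in> vset X \<and> u \<noteq> w \<and> geod_seg (met X) u w \<inter> vset X = {u, w}"

lemma edges_eq: "edges X = {geod_seg (met X) u w | u w. adjacent X u w}"
  by (simp add: edges_def adjacent_def)

lemma edgesE:
  assumes "e \<in> edges X"
  obtains u w where "adjacent X u w" "e = geod_seg (met X) u w"
  using assms by (auto simp: edges_eq)

lemma adjacent_edge: "adjacent X u w \<Longrightarrow> geod_seg (met X) u w \<in> edges X"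
  by (auto simp: edges_eq)

lemma finite_has_minimal_value:
  fixes f :: "'a \<Rightarrow> real"
  assumes "finite S" "S \<noteq> {}"
  obtains v where "v \<in> S" "\<And>w. w \<in> S \<Longrightarrow> f v \<le> f w"
  using arg_min_if_finite(1)[OF assms, of f] arg_min_least[OF assms, of _ f] that by blast

locale simplicial_tree =
  fixes X :: "('h, 'x) gtree"
  assumes simplicial: "metric_simplicial_tree X"
begin

sublocale tree_metric "met X"
  using simplicial by (intro metric_tree_imp_tree_metric) (simp add: metric_simplicial_tree_def)

abbreviation seg where "seg \<equiv> geod_seg (met X)"
abbreviation adj where "adj \<equiv> adjacent X"

lemma vset_pts: "v \<in> vset X \<Longrightarrow> v \<in> pts X"
  using simplicial by (auto simp: metric_simplicial_tree_def)

lemma seg_pts: "x \<in> seg a b \<Longrightarrow> x \<in> pts X"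
  using segment_sub by blast

lemma pts_cases:
  assumes "x \<in> pts X"
  obtains "x \<in> vset X" | u w where "adj u w" "x \<in> seg u w" "x \<notin> vset X"
proof -
  have "x \<in> vset X \<union> \<Union>(edges X)" using assms simplicial by (simp add: metric_simplicial_tree_def)
  then consider "x \<in> vset X" | e where "e \<in> edges X" "x \<in> e" "x \<notin> vset X" by blast
  then show thesis
  proof cases
    case 2
    then show thesis using that(2) by (metis edgesE)
  qed (rule that)
qed

lemma nonvertex_in_edge: "x \<in> pts X \<Longrightarrow> x \<notin> vset X \<Longrightarrow> \<exists>e \<in> edges X. x \<in> e"
  using simplicial unfolding metric_simplicial_tree_def by auto

lemma edges_inter:
  assumes "e \<in> edges X" "e' \<in> edges X" "x \<in> e" "x \<in> e'" "x \<notin> vset X"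
  shows "e = e'"
  using assms simplicial unfolding metric_simplicial_tree_def by blast

lemma finite_seg_vset: "x \<in> pts X \<Longrightarrow> y \<in> pts X \<Longrightarrow> finite (seg x y \<inter> vset X)"
  using simplicial by (simp add: metric_simplicial_tree_def)

lemma adj_commute: "adj u w \<Longrightarrow> adj w u"
  by (auto simp: adjacent_def segment_commute[of w u])

lemma adjD:
  assumes "adj u w"
  shows "u \<in> vset X" "w \<in> vset X" "u \<in> pts X" "w \<in> pts X" "u \<noteq> w" "seg u w \<inter> vset X = {u, w}"
    "0 < tdist X u w" "u \<in> seg u w" "w \<in> seg u w"
  using assms vset_pts ends_in_segment by (auto simp: adjacent_def order_less_le)

lemma edge_sub_pts: "e \<in> edges X \<Longrightarrow> e \<subseteq> pts X"
  by (auto simp: edges_eq seg_pts)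

lemma edge_ends_eq:
  assumes "adj u w" "adj u' w'" "seg u w = seg u' w'"
  shows "u = u' \<and> w = w' \<or> u = w' \<and> w = u'"
  using assms adjD(6)[OF assms(1)] adjD(6)[OF assms(2)] by (metis doubleton_eq_iff)

lemma edge_at_vertex:
  assumes "e \<in> edges X" "v \<in> e" "v \<in> vset X"
  obtains w where "adj v w" "e = seg v w"
proof -
  obtain u w where uw: "adj u w" "e = seg u w" using assms(1) by (rule edgesE)
  then have "v = u \<or> v = w" using assms(2,3) adjD(6)[OF uw(1)] by blast
  then show thesis using that uw adj_commute segment_commute by metis
qed

lemma vset_nonempty: "vset X \<noteq> {}"
proof -
  obtain x where "x \<in> pts X" using nonempty by blast
  then show ?thesis by (cases rule: pts_cases) (auto dest: adjD(1))
qed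

lemma closest_vertex:
  assumes "v \<in> vset X" "x \<in> pts X"
  obtains v' where "v' \<in> vset X" "v' \<in> seg v x" "seg v' x \<inter> vset X = {v'}"
proof -
  let ?S = "seg v x \<inter> vset X"
  have v: "v \<in> pts X" using assms vset_pts by blast
  have "finite ?S" "?S \<noteq> {}"
    using finite_seg_vset[OF v assms(2)] ends_in_segment[OF v assms(2)] assms(1) by auto
  then obtain v' where v': "v' \<in> ?S" "\<And>w. w \<in> ?S \<Longrightarrow> tdist X v' x \<le> tdist X w x"
    using finite_has_minimal_value[of ?S "\<lambda>w. tdist X w x"] by blast
  have "w = v'" if "w \<in> seg v' x" "w \<in> vset X" for w
  proof -
    have "v' \<in> seg x v" using v' segment_commute by blast
    then have "seg x v' \<subseteq> seg x v" using segment_mono[of x v v'] v assms by blast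
    then have "w \<in> seg v x" using that segment_commute by blast
    then have "tdist X v' x \<le> tdist X w x" using v' that by blast
    then have "tdist X v' w \<le> 0" using that by (simp add: geod_seg_def)
    then have "tdist X v' w = 0" using mdist_nonneg[of "met X" v' w] by linarith
    then show ?thesis using v' that vset_pts by auto
  qed
  moreover have "v' \<in> seg v' x" using v' assms seg_pts ends_in_segment by blast
  ultimately show thesis using that[of v'] v' by blast
qed

lemma next_vertex:
  assumes "u \<in> vset X" "x \<in> vset X" "u \<noteq> x"
  obtains w where "adj u w" "w \<in> seg u x"
proof -
  let ?S = "seg u x \<inter> vset X - {u}"
  have pts: "u \<in> pts X" "x \<in> pts X" using assms vset_pts by blast+
  have "finite ?S" "?S \<noteq> {}" using finite_seg_vset[OF pts] ends_in_segment[OF pts] assms by auto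
  then obtain w where w: "w \<in> ?S" "\<And>w'. w' \<in> ?S \<Longrightarrow> tdist X u w \<le> tdist X u w'"
    using finite_has_minimal_value[of ?S "\<lambda>w. tdist X u w"] by blast
  have "w' = w" if "w' \<in> seg u w" "w' \<in> vset X" "w' \<noteq> u" for w'
  proof -
    have "w' \<in> seg u x" using segment_mono[of u x w] w pts that by blast
    then have "tdist X u w \<le> tdist X u w'" using w that by blast
    then have "tdist X w' w \<le> 0" using that by (simp add: geod_seg_def)
    then have "tdist X w' w = 0" using mdist_nonneg[of "met X" w' w] by linarith
    then show ?thesis using w that vset_pts by auto
  qed
  moreover have "u \<in> seg u w" "w \<in> seg u w" using w pts seg_pts ends_in_segment by blast+
  ultimately have "adj u w" using w assms by (auto simp: adjacent_def)
  then show thesis using that w by blast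
qed

text \<open>If the projection \<open>z\<close> of \<open>y\<close> were interior to the edge, the
  last vertex \<open>v\<close> on the way from \<open>y\<close> to \<open>z\<close> would together
  with \<open>u\<close> bound an edge through \<open>z\<close>. Edges that share a non-vertex are
  equal, so \<open>v\<close> would be \<open>u\<close> or \<open>w\<close>; but both of these lie
  beyond \<open>z\<close> as seen from \<open>y\<close>.\<close>

lemma edge_gate_vertex:
  assumes uw: "adj u w" and y: "y \<in> vset X"
  shows "(\<forall>x \<in> seg u w. tdist X y x = tdist X y u + tdist X u x) \<or>
    (\<forall>x \<in> seg u w. tdist X y x = tdist X y w + tdist X w x)"
proof -
  note uwD = adjD[OF uw]
  have yp: "y \<in> pts X" using y vset_pts by blast
  obtain z where z: "z \<in> seg u w"
    and zx: "\<And>x. x \<in> seg u w \<Longrightarrow> tdist X y x = tdist X y z + tdist X z x"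
    using segment_proj[OF uwD(3,4) yp] by metis
  have zp: "z \<in> pts X" using z seg_pts by blast
  have "z = u \<or> z = w"
  proof (rule ccontr)
    assume nz: "\<not> (z = u \<or> z = w)"
    then have zV: "z \<notin> vset X" using z uwD(6) by blast
    obtain v where v: "v \<in> vset X" "v \<in> seg y z" "seg v z \<inter> vset X = {v}"
      using closest_vertex[OF y zp] .
    have vp: "v \<in> pts X" using v vset_pts by blast
    have yv: "tdist X y v + tdist X v z = tdist X y z" using v(2) by (simp add: geod_seg_def)
    have vx: "tdist X v x = tdist X v z + tdist X z x" if "x \<in> seg u w" for x
      using zx[OF that] yv mdist_triangle[of y "met X" v x] mdist_triangle[of v "met X" z x]
        seg_pts[OF that] yp vp zp by linarith
    have zu: "z \<in> seg v u" using vx[OF uwD(8)] zp by (simp add: geod_seg_def)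
    have zpos: "tdist X z u > 0" "tdist X z w > 0" using nz zp uwD by (auto simp: order_less_le)
    have vu: "v \<noteq> u" "v \<noteq> w"
      using vx[OF uwD(8)] vx[OF uwD(9)] zpos mdist_nonneg[of "met X" v z] uwD mdist_zero[of u "met X" u]
        mdist_zero[of w "met X" w] by fastforce+
    have "seg z u \<subseteq> seg u w" using segment_mono[OF uwD(3,4) z] segment_commute by blast
    moreover have "w \<notin> seg z u"
      using z zpos mdist_nonneg[of "met X" z w] by (auto simp: geod_seg_def mdist_commute)
    moreover have "u \<in> seg z u" using ends_in_segment zp uwD by blast
    ultimately have "seg z u \<inter> vset X = {u}" using uwD by blast
    then have "seg v u \<inter> vset X = {v, u}" using segment_split[OF vp uwD(3) zu] v(3) by blast
    then have "adj v u" using v(1) uwD(1) vu by (simp add: adjacent_def)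
    then have "seg v u = seg u w"
      using edges_inter adjacent_edge uw zu z zV by metis
    then have "v \<in> {u, w}" using uwD(6) v(1) ends_in_segment(1)[OF vp uwD(3)] by blast
    then show False using vu by blast
  qed
  then show ?thesis using zx by blast
qed

text \<open>Reduced to vertices: if a non-vertex \<open>y\<close> projected to an interior point
  \<open>z\<close>, some endpoint \<open>v\<close> of the edge through \<open>y\<close> would lie
  behind \<open>y\<close> as seen from \<open>z\<close>, and by \<open>geodesic_extend\<close> it
  would project to \<open>z\<close> as well.\<close>

lemma edge_gate:
  assumes uw: "adj u w" and y: "y \<in> pts X" "y \<notin> seg u w"
  shows "(\<forall>x \<in> seg u w. tdist X y x = tdist X y u + tdist X u x) \<or>
    (\<forall>x \<in> seg u w. tdist X y x = tdist X y w + tdist X w x)"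
  using y(1)
proof (cases rule: pts_cases)
  case 1
  then show ?thesis using edge_gate_vertex uw by blast
next
  case (2 u' w')
  note uwD = adjD[OF uw] and uwD' = adjD[OF 2(1)]
  obtain z where z: "z \<in> seg u w"
    and zx: "\<And>x. x \<in> seg u w \<Longrightarrow> tdist X y x = tdist X y z + tdist X z x"
    using segment_proj[OF uwD(3,4) y(1)] by metis
  have zp: "z \<in> pts X" using z seg_pts by blast
  have zy: "z \<noteq> y" using z y by blast
  have "z = u \<or> z = w"
  proof (rule ccontr)
    assume nz: "\<not> (z = u \<or> z = w)"
    have zpos: "tdist X z u > 0" "tdist X z w > 0" using nz zp uwD by (auto simp: order_less_le)
    obtain z' where z': "z' \<in> seg u' w'"
      and zx': "\<And>x. x \<in> seg u' w' \<Longrightarrow> tdist X z x = tdist X z z' + tdist X z' x"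
      using segment_proj[OF uwD'(3,4) zp] by metis
    have "\<exists>v \<in> {u', w'}. tdist X z v = tdist X z y + tdist X y v"
    proof -
      have "tdist X z' y = \<bar>tdist X u' z' - tdist X u' y\<bar>" "tdist X u' z' + tdist X z' w' = tdist X u' w'"
        "tdist X u' y + tdist X y w' = tdist X u' w'"
        using dist_on_segment[OF uwD'(3,4) z' 2(2)] z' 2(2) by (auto simp: geod_seg_def)
      then have "tdist X z u' = tdist X z y + tdist X y u' \<or> tdist X z w' = tdist X z y + tdist X y w'"
        using zx'[OF 2(2)] zx'[OF uwD'(8)] zx'[OF uwD'(9)] mdist_commute[of "met X"]
        by (auto simp: abs_if split: if_splits)
      then show ?thesis by blast
    qed
    then obtain v where v: "v \<in> {u', w'}" "tdist X z v = tdist X z y + tdist X y v" by blast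
    have vV: "v \<in> vset X" "v \<in> pts X" using v uwD' by auto
    have xv: "tdist X x v = tdist X x z + tdist X z v" if "x \<in> seg u w" for x
      using geodesic_extend[of x v z y] seg_pts[OF that] vV zp y(1) zy zx[OF that] v(2)
      by (simp add: mdist_commute)
    have "tdist X v z = tdist X v u + tdist X u z \<or> tdist X v z = tdist X v w + tdist X w z"
      using edge_gate_vertex[OF uw vV(1)] z by blast
    then show False using xv[OF uwD(8)] xv[OF uwD(9)] zpos
      by (auto simp: mdist_commute)
  qed
  then show ?thesis using zx by blast
qed

lemma vertex_between:
  assumes "x \<in> pts X" "y \<in> pts X" "\<nexists>e. e \<in> edges X \<and> x \<in> e \<and> y \<in> e" "x \<notin> vset X"
  obtains v where "v \<in> vset X" "v \<in> seg x y" "\<exists>e \<in> edges X. x \<in> e \<and> v \<in> e"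
  using assms(1)
proof (cases rule: pts_cases)
  case 1
  then show ?thesis using assms(4) by simp
next
  case (2 u w)
  note uwD = adjD[OF 2(1)]
  note e = adjacent_edge[OF 2(1)]
  have "y \<notin> seg u w" using assms(3) e 2(2) by auto
  then have "tdist X y x = tdist X y u + tdist X u x \<or> tdist X y x = tdist X y w + tdist X w x"
    using edge_gate[OF 2(1) assms(2)] 2(2) by blast
  then have "u \<in> seg x y \<or> w \<in> seg x y" using uwD by (auto simp: geod_seg_def mdist_commute)
  then show ?thesis
  proof
    assume "u \<in> seg x y"
    then show ?thesis using that[of u] uwD(1,8) e 2(2) by auto
  next
    assume "w \<in> seg x y"
    then show ?thesis using that[of w] uwD(2,9) e 2(2) by auto
  qed
qed

text \<open>A segment is cut at its finitely many vertices, and the estimates for the pieces add up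
  along the geodesic. The induction treats segments between vertices; the two ends are then released
  one after the other.\<close>

lemma Lipschitz_from_edges:
  assumes F: "\<And>x. x \<in> pts X \<Longrightarrow> F x \<in> mspace m'"
    and edge: "\<And>u w a b. adj u w \<Longrightarrow> a \<in> seg u w \<Longrightarrow> b \<in> seg u w \<Longrightarrow> mdist m' (F a) (F b) \<le> L * tdist X a b"
    and ab: "a \<in> pts X" "b \<in> pts X"
  shows "mdist m' (F a) (F b) \<le> L * tdist X a b"
proof -
  have split: "mdist m' (F x) (F y) \<le> L * tdist X x y"
    if "mdist m' (F x) (F v) \<le> L * tdist X x v" "mdist m' (F v) (F y) \<le> L * tdist X v y"
      "v \<in> seg x y" "x \<in> pts X" "y \<in> pts X" for x y v
  proof -
    have "mdist m' (F x) (F y) \<le> mdist m' (F x) (F v) + mdist m' (F v) (F y)"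
      using that seg_pts F by (intro mdist_triangle) blast+
    also have "\<dots> \<le> L * (tdist X x v + tdist X v y)" using that by (simp add: distrib_left)
    finally show ?thesis using that(3) by (simp add: geod_seg_def)
  qed
  have edge': "mdist m' (F x) (F y) \<le> L * tdist X x y" if "e \<in> edges X" "x \<in> e" "y \<in> e" for e x y
    using that edge by (auto elim: edgesE)
  have VV: "mdist m' (F x) (F y) \<le> L * tdist X x y" if "x \<in> vset X" "y \<in> vset X" for x y
    using that
  proof (induction "card (seg x y \<inter> vset X)" arbitrary: x rule: less_induct)
    case less
    have p: "x \<in> pts X" "y \<in> pts X" using less.prems vset_pts by auto
    show ?case
    proof (cases "x = y")
      case True
      then have "mdist m' (F x) (F y) = 0" "tdist X x y = 0" using F p by simp_all
      then show ?thesis by simp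
    next
      case False
      obtain w where w: "adj x w" "w \<in> seg x y" by (rule next_vertex[OF less.prems False])
      note wD = adjD[OF w(1)]
      have sub: "seg w y \<subseteq> seg x y" using segment_mono[OF p(2,1), of w] w(2) segment_commute
        by blast
      have "x \<notin> seg w y"
        using w(2) wD(7) by (auto simp: geod_seg_def mdist_commute)
      then have "seg w y \<inter> vset X \<subset> seg x y \<inter> vset X"
        using sub less.prems ends_in_segment[OF p] by blast
      then have "card (seg w y \<inter> vset X) < card (seg x y \<inter> vset X)"
        by (rule psubset_card_mono[OF finite_seg_vset[OF p]])
      then have "mdist m' (F w) (F y) \<le> L * tdist X w y" using less wD by blast
      moreover have "mdist m' (F x) (F w) \<le> L * tdist X x w" using edge w wD by blast
      ultimately show ?thesis using split w p by blast
    qed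
  qed
  have via_vertex: "mdist m' (F x) (F y) \<le> L * tdist X x y" if x: "x \<in> pts X" and y: "y \<in> pts X"
    and V: "\<And>v. v \<in> vset X \<Longrightarrow> mdist m' (F v) (F y) \<le> L * tdist X v y" for x y
  proof (cases "x \<in> vset X \<or> (\<exists>e \<in> edges X. x \<in> e \<and> y \<in> e)")
    case True
    then show ?thesis using V edge' by blast
  next
    case False
    obtain v where v: "v \<in> vset X" "v \<in> seg x y" "\<exists>e \<in> edges X. x \<in> e \<and> v \<in> e"
      by (rule vertex_between[OF x y]) (use False in blast)+
    then have "mdist m' (F x) (F v) \<le> L * tdist X x v" using edge' by blast
    then show ?thesis using split V v x y by blast
  qed
  have "mdist m' (F v) (F b) \<le> L * tdist X v b" if "v \<in> vset X" for v
    using via_vertex[OF ab(2) vset_pts[OF that]] VV that by (simp add: mdist_commute)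
  then show ?thesis by (rule via_vertex[OF ab])
qed

text \<open>Distances from \<open>x\<close> fill an interval along the segment, which has only
  finitely many vertices. As a non-vertex determines its edge, such points serve to recognise
  edges.\<close>

lemma interior_point:
  assumes "x \<in> pts X" "y \<in> pts X" "x \<noteq> y"
  obtains z where "z \<in> seg x y" "z \<notin> vset X"
proof -
  have "\<not> seg x y \<subseteq> vset X"
  proof
    assume "seg x y \<subseteq> vset X"
    then have "finite (seg x y)" using finite_seg_vset[OF assms(1,2)] by (simp add: Int_absorb2)
    then have "finite (tdist X x ` seg x y)" by blast
    moreover have "{0..tdist X x y} \<subseteq> tdist X x ` seg x y"
    proof
      fix s assume "s \<in> {0..tdist X x y}"
      then obtain z where "z \<in> seg x y" "tdist X x z = s" using segment_point[OF assms(1,2)] by auto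
      then show "s \<in> tdist X x ` seg x y" by blast
    qed
    ultimately have "finite {0..tdist X x y}" by (rule finite_subset[rotated])
    moreover have "0 < tdist X x y" using assms by (simp add: order_less_le)
    ultimately show False by (simp add: infinite_Icc)
  qed
  then show thesis using that by blast
qed

lemma edge_length_eq:
  assumes "adj u w"
  shows "edge_length X (seg u w) = tdist X u w"
proof -
  note D = adjD[OF assms]
  have "tdist X a b \<le> tdist X u w" if "a \<in> seg u w" "b \<in> seg u w" for a b
  proof -
    have "tdist X u a + tdist X a w = tdist X u w" "tdist X u b + tdist X b w = tdist X u w"
      using that by (auto simp: geod_seg_def)
    then show ?thesis
      using dist_on_segment[OF D(3,4) that] mdist_nonneg[of "met X" a w] mdist_nonneg[of "met X" b w]
        mdist_nonneg[of "met X" u a] mdist_nonneg[of "met X" u b] by linarith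
  qed
  moreover have "(u, w) \<in> seg u w \<times> seg u w" using D by blast
  ultimately show ?thesis unfolding edge_length_def
    by (intro cSup_eq_maximum) (auto intro!: image_eqI[of _ _ "(u, w)"])
qed

end

section \<open>Trees with a group action\<close>

locale tree_action = simplicial_tree X for X :: "('h, 'x) gtree" +
  fixes H :: "'h monoid"
  assumes action: "simplicial_isometric_action H X"
    and trivial_edges: "trivial_edge_stabilisers H X"
begin

sublocale act: group_action H "pts X" "act X"
  using action by (simp add: simplicial_isometric_action_def)

sublocale H: group H
  using act.group_hom by (simp add: group_hom_def)

abbreviation a where "a \<equiv> act X"

lemma act_closed: "h \<in> carrier H \<Longrightarrow> x \<in> pts X \<Longrightarrow> a h x \<in> pts X"
  using act.element_image by blast

lemma act_mult: "g \<in> carrier H \<Longrightarrow> h \<in> carrier H \<Longrightarrow> x \<in> pts X \<Longrightarrow> a (g \<otimes>\<^bsub>H\<^esub> h) x = a g (a h x)"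
  by (rule act.composition_rule)

lemma act_one: "x \<in> pts X \<Longrightarrow> a \<one>\<^bsub>H\<^esub> x = x"
  using act.id_eq_one by (metis restrict_apply')

lemma act_inv: "h \<in> carrier H \<Longrightarrow> x \<in> pts X \<Longrightarrow> a (inv\<^bsub>H\<^esub> h) (a h x) = x"
  using act.orbit_sym_aux by blast

lemma act_inv': "h \<in> carrier H \<Longrightarrow> x \<in> pts X \<Longrightarrow> a h (a (inv\<^bsub>H\<^esub> h) x) = x"
  using act_inv[of "inv\<^bsub>H\<^esub> h" x] by simp

lemma act_dist: "h \<in> carrier H \<Longrightarrow> x \<in> pts X \<Longrightarrow> y \<in> pts X \<Longrightarrow> tdist X (a h x) (a h y) = tdist X x y"
  using action by (simp add: simplicial_isometric_action_def)

lemma act_vset: "h \<in> carrier H \<Longrightarrow> v \<in> vset X \<Longrightarrow> a h v \<in> vset X"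
  using action by (auto simp: simplicial_isometric_action_def)

lemma act_vset_iff: "h \<in> carrier H \<Longrightarrow> x \<in> pts X \<Longrightarrow> a h x \<in> vset X \<longleftrightarrow> x \<in> vset X"
  using act_vset act_inv by (metis H.inv_closed)

lemma act_in_seg:
  assumes "h \<in> carrier H" "x \<in> pts X" "y \<in> pts X" "z \<in> seg x y"
  shows "a h z \<in> seg (a h x) (a h y)"
  using assms by (simp add: geod_seg_def act_closed act_dist)

lemma act_seg:
  assumes h: "h \<in> carrier H" "x \<in> pts X" "y \<in> pts X"
  shows "a h ` seg x y = seg (a h x) (a h y)"
proof
  show "a h ` seg x y \<subseteq> seg (a h x) (a h y)" using act_in_seg assms by blast
  show "seg (a h x) (a h y) \<subseteq> a h ` seg x y"
  proof
    fix z assume z: "z \<in> seg (a h x) (a h y)"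
    then have "a (inv\<^bsub>H\<^esub> h) z \<in> seg x y"
      using act_in_seg[of "inv\<^bsub>H\<^esub> h" "a h x" "a h y" z] assms act_inv act_closed by simp
    moreover have "a h (a (inv\<^bsub>H\<^esub> h) z) = z" using act_inv' h z seg_pts by blast
    ultimately show "z \<in> a h ` seg x y" by (metis imageI)
  qed
qed

lemma act_adj:
  assumes h: "h \<in> carrier H" and uw: "adj u w"
  shows "adj (a h u) (a h w)"
proof -
  note D = adjD[OF uw]
  have ne: "a h u \<noteq> a h w" using act_inv h D by metis
  have "seg (a h u) (a h w) \<inter> vset X \<subseteq> {a h u, a h w}"
  proof
    fix z assume z: "z \<in> seg (a h u) (a h w) \<inter> vset X"
    then obtain y where "z = a h y" "y \<in> seg u w" using act_seg[OF h D(3,4)] by blast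
    moreover from this have "y \<in> vset X" using z act_vset_iff h seg_pts by blast
    ultimately have "y \<in> {u, w}" using D(6) by blast
    then show "z \<in> {a h u, a h w}" using \<open>z = a h y\<close> by auto
  qed
  moreover have "a h u \<in> vset X" "a h w \<in> vset X" using act_vset h D by auto
  ultimately show ?thesis using ne ends_in_segment vset_pts unfolding adjacent_def by blast
qed

lemma act_edge: "h \<in> carrier H \<Longrightarrow> e \<in> edges X \<Longrightarrow> a h ` e \<in> edges X"
  using act_adj act_seg adjD adjacent_edge by (metis edgesE)

lemma act_image_mult:
  assumes "g \<in> carrier H" "h \<in> carrier H" "e \<subseteq> pts X"
  shows "a g ` a h ` e = a (g \<otimes>\<^bsub>H\<^esub> h) ` e"
  using assms act_mult by (auto simp: image_image subset_iff intro!: image_cong)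

lemma act_image_one: "e \<subseteq> pts X \<Longrightarrow> a \<one>\<^bsub>H\<^esub> ` e = e"
  using act_one by (simp add: subset_iff image_def)

text \<open>\<open>h\<close> fixes every point of the segment from \<open>x\<close> to
  \<open>y\<close>, as it preserves the distance from \<open>x\<close>. One of these points is not a
  vertex, and the only edge containing it is then mapped to itself.\<close>

lemma act_eq_one_if_fixes_two:
  assumes h: "h \<in> carrier H" and x: "x \<in> pts X" "a h x = x" and y: "y \<in> pts X" "a h y = y"
    and "x \<noteq> y"
  shows "h = \<one>\<^bsub>H\<^esub>"
proof -
  obtain z where z: "z \<in> seg x y" "z \<notin> vset X" using interior_point x y \<open>x \<noteq> y\<close> by metis
  have zp: "z \<in> pts X" using z seg_pts by blast
  have "a h z \<in> seg x y" using act_in_seg[OF h x(1) y(1) z(1)] x y by simp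
  moreover have "tdist X x (a h z) = tdist X x z" using act_dist[OF h x(1) zp] x by simp
  ultimately have hz: "a h z = z" using segment_eqI[of x y] x y z by metis
  obtain e where e: "e \<in> edges X" "z \<in> e"
    using nonvertex_in_edge[OF zp z(2)] by blast
  then have "z \<in> a h ` e" using hz by (metis imageI)
  then have "a h ` e = e" using edges_inter act_edge[OF h e(1)] e z by blast
  then show ?thesis using trivial_edges e(1) h by (simp add: trivial_edge_stabilisers_def)
qed

section \<open>Edge orbits, their lengths and the volume of subgraphs of the quotient\<close>

definition edge_orbit :: "'x set \<Rightarrow> 'x set set" where
  "edge_orbit e = {a h ` e | h. h \<in> carrier H}"

lemma edge_orbits_eq: "edge_orbits H X = edge_orbit ` edges X"
  by (auto simp: edge_orbits_def edge_orbit_def)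

lemma edge_orbit_self: "e \<in> edges X \<Longrightarrow> e \<in> edge_orbit e"
  using act_image_one[OF edge_sub_pts] H.one_closed unfolding edge_orbit_def by fastforce

lemma edge_orbits_sub: "E \<in> edge_orbits H X \<Longrightarrow> e \<in> E \<Longrightarrow> e \<in> edges X"
  using act_edge by (auto simp: edge_orbits_eq edge_orbit_def)

lemma edge_orbits_act:
  assumes "E \<in> edge_orbits H X" "e \<in> E" "h \<in> carrier H"
  shows "a h ` e \<in> E"
proof -
  obtain e0 where e0: "e0 \<in> edges X" "E = edge_orbit e0" using assms by (auto simp: edge_orbits_eq)
  then obtain g where "g \<in> carrier H" "e = a g ` e0" using assms by (auto simp: edge_orbit_def)
  then have "a h ` e = a (h \<otimes>\<^bsub>H\<^esub> g) ` e0" using act_image_mult assms e0 edge_sub_pts by metis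
  then show ?thesis using e0 assms \<open>g \<in> carrier H\<close> by (auto simp: edge_orbit_def)
qed

lemma edge_orbits_trans:
  assumes "E \<in> edge_orbits H X" "e \<in> E" "e' \<in> E"
  obtains h where "h \<in> carrier H" "e' = a h ` e"
proof -
  obtain e0 where e0: "e0 \<in> edges X" "E = edge_orbit e0" using assms by (auto simp: edge_orbits_eq)
  obtain g where g: "g \<in> carrier H" "e = a g ` e0" using assms e0 by (auto simp: edge_orbit_def)
  obtain g' where g': "g' \<in> carrier H" "e' = a g' ` e0" using assms e0
    by (auto simp: edge_orbit_def)
  have "a (g' \<otimes>\<^bsub>H\<^esub> inv\<^bsub>H\<^esub> g) ` e = a (g' \<otimes>\<^bsub>H\<^esub> inv\<^bsub>H\<^esub> g \<otimes>\<^bsub>H\<^esub> g) ` e0"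
    using act_image_mult e0 edge_sub_pts g g' by (metis H.inv_closed H.m_closed)
  also have "\<dots> = e'" using g g' by (simp add: H.m_assoc)
  finally show thesis using that[of "g' \<otimes>\<^bsub>H\<^esub> inv\<^bsub>H\<^esub> g"] g g' by simp
qed

lemma edge_orbit_eqI:
  assumes "E \<in> edge_orbits H X" "e \<in> E"
  shows "edge_orbit e = E"
proof
  show "edge_orbit e \<subseteq> E" using edge_orbits_act[OF assms] unfolding edge_orbit_def by blast
  show "E \<subseteq> edge_orbit e"
  proof
    fix e' assume "e' \<in> E"
    then obtain h where "h \<in> carrier H" "e' = a h ` e" using edge_orbits_trans[OF assms] by metis
    then show "e' \<in> edge_orbit e" unfolding edge_orbit_def by blast
  qed
qed

lemma edge_length_act:
  assumes "h \<in> carrier H" "e \<in> edges X"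
  shows "edge_length X (a h ` e) = edge_length X e"
proof -
  obtain u w where uw: "adj u w" "e = seg u w" using assms by (auto elim: edgesE)
  then show ?thesis using act_seg act_adj edge_length_eq act_dist adjD assms by metis
qed

lemma the_edge_length:
  assumes "E \<in> edge_orbits H X" "e \<in> E"
  shows "the_elem (edge_length X ` E) = edge_length X e"
proof -
  have "edge_length X ` E = {edge_length X e}"
  proof -
    have "edge_length X e' = edge_length X e" if "e' \<in> E" for e'
      using edge_orbits_trans[OF assms that] edge_length_act[OF _ edge_orbits_sub[OF assms]]
      by metis
    then show ?thesis using assms(2) by blast
  qed
  then show ?thesis by simp
qed

text \<open>A set \<open>S\<close> of edge orbits stands for a subgraph of the quotient graph; for
  \<open>edge_orbits H X\<close> the value is the contribution of this tree to
  \<open>vol\<close>.\<close>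

definition volume :: "'x set set set \<Rightarrow> real" where
  "volume S = (\<Sum>E \<in> S. the_elem (edge_length X ` E))"

lemma orbit_length_pos:
  assumes "E \<in> edge_orbits H X"
  shows "the_elem (edge_length X ` E) > 0"
proof -
  obtain e where e: "e \<in> edges X" "E = edge_orbit e" using assms by (auto simp: edge_orbits_eq)
  obtain u w where "adj u w" "e = seg u w" using e by (auto elim: edgesE)
  then show ?thesis using the_edge_length[OF assms] edge_orbit_self[OF e(1)] e edge_length_eq adjD
    by metis
qed

lemma volume_mono: "S \<subseteq> edge_orbits H X \<Longrightarrow> S' \<subseteq> S \<Longrightarrow> finite S \<Longrightarrow> volume S' \<le> volume S"
  unfolding volume_def using orbit_length_pos by (intro sum_mono2) (auto intro: less_imp_le)

lemma volume_nonneg: "S \<subseteq> edge_orbits H X \<Longrightarrow> 0 \<le> volume S"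
  unfolding volume_def using orbit_length_pos by (intro sum_nonneg) (auto intro: less_imp_le)

text \<open>Only one group element can carry a given point to \<open>v\<close>, so each edge orbit
  contributes at most two edges at \<open>v\<close>, one for each endpoint of a
  representative.\<close>

lemma finite_star:
  assumes fin: "finite (edge_orbits H X)" and v: "v \<in> vset X" and stab: "stabilizer H a v = {\<one>\<^bsub>H\<^esub>}"
  shows "finite {w. adj v w}"
proof -
  have vp: "v \<in> pts X" using v vset_pts by blast
  have uniq: "g = h"
    if "g \<in> carrier H" "h \<in> carrier H" "x \<in> pts X" "a g x = v" "a h x = v" for g h x
  proof -
    have "a (inv\<^bsub>H\<^esub> g) v = x" using that act_inv by blast
    then have "a (h \<otimes>\<^bsub>H\<^esub> inv\<^bsub>H\<^esub> g) v = v" using that act_mult vp by simp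
    then have "h \<otimes>\<^bsub>H\<^esub> inv\<^bsub>H\<^esub> g \<in> stabilizer H a v" using that by (simp add: stabilizer_def)
    then show ?thesis using stab that H.inv_equality H.inv_inv
      by (metis H.inv_closed singletonD)
  qed
  \<comment> \<open>The far ends of those translates of the pair \<open>u\<close>, \<open>w\<close>
    that start at \<open>v\<close>: at most one point.\<close>
  define P where "P u w = {a h w | h. h \<in> carrier H \<and> a h u = v}" for u w
  have finP: "finite (P u w)" if "u \<in> pts X" for u w
  proof -
    have "P u w \<subseteq> {x} " if "x \<in> P u w" for x
      using that uniq \<open>u \<in> pts X\<close> unfolding P_def by blast
    then show ?thesis by (metis finite.emptyI finite.insertI finite_subset subsetI empty_iff)
  qed
  have "\<exists>u w. adj u w \<and> seg u w \<in> E" if "E \<in> edge_orbits H X" for E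
  proof -
    from that obtain e where e: "e \<in> edges X" "E = edge_orbit e" unfolding edge_orbits_eq by blast
    show ?thesis using edge_orbit_self[OF e(1)] e by (auto elim!: edgesE)
  qed
  then obtain U W where UW: "\<And>E. E \<in> edge_orbits H X \<Longrightarrow> adj (U E) (W E) \<and> seg (U E) (W E) \<in> E"
    by metis
  have "{w. adj v w} \<subseteq> (\<Union>E \<in> edge_orbits H X. P (U E) (W E) \<union> P (W E) (U E))"
  proof
    fix w assume "w \<in> {w. adj v w}"
    then have vw: "adj v w" by simp
    define E where "E = edge_orbit (seg v w)"
    have e: "seg v w \<in> edges X" by (rule adjacent_edge[OF vw])
    have E: "E \<in> edge_orbits H X" "seg v w \<in> E" using e edge_orbit_self
      by (auto simp: E_def edge_orbits_eq)
    obtain h where h: "h \<in> carrier H" "seg v w = a h ` seg (U E) (W E)"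
      using edge_orbits_trans[OF E(1) conjunct2[OF UW[OF E(1)]] E(2)] by blast
    then have "seg v w = seg (a h (U E)) (a h (W E))" using act_seg[OF h(1)] UW[OF E(1)] adjD(3,4)
      by metis
    then have "v = a h (U E) \<and> w = a h (W E) \<or> v = a h (W E) \<and> w = a h (U E)"
      using edge_ends_eq[OF vw] act_adj h UW[OF E(1)] by blast
    then have "w \<in> P (U E) (W E) \<union> P (W E) (U E)" using h unfolding P_def by blast
    then show "w \<in> (\<Union>E \<in> edge_orbits H X. P (U E) (W E) \<union> P (W E) (U E))" using E by blast
  qed
  moreover have "finite (\<Union>E \<in> edge_orbits H X. P (U E) (W E) \<union> P (W E) (U E))"
    using fin finP UW adjD by blast
  ultimately show ?thesis by (rule finite_subset)
qed

lemma vertex_separation: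
  assumes fin: "finite (edge_orbits H X)"
  obtains c where "c > 0" "\<And>u w. u \<in> vset X \<Longrightarrow> w \<in> vset X \<Longrightarrow> u \<noteq> w \<Longrightarrow> c \<le> tdist X u w"
proof -
  \<comment> \<open>Distinct vertices are at least as far apart as the first edge on the way is
    long. The inserted 1 serves trees without edges.\<close>
  let ?L = "insert 1 ((\<lambda>E. the_elem (edge_length X ` E)) ` edge_orbits H X)"
  have finL: "finite ?L" using fin by blast
  have "Min ?L > 0" using finL orbit_length_pos by (subst Min_gr_iff) auto
  moreover have "Min ?L \<le> tdist X u w" if uw: "u \<in> vset X" "w \<in> vset X" "u \<noteq> w" for u w
  proof -
    obtain v where v: "adj u v" "v \<in> seg u w" by (rule next_vertex[OF uw])
    let ?e = "seg u v"
    have e: "?e \<in> edges X" "edge_length X ?e = tdist X u v" using v adjacent_edge edge_length_eq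
      by auto
    have "edge_orbit ?e \<in> edge_orbits H X" using e edge_orbits_eq by blast
    moreover from this have "the_elem (edge_length X ` edge_orbit ?e) = tdist X u v"
      using the_edge_length edge_orbit_self e by metis
    ultimately have "Min ?L \<le> tdist X u v" using Min_le[OF finL]
      by (metis (no_types, lifting) imageI insertI2)
    also have "\<dots> \<le> tdist X u w" using segment_le(1)[OF v(2)] .
    finally show ?thesis .
  qed
  ultimately show thesis using that by blast
qed

section \<open>Completeness of the trees\<close>

lemma edge_Cauchy_convergent:
  assumes "adj u w" and y: "\<And>n. n \<ge> N \<Longrightarrow> y n \<in> seg u w"
    and Cauchy: "\<And>e. e > 0 \<Longrightarrow> \<exists>N. \<forall>n \<ge> N. \<forall>k \<ge> N. tdist X (y n) (y k) < e"
  shows "\<exists>z \<in> pts X. (\<lambda>n. tdist X (y n) z) \<longlonglongrightarrow> 0"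
proof -
  note D = adjD[OF assms(1)]
  define s where "s n = tdist X u (y n)" for n
  have sd: "tdist X (y n) (y k) = \<bar>s n - s k\<bar>" if "n \<ge> N" "k \<ge> N" for n k
    unfolding s_def using dist_on_segment D y that by blast
  have "Cauchy s"
  proof (rule metric_CauchyI)
    fix e :: real assume "e > 0"
    then obtain K where K: "\<forall>n \<ge> K. \<forall>k \<ge> K. tdist X (y n) (y k) < e" using Cauchy by blast
    then have "dist (s n) (s k) < e" if "n \<ge> max K N" "k \<ge> max K N" for n k
      using K[rule_format, of n k] sd[of n k] that by (auto simp: dist_real_def)
    then show "\<exists>M. \<forall>n \<ge> M. \<forall>k \<ge> M. dist (s n) (s k) < e" by blast
  qed
  then obtain l where l: "s \<longlonglongrightarrow> l" using Cauchy_convergent_iff convergent_def by blast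
  have "0 \<le> l" using LIMSEQ_le_const[OF l, of 0] by (auto simp: s_def)
  moreover have "l \<le> tdist X u w"
  proof (rule LIMSEQ_le_const2[OF l], intro exI allI impI)
    fix n assume "n \<ge> N"
    then have "y n \<in> seg u w" using y by blast
    then show "s n \<le> tdist X u w" using segment_le(1) by (simp add: s_def)
  qed
  ultimately obtain z where z: "z \<in> seg u w" "tdist X u z = l" using segment_point[OF D(3,4)]
    by metis
  have "(\<lambda>n. \<bar>s n - l\<bar>) \<longlonglongrightarrow> 0" using l by (simp add: LIM_zero_iff tendsto_rabs_zero_iff)
  moreover have "\<forall>\<^sub>F n in sequentially. \<bar>s n - l\<bar> = tdist X (y n) z"
    unfolding eventually_sequentially s_def using dist_on_segment[OF D(3,4) _ z(1)] y z(2) by metis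
  ultimately have "(\<lambda>n. tdist X (y n) z) \<longlonglongrightarrow> 0" by (rule Lim_transform_eventually)
  then show ?thesis using z seg_pts by blast
qed

text \<open>A Cauchy sequence that stays away from the vertices ends up inside one edge, since
  leaving an edge means passing a vertex. Otherwise it comes close to vertices again and again; as
  distinct vertices are a fixed distance apart, it is eventually always the same vertex, which is
  the limit.\<close>

lemma tree_complete:
  assumes fin: "finite (edge_orbits H X)" and y: "\<And>n :: nat. y n \<in> pts X"
    and Cauchy: "\<And>e. e > 0 \<Longrightarrow> \<exists>N. \<forall>n \<ge> N. \<forall>k \<ge> N. tdist X (y n) (y k) < e"
  shows "\<exists>z \<in> pts X. (\<lambda>n. tdist X (y n) z) \<longlonglongrightarrow> 0"
proof (cases "\<exists>\<delta>>0. \<exists>N. \<forall>n \<ge> N. \<forall>v \<in> vset X. \<delta> \<le> tdist X (y n) v")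
  case True
  then obtain \<delta> N where \<delta>: "\<delta> > 0" "\<And>n v. n \<ge> N \<Longrightarrow> v \<in> vset X \<Longrightarrow> \<delta> \<le> tdist X (y n) v" by blast
  obtain K where K: "\<And>n k. n \<ge> K \<Longrightarrow> k \<ge> K \<Longrightarrow> tdist X (y n) (y k) < \<delta>" using Cauchy \<delta> by blast
  define M where "M = max N K"
  have nV: "y n \<notin> vset X" if "n \<ge> M" for n
  proof
    assume "y n \<in> vset X"
    then have "\<delta> \<le> tdist X (y n) (y n)" using \<delta>(2)[of n "y n"] that by (simp add: M_def)
    also have "\<dots> = 0" using y by simp
    finally show False using \<delta>(1) by simp
  qed
  obtain u w where uw: "adj u w" "y M \<in> seg u w"
    using nonvertex_in_edge[OF y nV[OF order_refl]] by (auto elim: edgesE)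
  have "y n \<in> seg u w" if "n \<ge> M" for n
  proof -
    have "\<exists>e. e \<in> edges X \<and> y M \<in> e \<and> y n \<in> e"
    proof (rule ccontr)
      assume "\<nexists>e. e \<in> edges X \<and> y M \<in> e \<and> y n \<in> e"
      then obtain v where "v \<in> vset X" "v \<in> seg (y M) (y n)"
        using vertex_between y nV by (metis order_refl)
      moreover from this have "tdist X (y M) v \<le> tdist X (y M) (y n)"
        using segment_le(1) by blast
      ultimately show False using \<delta>(2)[of M v] K[of M n] that by (auto simp: M_def)
    qed
    then show ?thesis using edges_inter[OF adjacent_edge[OF uw(1)]] uw nV[of M] by blast
  qed
  then show ?thesis using edge_Cauchy_convergent[OF uw(1)] Cauchy by blast
next
  case False
  then have near: "\<exists>n \<ge> N. \<exists>v \<in> vset X. tdist X (y n) v < \<delta>" if "\<delta> > 0" for \<delta> N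
    using that by (meson not_le)
  obtain c where c: "c > 0" "\<And>u w. u \<in> vset X \<Longrightarrow> w \<in> vset X \<Longrightarrow> u \<noteq> w \<Longrightarrow> c \<le> tdist X u w"
    using vertex_separation[OF fin] by blast
  \<comment> \<open>Two vertices within \<open>c/4\<close> of late terms are less than
    \<open>c\<close> apart, being joined through these two terms, and hence equal.\<close>
  obtain N where N: "\<And>n k. n \<ge> N \<Longrightarrow> k \<ge> N \<Longrightarrow> tdist X (y n) (y k) < c/4"
    using Cauchy[of "c/4"] c(1) by (metis divide_pos_pos zero_less_numeral)
  obtain n0 v where n0: "n0 \<ge> N" "v \<in> vset X" "tdist X (y n0) v < c/4" using near[of "c/4" N] c
    by auto
  have vp: "v \<in> pts X" using n0 vset_pts by blast
  have "(\<lambda>n. tdist X (y n) v) \<longlonglongrightarrow> 0"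
  proof (rule LIMSEQ_I)
    fix r :: real assume r: "r > 0"
    obtain K where K: "\<And>n k. n \<ge> K \<Longrightarrow> k \<ge> K \<Longrightarrow> tdist X (y n) (y k) < r/2" using Cauchy[of "r/2"] r
      by auto
    obtain n1 v1 where n1: "n1 \<ge> max N K" "v1 \<in> vset X" "tdist X (y n1) v1 < min (r/2) (c/4)"
      using near[of "min (r/2) (c/4)" "max N K"] c r by auto
    have v1p: "v1 \<in> pts X" using n1 vset_pts by blast
    have "tdist X v1 v \<le> tdist X (y n1) v1 + tdist X (y n1) (y n0) + tdist X (y n0) v"
      using mdist_triangle[of v1 "met X" "y n1" v] mdist_triangle[of "y n1" "met X" "y n0" v] v1p vp y
      by (simp add: mdist_commute)
    also have "\<dots> < c" using n1 n0 N[of n1 n0] c(1) by auto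
    finally have "v1 = v" using c(2)[of v1 v] n0 n1 by fastforce
    then have "tdist X (y n) v < r" if "n \<ge> K" for n
      using mdist_triangle[of "y n" "met X" "y n1" v] y vp K[of n n1] n1 that by auto
    then show "\<exists>no. \<forall>n \<ge> no. norm (tdist X (y n) v - 0) < r" by auto
  qed
  then show ?thesis using vp by blast
qed

text \<open>If \<open>v\<close> were a leaf, removing its orbit would leave a smaller invariant
  subtree, against minimality. This serves maps that collapse all edges, where two edges at a vertex
  provide the two gates.\<close>

lemma two_edges_at_vertex:
  assumes min: "minimal_action H X" and vw: "adj v w"
  shows "\<exists>w'. adj v w' \<and> w' \<noteq> w"
proof (rule ccontr)
  assume *: "\<not> (\<exists>w'. adj v w' \<and> w' \<noteq> w)"
  note D = adjD[OF vw]
  define W where "W = {x \<in> vset X. \<forall>h \<in> carrier H. a h v \<noteq> x}"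
  have nbr: "x = a h w" if "h \<in> carrier H" "adj (a h v) x" for h x
  proof -
    have "adj v (a (inv\<^bsub>H\<^esub> h) x)" using act_adj[of "inv\<^bsub>H\<^esub> h", OF _ that(2)] that(1) D act_inv
      by simp
    then have "a (inv\<^bsub>H\<^esub> h) x = w" using * by blast
    then show ?thesis using act_inv' that adjD by metis
  qed
  \<comment> \<open>An element taking \<open>v\<close> to \<open>w\<close> would make
    \<open>w\<close> a leaf with neighbour \<open>v\<close> and so invert the edge, but setwise edge
    stabilisers are trivial.\<close>
  have "w \<in> W"
  proof (rule ccontr)
    assume "w \<notin> W"
    then obtain h where h: "h \<in> carrier H" "a h v = w" using D unfolding W_def by blast
    then have "v = a h w" using nbr[OF h(1)] adj_commute vw by blast
    then have "a h ` seg v w = seg v w" using act_seg[OF h(1) D(3,4)] h segment_commute by metis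
    then have "h = \<one>\<^bsub>H\<^esub>" using trivial_edges adjacent_edge[OF vw] h
      by (simp add: trivial_edge_stabilisers_def)
    then show False using h D act_one by metis
  qed
  moreover have "a h ` W \<subseteq> W" if h: "h \<in> carrier H" for h
  proof
    fix x assume "x \<in> a h ` W"
    then obtain y where y: "y \<in> W" "x = a h y" by blast
    have "a g v \<noteq> x" if g: "g \<in> carrier H" for g
    proof
      assume "a g v = x"
      then have "a (inv\<^bsub>H\<^esub> h \<otimes>\<^bsub>H\<^esub> g) v = y"
        using act_mult[of "inv\<^bsub>H\<^esub> h" g v] act_inv[OF h] D y g h vset_pts by (simp add: W_def)
      then show False using y g h by (auto simp: W_def)
    qed
    then show "x \<in> W" using y act_vset h by (auto simp: W_def)
  qed
  \<comment> \<open>A geodesic passing through a leaf would arrive and depart along the same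
    edge.\<close>
  moreover have "seg u x \<inter> vset X \<subseteq> W" if ux: "u \<in> W" "x \<in> W" for u x
  proof
    fix z assume z: "z \<in> seg u x \<inter> vset X"
    have p: "u \<in> vset X" "x \<in> vset X" "u \<in> pts X" "x \<in> pts X" using ux vset_pts
      by (auto simp: W_def)
    have "a h v \<noteq> z" if h: "h \<in> carrier H" for h
    proof
      assume hz: "a h v = z"
      have ne: "z \<noteq> u" "z \<noteq> x" using ux hz h by (auto simp: W_def)
      obtain y where y: "adj z y" "y \<in> seg z u" using next_vertex[of z u] z p ne by blast
      obtain y' where y': "adj z y'" "y' \<in> seg z x" using next_vertex[of z x] z p ne by blast
      have "y = y'" using nbr[OF h] hz y y' by metis
      then have "y \<in> seg z u" "y \<in> seg z x" "z \<in> seg u x" using y(2) y'(2) z by simp_all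
      then have "tdist X u x \<le> tdist X u y + tdist X y x" "tdist X u z + tdist X z x = tdist X u x"
        "tdist X z y + tdist X y u = tdist X z u" "tdist X z y + tdist X y x = tdist X z x"
        using mdist_triangle[of u "met X" y x] p unfolding geod_seg_def mem_Collect_eq by blast+
      then show False using adjD(7)[OF y(1)] by (simp add: mdist_commute)
    qed
    then show "z \<in> W" using z by (auto simp: W_def)
  qed
  moreover have "W \<subseteq> vset X" by (auto simp: W_def)
  moreover have "W \<noteq> {}" using \<open>w \<in> W\<close> by blast
  ultimately have "W = vset X" using min[unfolded minimal_action_def, rule_format, of W] by simp
  then have "v \<in> W" using D by blast
  then show False using act_one D by (auto simp: W_def)
qed

section \<open>Finitely many edge orbits from minimality\<close>

text \<open>The union of all translates of the spokes from \<open>x0\<close> to the points of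
  \<open>K\<close>. A finite \<open>K\<close> yields finitely many edges up to translation; whether
  the union is a subtree depends on the generators of \<open>H\<close>.\<close>

definition tree_hull :: "'x \<Rightarrow> 'x set \<Rightarrow> 'x set" where
  "tree_hull x0 K = (\<Union>h \<in> carrier H. \<Union>k \<in> K. a h ` seg x0 k)"

lemma hull_act:
  assumes "g \<in> carrier H" "y \<in> tree_hull x0 K"
  shows "a g y \<in> tree_hull x0 K"
proof -
  obtain h k z where "h \<in> carrier H" "k \<in> K" "y = a h z" "z \<in> seg x0 k"
    using assms by (auto simp: tree_hull_def)
  moreover from this have "a g y = a (g \<otimes>\<^bsub>H\<^esub> h) z" using act_mult assms seg_pts by metis
  ultimately show ?thesis unfolding tree_hull_def using assms H.m_closed by blast
qed

text \<open>The segment is covered by the one from \<open>x0\<close> to \<open>a g x0\<close> and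
  the translate by \<open>g\<close> of the one from \<open>x0\<close> to \<open>a h x0\<close>. So
  the condition passes to products and has to be checked on generators only.\<close>

lemma seg_in_hull_mult:
  assumes x0: "x0 \<in> pts X" and g: "g \<in> carrier H" "h \<in> carrier H"
    and "seg x0 (a g x0) \<subseteq> tree_hull x0 K" "seg x0 (a h x0) \<subseteq> tree_hull x0 K"
  shows "seg x0 (a (g \<otimes>\<^bsub>H\<^esub> h) x0) \<subseteq> tree_hull x0 K"
proof -
  have "seg (a g x0) (a g (a h x0)) \<subseteq> tree_hull x0 K"
    unfolding act_seg[OF g(1) x0 act_closed[OF g(2) x0], symmetric]
    using hull_act[OF g(1)] assms(5) by (meson image_subsetI subsetD)
  then show ?thesis
    using segment_union[of x0 "a g (a h x0)" "a g x0"] assms act_closed act_mult by auto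
qed

text \<open>Detour through the fixed point \<open>k\<close>: out along a spoke and back along its
  translate by \<open>g\<close>. A single \<open>k\<close> serves a whole vertex group, however
  large.\<close>

lemma seg_in_hull_fixed:
  assumes x0: "x0 \<in> pts X" and g: "g \<in> carrier H" and k: "k \<in> K" "k \<in> pts X" "a g k = k"
  shows "seg x0 (a g x0) \<subseteq> tree_hull x0 K"
proof -
  have sub: "a h ` seg x0 k \<subseteq> tree_hull x0 K" if "h \<in> carrier H" for h
    using that k unfolding tree_hull_def by blast
  have "seg x0 k \<subseteq> tree_hull x0 K"
    using sub[of "\<one>\<^bsub>H\<^esub>"] act_image_one[OF segment_sub] by simp
  moreover have "seg k (a g x0) \<subseteq> tree_hull x0 K"
    using sub[OF g] act_seg[OF g x0 k(2)] k segment_commute by metis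
  ultimately show ?thesis using segment_union[of x0 "a g x0" k] x0 k act_closed g by blast
qed

text \<open>Every vertex reaches \<open>z\<close> through one end of the edge. If \<open>x\<close>
  and \<open>y\<close> came through the same end, the geodesic between them would miss
  \<open>z\<close>; so they use different ends, and both ends lie on it.\<close>

lemma edge_on_segment:
  assumes uw: "adj u w" and z: "z \<in> seg u w" "z \<notin> vset X"
    and xy: "x \<in> vset X" "y \<in> vset X" "z \<in> seg x y"
  shows "u \<in> seg x y \<and> w \<in> seg x y"
proof -
  note D = adjD[OF uw]
  have p: "x \<in> pts X" "y \<in> pts X" "z \<in> pts X" using xy vset_pts seg_pts by auto
  have gate: "tdist X t z = tdist X t u + tdist X u z \<or> tdist X t z = tdist X t w + tdist X w z"
    if "t \<in> vset X" for t using edge_gate_vertex[OF uw that] z by blast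
  have "tdist X z v = 0" if "v \<in> {u, w}" "tdist X x z = tdist X x v + tdist X v z"
     "tdist X y z = tdist X y v + tdist X v z" for v
  proof -
    have "tdist X x y \<le> tdist X x v + tdist X v y" using that p D by (intro mdist_triangle) auto
    moreover have "tdist X x z + tdist X z y = tdist X x y" using xy(3) by (simp add: geod_seg_def)
    ultimately have "2 * tdist X v z \<le> 0"
      using that(2,3) mdist_commute[of "met X" z y] mdist_commute[of "met X" y v] by linarith
    then show ?thesis using mdist_nonneg[of "met X" v z] mdist_commute[of "met X" z v] by linarith
  qed
  moreover have "tdist X z v \<noteq> 0" if "v \<in> {u, w}" for v
  proof -
    have "z \<noteq> v" "v \<in> pts X" using that z(2) D by auto
    then show ?thesis using p(3) by simp
  qed
  ultimately consider "tdist X x z = tdist X x u + tdist X u z" "tdist X y z = tdist X y w + tdist X w z"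
    | "tdist X x z = tdist X x w + tdist X w z" "tdist X y z = tdist X y u + tdist X u z"
    using gate[OF xy(1)] gate[OF xy(2)] by blast
  then show ?thesis
  proof cases
    case 1
    then have "u \<in> seg x z" "w \<in> seg y z" using D by (auto simp: geod_seg_def)
    then show ?thesis using segment_mono p xy(3) segment_commute by blast
  next
    case 2
    then have "w \<in> seg x z" "u \<in> seg y z" using D by (auto simp: geod_seg_def)
    then show ?thesis using segment_mono p xy(3) segment_commute by blast
  qed
qed

text \<open>The hull is a subtree, hence it contains all vertices by minimality.\<close>

lemma finite_edge_orbits_of_hull:
  assumes min: "minimal_action H X" and x0: "x0 \<in> vset X" and K: "finite K" "K \<subseteq> vset X" "x0 \<in> K"
    and gen: "\<And>g. g \<in> carrier H \<Longrightarrow> seg x0 (a g x0) \<subseteq> tree_hull x0 K"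
  shows "finite (edge_orbits H X)"
proof -
  have x0p: "x0 \<in> pts X" using x0 vset_pts by blast
  have to_center: "\<exists>h \<in> carrier H. seg x (a h x0) \<subseteq> tree_hull x0 K" if x: "x \<in> tree_hull x0 K" for x
  proof -
    obtain h k z where h: "h \<in> carrier H" "k \<in> K" "x = a h z" "z \<in> seg x0 k"
      using x by (auto simp: tree_hull_def)
    have kp: "k \<in> pts X" using h K vset_pts by blast
    have "seg x (a h x0) = a h ` seg x0 z" using act_seg h x0p seg_pts segment_commute by metis
    also have "\<dots> \<subseteq> a h ` seg x0 k" using segment_mono[OF x0p kp h(4)] by blast
    also have "\<dots> \<subseteq> tree_hull x0 K" unfolding tree_hull_def using h by blast
    finally show ?thesis using h by blast
  qed
  have hull_pts: "tree_hull x0 K \<subseteq> pts X" using act_closed seg_pts unfolding tree_hull_def by blast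
  have convex: "seg x y \<subseteq> tree_hull x0 K" if xy: "x \<in> tree_hull x0 K" "y \<in> tree_hull x0 K" for x y
  proof -
    \<comment> \<open>Both points are joined within the hull to translates of \<open>x0\<close>, and
      these two are joined by a translate of a segment covered by \<open>gen\<close>.\<close>
    obtain g where g: "g \<in> carrier H" "seg x (a g x0) \<subseteq> tree_hull x0 K" using to_center xy by blast
    obtain h where h: "h \<in> carrier H" "seg y (a h x0) \<subseteq> tree_hull x0 K" using to_center xy by blast
    have "a g ` seg x0 (a (inv\<^bsub>H\<^esub> g \<otimes>\<^bsub>H\<^esub> h) x0) \<subseteq> tree_hull x0 K"
      using gen[of "inv\<^bsub>H\<^esub> g \<otimes>\<^bsub>H\<^esub> h"] hull_act g h by blast
    moreover have "a g ` seg x0 (a (inv\<^bsub>H\<^esub> g \<otimes>\<^bsub>H\<^esub> h) x0) = seg (a g x0) (a h x0)"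
      using act_seg[of g x0 "a (inv\<^bsub>H\<^esub> g \<otimes>\<^bsub>H\<^esub> h) x0"] g h x0p act_closed act_mult act_inv' by simp
    ultimately have "seg (a g x0) (a h x0) \<subseteq> tree_hull x0 K" by simp
    moreover have "seg x y \<subseteq> seg x (a g x0) \<union> seg (a g x0) y"
      "seg (a g x0) y \<subseteq> seg (a g x0) (a h x0) \<union> seg (a h x0) y"
      using xy hull_pts act_closed g h x0p by (intro segment_union; blast)+
    ultimately show ?thesis using g h segment_commute[of y] by blast
  qed
  have "x0 \<in> tree_hull x0 K"
    using K(3) x0p act_one ends_in_segment[OF x0p x0p] unfolding tree_hull_def
    by (force intro!: bexI[of _ "\<one>\<^bsub>H\<^esub>"])
  define W where "W = tree_hull x0 K \<inter> vset X"
  have "W = vset X"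
  proof -
    have "W \<subseteq> vset X" "W \<noteq> {}" using \<open>x0 \<in> tree_hull x0 K\<close> x0 by (auto simp: W_def)
    moreover have "\<forall>h \<in> carrier H. a h ` W \<subseteq> W" using hull_act act_vset by (auto simp: W_def)
    moreover have "\<forall>u \<in> W. \<forall>w \<in> W. seg u w \<inter> vset X \<subseteq> W" using convex by (auto simp: W_def)
    ultimately show ?thesis using min unfolding minimal_action_def by blast
  qed
  \<comment> \<open>A non-vertex of an edge lies on a translated spoke. Translated back, the whole
    edge lies on the spoke, so that both ends are in \<open>T\<close>.\<close>
  define T where "T = (\<Union>k \<in> K. seg x0 k \<inter> vset X)"
  have finT: "finite T" using K finite_seg_vset x0p vset_pts unfolding T_def by blast
  have "edge_orbits H X \<subseteq> (\<lambda>(u, w). edge_orbit (seg u w)) ` (T \<times> T)"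
  proof
    fix E assume E: "E \<in> edge_orbits H X"
    then obtain e where e: "e \<in> edges X" "E = edge_orbit e" by (auto simp: edge_orbits_eq)
    obtain u w where uw: "adj u w" "e = seg u w" using e edgesE by blast
    note D = adjD[OF uw(1)]
    obtain z where z: "z \<in> seg u w" "z \<notin> vset X" using interior_point D by metis
    have "seg u w \<subseteq> tree_hull x0 K"
    proof (rule convex)
      show "u \<in> tree_hull x0 K" "w \<in> tree_hull x0 K" using D(1,2) \<open>W = vset X\<close> unfolding W_def
        by blast+
    qed
    then obtain h k y where h: "h \<in> carrier H" "k \<in> K" "z = a h y" "y \<in> seg x0 k"
      using z by (auto simp: tree_hull_def)
    let ?g = "inv\<^bsub>H\<^esub> h"
    have g: "?g \<in> carrier H" using h by simp
    have uw': "adj (a ?g u) (a ?g w)" using act_adj[OF g uw(1)] .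
    have "y = a ?g z" using h act_inv seg_pts by metis
    then have "y \<in> seg (a ?g u) (a ?g w)" using act_in_seg[OF g D(3,4) z(1)] by simp
    moreover have "y \<notin> vset X" using z h act_vset by blast
    ultimately have "a ?g u \<in> T" "a ?g w \<in> T"
      using edge_on_segment[OF uw'] h(2,4) x0 K(2) adjD[OF uw'] unfolding T_def by blast+
    moreover have "seg (a ?g u) (a ?g w) = a ?g ` e" using act_seg[OF g D(3,4)] uw by simp
    moreover have "edge_orbit (a ?g ` e) = E"
      using edge_orbit_eqI[OF E edge_orbits_act[OF E _ g]] edge_orbit_self e by blast
    ultimately show "E \<in> (\<lambda>(u, w). edge_orbit (seg u w)) ` (T \<times> T)"
      by (intro image_eqI[of _ _ "(a ?g u, a ?g w)"]) simp_all
  qed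
  then show ?thesis using finT by (simp add: finite_subset)
qed

end

section \<open>Generators of the fundamental group\<close>

locale finite_gog =
  fixes \<Gamma> :: "('v, 'e, 'g) graph_of_groups"
  assumes connected_finite: "connected_finite_gog \<Gamma>"
begin

abbreviation GG where "GG \<equiv> gog_graph \<Gamma>"
abbreviation base where "base \<equiv> base_vertex \<Gamma>"
abbreviation VG where "VG \<equiv> vertex_group \<Gamma>"
abbreviation path where "path \<equiv> gog_path \<Gamma>"
abbreviation cls where "cls \<equiv> loop_class \<Gamma>"
abbreviation eqv (infix "\<sim>" 50) where "p \<sim> q \<equiv> equivclp (gog_step \<Gamma>) p q"

sublocale fin_digraph GG
  using connected_finite by (simp add: connected_finite_gog_def)

lemma vertex_group_group: "v \<in> verts GG \<Longrightarrow> group (VG v)"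
  using connected_finite by (simp add: connected_finite_gog_def)

lemma base_in_verts: "base \<in> verts GG"
  using connected_finite by (simp add: connected_finite_gog_def)

lemma step_context:
  assumes "gog_step \<Gamma> p q"
  shows "gog_step \<Gamma> (r @ p @ s) (r @ q @ s)"
  using assms
proof cases
  case (one v p' q')
  then show ?thesis using gog_step.one[of v \<Gamma> "r @ p'" "q' @ s"] by simp
next
  case (mult v a b p' q')
  then show ?thesis using gog_step.mult[of v \<Gamma> a b "r @ p'" "q' @ s"] by simp
next
  case (backtrack e p' d' q')
  then show ?thesis using gog_step.backtrack[of e \<Gamma> "r @ p'" d' "q' @ s"] by simp
qed

lemma eqv_context:
  assumes "p \<sim> q"
  shows "r @ p @ s \<sim> r @ q @ s"
  using assms
proof (induction rule: equivclp_induct)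
  case (step y z)
  then have "gog_step \<Gamma> (r @ y @ s) (r @ z @ s) \<or> gog_step \<Gamma> (r @ z @ s) (r @ y @ s)"
    using step_context by blast
  then show ?case using step.IH equivclp_into_equivclp by metis
qed simp

lemma eqv_append: "p \<sim> p' \<Longrightarrow> q \<sim> q' \<Longrightarrow> p @ q \<sim> p' @ q'"
  using eqv_context[of p p' "[]" q] eqv_context[of q q' p' "[]"] by (auto intro: equivclp_trans)

lemma path_verts: "path u p w \<Longrightarrow> u \<in> verts GG \<and> w \<in> verts GG"
  by (induction rule: gog_path.induct) auto

lemma path_append: "path u p w \<Longrightarrow> path w q x \<Longrightarrow> path u (p @ q) x"
  by (induction rule: gog_path.induct) (auto intro: gog_path.intros)

lemma path_Elt: "v \<in> verts GG \<Longrightarrow> x \<in> carrier (VG v) \<Longrightarrow> path v [Elt v x] v"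
  by (intro gog_path.intros)

lemma path_Traverse:
  assumes "e \<in> arcs GG"
  shows "path (tail GG e) [Traverse e True] (head GG e)" "path (head GG e) [Traverse e False] (tail GG e)"
  using assms by (auto intro!: gog_path.intros)

lemma inv_path_Nil [simp]: "inv_path \<Gamma> [] = []"
  and inv_path_Cons [simp]: "inv_path \<Gamma> (l # p) = inv_path \<Gamma> p @ [inv_letter \<Gamma> l]"
  by (simp_all add: inv_path_def)

lemma path_inv_path: "path u p w \<Longrightarrow> path w (inv_path \<Gamma> p) u"
proof (induction rule: gog_path.induct)
  case (Elt v p w x)
  then have "path v [Elt v (inv\<^bsub>VG v\<^esub> x)] v"
    using path_Elt path_verts group.inv_closed[OF vertex_group_group] by blast
  then show ?case using Elt path_append by simp
qed (use path_append path_Traverse in \<open>auto intro: gog_path.Nil\<close>)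

lemma Elt_cancel:
  assumes v: "v \<in> verts GG" and x: "x \<in> carrier (VG v)" "y \<in> carrier (VG v)" "x \<otimes>\<^bsub>VG v\<^esub> y = \<one>\<^bsub>VG v\<^esub>"
  shows "[Elt v x, Elt v y] \<sim> []"
proof -
  have "[Elt v x, Elt v y] \<sim> [Elt v (x \<otimes>\<^bsub>VG v\<^esub> y)]"
    using gog_step.mult[of v \<Gamma> x y "[]" "[]"] assms by auto
  also have "\<dots> \<sim> []" using gog_step.one[of v \<Gamma> "[]" "[]"] assms by auto
  finally show ?thesis .
qed

lemma letter_cancel:
  assumes "path u (l # p) w"
  shows "[l, inv_letter \<Gamma> l] \<sim> []" "[inv_letter \<Gamma> l, l] \<sim> []"
  using assms
proof (atomize (full), cases)
  case (Elt a)
  then have "u \<in> verts GG" using path_verts assms by blast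
  then interpret g: group "VG u" by (rule vertex_group_group)
  show "[l, inv_letter \<Gamma> l] \<sim> [] \<and> [inv_letter \<Gamma> l, l] \<sim> []"
    using Elt Elt_cancel[OF \<open>u \<in> verts GG\<close>] by simp
next
  case (Fwd e)
  then show "[l, inv_letter \<Gamma> l] \<sim> [] \<and> [inv_letter \<Gamma> l, l] \<sim> []"
    using gog_step.backtrack[of e \<Gamma> "[]" True "[]"] gog_step.backtrack[of e \<Gamma> "[]" False "[]"]
    by auto
next
  case (Bwd e)
  then show "[l, inv_letter \<Gamma> l] \<sim> [] \<and> [inv_letter \<Gamma> l, l] \<sim> []"
    using gog_step.backtrack[of e \<Gamma> "[]" True "[]"] gog_step.backtrack[of e \<Gamma> "[]" False "[]"]
    by auto
qed

lemma path_tl: "path u (l # p) w \<Longrightarrow> \<exists>u'. path u' p w"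
  by (erule gog_path.cases) auto

lemma inv_path_cancel:
  assumes "path u p w"
  shows "p @ inv_path \<Gamma> p \<sim> []" "inv_path \<Gamma> p @ p \<sim> []"
  using assms
proof (induction p arbitrary: u)
  case (Cons l p)
  {
    case 1
    then obtain u' where "path u' p w" using path_tl by blast
    then have "[l] @ (p @ inv_path \<Gamma> p) @ [inv_letter \<Gamma> l] \<sim> [l] @ [] @ [inv_letter \<Gamma> l]"
      using Cons.IH(1) by (intro eqv_context)
    also have "\<dots> \<sim> []" using letter_cancel(1)[OF 1] by simp
    finally show ?case by simp
  next
    case 2
    then obtain u' where u': "path u' p w" using path_tl by blast
    have "inv_path \<Gamma> p @ [inv_letter \<Gamma> l, l] @ p \<sim> inv_path \<Gamma> p @ [] @ p"
      using letter_cancel(2)[OF 2] by (intro eqv_context)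
    also have "\<dots> \<sim> []" using Cons.IH(2)[OF u'] by simp
    finally show ?case by simp
  }
qed simp_all

lemma loop_class_eqI: "p \<sim> q \<Longrightarrow> cls p = cls q"
  unfolding loop_class_def by (blast intro: equivclp_trans equivclp_sym)

text \<open>The product in \<open>pi1\<close> is a union over all pairs of representatives; since
  homotopy respects concatenation, all members of this union coincide.\<close>

lemma loop_class_mult:
  assumes "path base p base" "path base q base"
  shows "cls p \<otimes>\<^bsub>pi1 \<Gamma>\<^esub> cls q = cls (p @ q)"
proof -
  have eq: "cls (p' @ q') = cls (p @ q)" if "p' \<in> cls p" "q' \<in> cls q" for p' q'
    using that by (intro loop_class_eqI eqv_append) (auto simp: loop_class_def intro: equivclp_sym)
  have ne: "p \<in> cls p" "q \<in> cls q" using assms by (auto simp: loop_class_def gog_loops_def)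
  have "(\<Union>p' \<in> cls p. \<Union>q' \<in> cls q. cls (p' @ q')) = (\<Union>p' \<in> cls p. \<Union>q' \<in> cls q. cls (p @ q))"
    by (intro SUP_cong refl eq)
  also have "\<dots> = cls (p @ q)" using ne by blast
  finally show ?thesis by (simp add: pi1_def)
qed

lemma loop_class_carrier: "path base p base \<Longrightarrow> cls p \<in> carrier (pi1 \<Gamma>)"
  by (simp add: pi1_def gog_loops_def)

lemma exists_path:
  assumes "v \<in> verts GG"
  shows "\<exists>p. path base p v"
proof -
  have "strongly_connected (with_proj (mk_symmetric GG))"
    using connected_finite by (simp add: connected_finite_gog_def Digraph_Component.connected_def)
  then have "base \<rightarrow>\<^sup>*\<^bsub>with_proj (mk_symmetric GG)\<^esub> v"
    using assms base_in_verts by (auto elim: strongly_connectedE)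
  then have "(base, v) \<in> rtrancl_on (verts GG) (parcs (mk_symmetric GG))"
    by (simp add: reachable_def)
  then show ?thesis
  proof (induction rule: rtrancl_on_induct)
    case base
    show ?case using gog_path.Nil[OF base_in_verts] by (rule exI)
  next
    case (step y z)
    then obtain p e where p: "path base p y" and e: "e \<in> arcs GG"
      "(y, z) = (tail GG e, head GG e) \<or> (y, z) = (head GG e, tail GG e)"
      by (auto simp: parcs_mk_symmetric)
    then show ?case using path_append[OF p] path_Traverse[OF e(1)] by blast
  qed
qed

text \<open>Between consecutive letters of a loop insert the return along \<open>P v\<close> to the
  base vertex and the way out again. This turns the loop into a product of generators, one for each
  letter. With \<open>P base = []\<close> nothing is left over at the two ends.\<close>

lemma pi1_induct:
  assumes P: "\<And>v. v \<in> verts GG \<Longrightarrow> path base (P v) v" "P base = []"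
    and one: "Q (cls [])"
    and mult: "\<And>x y. x \<in> carrier (pi1 \<Gamma>) \<Longrightarrow> y \<in> carrier (pi1 \<Gamma>) \<Longrightarrow> Q x \<Longrightarrow> Q y \<Longrightarrow> Q (x \<otimes>\<^bsub>pi1 \<Gamma>\<^esub> y)"
    and Elt: "\<And>v x. v \<in> verts GG \<Longrightarrow> x \<in> carrier (VG v) \<Longrightarrow> Q (cls (P v @ [Elt v x] @ inv_path \<Gamma> (P v)))"
    and Fwd: "\<And>e. e \<in> arcs GG \<Longrightarrow> Q (cls (P (tail GG e) @ [Traverse e True] @ inv_path \<Gamma> (P (head GG e))))"
    and Bwd: "\<And>e. e \<in> arcs GG \<Longrightarrow> Q (cls (P (head GG e) @ [Traverse e False] @ inv_path \<Gamma> (P (tail GG e))))"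
    and g: "g \<in> carrier (pi1 \<Gamma>)"
  shows "Q g"
proof -
  have glue: "Q (cls (P u @ (l # p) @ inv_path \<Gamma> (P w)))"
    if l: "path u [l] v" and p: "path v p w"
    and Q: "Q (cls (P u @ [l] @ inv_path \<Gamma> (P v)))" "Q (cls (P v @ p @ inv_path \<Gamma> (P w)))"
    for u l v p w
  proof -
    have V: "u \<in> verts GG" "v \<in> verts GG" "w \<in> verts GG" using path_verts l p by auto
    have 1: "path base (P u @ [l] @ inv_path \<Gamma> (P v)) base"
      using P(1) V l path_inv_path path_append by metis
    have 2: "path base (P v @ p @ inv_path \<Gamma> (P w)) base"
      using P(1) V p path_inv_path path_append by metis
    have "(P u @ [l]) @ (inv_path \<Gamma> (P v) @ P v) @ (p @ inv_path \<Gamma> (P w))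
        \<sim> (P u @ [l]) @ [] @ (p @ inv_path \<Gamma> (P w))"
      using inv_path_cancel(2)[OF P(1)[OF V(2)]] by (intro eqv_context)
    then have "cls (P u @ (l # p) @ inv_path \<Gamma> (P w))
        = cls ((P u @ [l] @ inv_path \<Gamma> (P v)) @ (P v @ p @ inv_path \<Gamma> (P w)))"
      using loop_class_eqI by (simp add: equivclp_sym)
    also have "\<dots> = cls (P u @ [l] @ inv_path \<Gamma> (P v)) \<otimes>\<^bsub>pi1 \<Gamma>\<^esub> cls (P v @ p @ inv_path \<Gamma> (P w))"
      using loop_class_mult[OF 1 2] by simp
    finally show ?thesis using mult Q loop_class_carrier 1 2 by simp
  qed
  have "Q (cls (P u @ p @ inv_path \<Gamma> (P w)))" if "path u p w" for u p w
    using that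
  proof (induction rule: gog_path.induct)
    case (Nil v)
    then have "cls (P v @ [] @ inv_path \<Gamma> (P v)) = cls []"
      using inv_path_cancel(1)[OF P(1)] loop_class_eqI by simp
    then show ?case using one by simp
  next
    case (Elt v p w x)
    then have "v \<in> verts GG" using path_verts by blast
    then show ?case using glue[OF path_Elt] Elt assms(5) by blast
  next
    case (Fwd e p w)
    then show ?case using glue path_Traverse assms(6) by blast
  next
    case (Bwd e p w)
    then show ?case using glue path_Traverse assms(7) by blast
  qed
  moreover obtain p where "path base p base" "g = cls p"
    using g by (auto simp: pi1_def gog_loops_def)
  ultimately show ?thesis using P(2) by fastforce
qed

text \<open>Membership in \<open>outer_space_component\<close> provides a vertex fixed by the copy
  of the vertex group along some path \<open>p\<close>. Its translate by the loop that follows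
  \<open>q\<close> and returns along \<open>p\<close> is fixed by the copy along the prescribed
  \<open>q\<close>.\<close>

lemma vertex_subgroup_fixes_vertex:
  assumes X: "X \<in> outer_space_component \<Gamma>" and v: "v \<in> nontrivial_vertices \<Gamma>" and q: "path base q v"
  shows "\<exists>k \<in> vset X. \<forall>x \<in> carrier (VG v). act X (cls (q @ [Elt v x] @ inv_path \<Gamma> q)) k = k"
proof -
  interpret tree_action X "pi1 \<Gamma>"
    using X by unfold_locales (auto simp: outer_space_component_def)
  have "\<exists>!B. B \<in> orbit (pi1 \<Gamma>) (act X) ` vertices_over \<Gamma> X v"
    using X v by (simp add: outer_space_component_def)
  then obtain y where y: "y \<in> vset X" "conj_to_vertex_group \<Gamma> v (stabilizer (pi1 \<Gamma>) (act X) y)"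
    unfolding vertices_over_def by blast
  then obtain p where p: "path base p v" "stabilizer (pi1 \<Gamma>) (act X) y = vertex_subgroup \<Gamma> v p"
    unfolding conj_to_vertex_group_def by blast
  have yp: "y \<in> pts X" using y vset_pts by blast
  let ?g = "cls (q @ inv_path \<Gamma> p)"
  have gp: "path base (q @ inv_path \<Gamma> p) base" using q p path_inv_path path_append by blast
  have g: "?g \<in> carrier (pi1 \<Gamma>)" using gp by (rule loop_class_carrier)
  have "act X (cls (q @ [Elt v x] @ inv_path \<Gamma> q)) (act X ?g y) = act X ?g y"
    if x: "x \<in> carrier (VG v)" for x
  proof -
    have vv: "v \<in> verts GG" using path_verts q by blast
    have xp: "path v [Elt v x] v" using path_Elt vv x by blast
    have hp: "path base (q @ [Elt v x] @ inv_path \<Gamma> q) base"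
      by (intro path_append[OF q] path_append[OF xp] path_inv_path[OF q])
    have sp: "path base (p @ [Elt v x] @ inv_path \<Gamma> p) base"
      by (intro path_append[OF p(1)] path_append[OF xp] path_inv_path[OF p(1)])
    have s: "cls (p @ [Elt v x] @ inv_path \<Gamma> p) \<in> stabilizer (pi1 \<Gamma>) (act X) y"
      unfolding p(2) vertex_subgroup_def using x by blast
    have "cls (q @ [Elt v x] @ inv_path \<Gamma> q) \<otimes>\<^bsub>pi1 \<Gamma>\<^esub> ?g
        = cls ((q @ [Elt v x]) @ (inv_path \<Gamma> q @ q) @ inv_path \<Gamma> p)"
      using loop_class_mult[OF hp gp] by simp
    also have "\<dots> = cls ((q @ [Elt v x]) @ [] @ inv_path \<Gamma> p)"
      by (intro loop_class_eqI eqv_context inv_path_cancel(2)[OF q])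
    also have "\<dots> = cls (q @ [] @ ([Elt v x] @ inv_path \<Gamma> p))" by simp
    also have "\<dots> = cls (q @ (inv_path \<Gamma> p @ p) @ ([Elt v x] @ inv_path \<Gamma> p))"
      using equivclp_sym[OF inv_path_cancel(2)[OF p(1)]] by (intro loop_class_eqI eqv_context)
    also have "\<dots> = ?g \<otimes>\<^bsub>pi1 \<Gamma>\<^esub> cls (p @ [Elt v x] @ inv_path \<Gamma> p)"
      using loop_class_mult[OF gp sp] by simp
    finally have "act X (cls (q @ [Elt v x] @ inv_path \<Gamma> q)) (act X ?g y)
        = act X ?g (act X (cls (p @ [Elt v x] @ inv_path \<Gamma> p)) y)"
      using act_mult[OF loop_class_carrier[OF hp] g yp] act_mult[OF g loop_class_carrier[OF sp] yp]
      by simp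
    then show ?thesis using s by (simp add: stabilizer_def)
  qed
  moreover have "act X ?g y \<in> vset X" using act_vset g y by blast
  ultimately show ?thesis by blast
qed

text \<open>\<open>pi1\<close> need not be finitely generated, but it is generated by finitely many
  vertex groups, each fixing a vertex if it is nontrivial, and finitely many loops along edges. A
  trivial vertex group contributes only the identity.\<close>

theorem finite_edge_orbits:
  assumes X: "X \<in> outer_space_component \<Gamma>"
  shows "finite (edge_orbits (pi1 \<Gamma>) X)"
proof -
  interpret tree_action X "pi1 \<Gamma>"
    using X by unfold_locales (auto simp: outer_space_component_def)
  have min: "minimal_action (pi1 \<Gamma>) X" using X by (simp add: outer_space_component_def)
  obtain x0 where x0: "x0 \<in> vset X" using vset_nonempty by blast
  then have x0p: "x0 \<in> pts X" by (rule vset_pts)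
  obtain P0 where P0: "\<And>v. v \<in> verts GG \<Longrightarrow> path base (P0 v) v" using exists_path by metis
  define P where "P = P0(base := [])"
  have P: "\<And>v. v \<in> verts GG \<Longrightarrow> path base (P v) v" "P base = []"
    using P0 base_in_verts by (auto simp: P_def intro: gog_path.Nil)
  have ntv: "v \<in> verts GG" if "v \<in> nontrivial_vertices \<Gamma>" for v
    using that by (simp add: nontrivial_vertices_def)
  obtain k where k: "\<And>v. v \<in> nontrivial_vertices \<Gamma> \<Longrightarrow> k v \<in> vset X"
    "\<And>v x. v \<in> nontrivial_vertices \<Gamma> \<Longrightarrow> x \<in> carrier (VG v) \<Longrightarrow>
      act X (cls (P v @ [Elt v x] @ inv_path \<Gamma> (P v))) (k v) = k v"
    using vertex_subgroup_fixes_vertex[OF X _ P(1)[OF ntv]] by metis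
  define F where "F e = cls (P (tail GG e) @ [Traverse e True] @ inv_path \<Gamma> (P (head GG e)))" for e
  define B where "B e = cls (P (head GG e) @ [Traverse e False] @ inv_path \<Gamma> (P (tail GG e)))" for e
  have FB: "F e \<in> carrier (pi1 \<Gamma>)" "B e \<in> carrier (pi1 \<Gamma>)" if "e \<in> arcs GG" for e
  proof -
    have "path base (P (tail GG e) @ [Traverse e True] @ inv_path \<Gamma> (P (head GG e))) base"
      "path base (P (head GG e) @ [Traverse e False] @ inv_path \<Gamma> (P (tail GG e))) base"
      using that P(1) path_Traverse path_inv_path path_append head_in_verts tail_in_verts by meson+
    then show "F e \<in> carrier (pi1 \<Gamma>)" "B e \<in> carrier (pi1 \<Gamma>)"
      by (auto simp: F_def B_def loop_class_carrier)
  qed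
  \<comment> \<open>One spoke for each kind of generator: the fixed vertex \<open>k v\<close> for a
    vertex group, a translate of \<open>x0\<close> for an edge in either direction.\<close>
  define K where "K = insert x0 (k ` nontrivial_vertices \<Gamma> \<union>
    (\<lambda>e. act X (F e) x0) ` arcs GG \<union> (\<lambda>e. act X (B e) x0) ` arcs GG)"
  have finK: "finite K" by (simp add: K_def nontrivial_vertices_def)
  have KV: "K \<subseteq> vset X" using x0 k(1) FB act_vset by (auto simp: K_def)
  have hull1: "seg x0 y \<subseteq> tree_hull x0 K" if "y \<in> K" for y
  proof -
    have "act X \<one>\<^bsub>pi1 \<Gamma>\<^esub> ` seg x0 y \<subseteq> tree_hull x0 K" unfolding tree_hull_def using that by blast
    then show ?thesis using act_image_one[OF segment_sub] by simp
  qed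
  show ?thesis
  proof (rule finite_edge_orbits_of_hull[OF min x0 finK KV])
    show "x0 \<in> K" by (simp add: K_def)
    fix g assume g: "g \<in> carrier (pi1 \<Gamma>)"
    have one: "seg x0 (act X (cls []) x0) \<subseteq> tree_hull x0 K"
    proof -
      have "act X (cls []) x0 = x0" using act_one[OF x0p] by (simp add: pi1_def)
      then show ?thesis using hull1[of x0] by (simp add: K_def)
    qed
    show "seg x0 (act X g x0) \<subseteq> tree_hull x0 K"
    proof (rule pi1_induct[where Q = "\<lambda>g. seg x0 (act X g x0) \<subseteq> tree_hull x0 K", OF P _ _ _ _ _ g])
      show "seg x0 (act X (cls []) x0) \<subseteq> tree_hull x0 K" by (rule one)
    next
      fix x y assume "x \<in> carrier (pi1 \<Gamma>)" "y \<in> carrier (pi1 \<Gamma>)"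
        "seg x0 (act X x x0) \<subseteq> tree_hull x0 K" "seg x0 (act X y x0) \<subseteq> tree_hull x0 K"
      then show "seg x0 (act X (x \<otimes>\<^bsub>pi1 \<Gamma>\<^esub> y) x0) \<subseteq> tree_hull x0 K"
        by (rule seg_in_hull_mult[OF x0p])
    next
      fix v x assume vx: "v \<in> verts GG" "x \<in> carrier (VG v)"
      let ?q = "P v @ [Elt v x] @ inv_path \<Gamma> (P v)"
      have qp: "path base ?q base" using vx P(1) path_Elt path_inv_path path_append by meson
      show "seg x0 (act X (cls ?q) x0) \<subseteq> tree_hull x0 K"
      proof (cases "v \<in> nontrivial_vertices \<Gamma>")
        case True
        then show ?thesis
          using seg_in_hull_fixed[OF x0p loop_class_carrier[OF qp], of "k v"] k vx vset_pts
          by (auto simp: K_def)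
      next
        case False
        then have "x = \<one>\<^bsub>VG v\<^esub>" using vx by (auto simp: nontrivial_vertices_def)
        then have "[Elt v x] \<sim> []" using gog_step.one[of v \<Gamma> "[]" "[]"] vx by auto
        then have "?q \<sim> P v @ [] @ inv_path \<Gamma> (P v)" by (rule eqv_context)
        also have "\<dots> \<sim> []" using inv_path_cancel(1)[OF P(1)[OF vx(1)]] by simp
        finally have "cls ?q = cls []" by (rule loop_class_eqI)
        then show ?thesis using one by simp
      qed
    next
      fix e assume "e \<in> arcs GG"
      then show "seg x0 (act X (cls (P (tail GG e) @ [Traverse e True] @ inv_path \<Gamma> (P (head GG e)))) x0)
        \<subseteq> tree_hull x0 K"
        unfolding F_def[symmetric] by (intro hull1) (auto simp: K_def)
    next
      fix e assume "e \<in> arcs GG"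
      then show "seg x0 (act X (cls (P (head GG e) @ [Traverse e False] @ inv_path \<Gamma> (P (tail GG e)))) x0)
        \<subseteq> tree_hull x0 K"
        unfolding B_def[symmetric] by (intro hull1) (auto simp: K_def)
    qed
  qed
qed

end

section \<open>Equivariant maps between trees\<close>

locale tree_pair = X: tree_action X H + Y: tree_action Y H
  for X :: "('h, 'x) gtree" and Y :: "('h, 'y) gtree" and H :: "'h monoid" +
  assumes finite_orbits: "finite (edge_orbits H X)"
begin

abbreviation dX where "dX \<equiv> tdist X"
abbreviation dY where "dY \<equiv> tdist Y"

text \<open>A straight map is determined by its values at vertices, so it is modified there and then
  extended over the edges. Nothing is said about other points, so a straight map is itself a vertex
  map.\<close>

definition vertex_map :: "('x \<Rightarrow> 'y) \<Rightarrow> bool" where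
  "vertex_map F \<longleftrightarrow> (\<forall>v \<in> vset X. F v \<in> pts Y) \<and>
     (\<forall>h \<in> carrier H. \<forall>v \<in> vset X. F (act X h v) = act Y h (F v))"

text \<open>One component of a straight map. The Lipschitz condition is recovered in
  \<open>tree_map_Lipschitz\<close>, as there are only finitely many speeds.\<close>

definition tree_map :: "('x \<Rightarrow> 'y) \<Rightarrow> bool" where
  "tree_map f \<longleftrightarrow> f \<in> pts X \<rightarrow> pts Y \<and>
     (\<forall>h \<in> carrier H. \<forall>x \<in> pts X. f (act X h x) = act Y h (f x)) \<and>
     (\<forall>e \<in> edges X. \<exists>l \<ge> 0. has_speed X Y f e l)"

lemma vertex_mapD:
  assumes "vertex_map F"
  shows "v \<in> vset X \<Longrightarrow> F v \<in> pts Y"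
    and "h \<in> carrier H \<Longrightarrow> v \<in> vset X \<Longrightarrow> F (act X h v) = act Y h (F v)"
  using assms by (auto simp: vertex_map_def)

lemma tree_map_vertex_map: "tree_map f \<Longrightarrow> vertex_map f"
  by (auto simp: tree_map_def vertex_map_def X.vset_pts)

text \<open>Edges carry no orientation, so the choice ranges over both orders of the endpoints;
  \<open>extension_on_edge\<close> shows that both yield the same point.\<close>

definition extension :: "('x \<Rightarrow> 'y) \<Rightarrow> 'x \<Rightarrow> 'y" where
  "extension F x = (if x \<in> vset X then F x else
     (SOME y. \<exists>u w. X.adj u w \<and> x \<in> X.seg u w \<and> y \<in> Y.seg (F u) (F w) \<and>
        dY (F u) y = dX u x / dX u w * dY (F u) (F w)))"

lemma extension_on_edge:
  assumes F: "vertex_map F" and uw: "X.adj u w" and x: "x \<in> X.seg u w"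
  shows "extension F x \<in> Y.seg (F u) (F w)"
    and "dY (F u) (extension F x) = dX u x / dX u w * dY (F u) (F w)"
proof -
  note D = X.adjD[OF uw]
  have FY: "F u \<in> pts Y" "F w \<in> pts Y" using vertex_mapD(1)[OF F] D by auto
  have "extension F x \<in> Y.seg (F u) (F w) \<and>
    dY (F u) (extension F x) = dX u x / dX u w * dY (F u) (F w)"
  proof (cases "x \<in> vset X")
    case True
    then have "x = u \<or> x = w" using x D(6) by blast
    moreover have "dX u u = 0" "dY (F u) (F u) = 0" using D(3) FY by simp_all
    moreover have "extension F x = F x" using True by (simp add: extension_def)
    moreover have "dX u w / dX u w = 1" using D(7) by simp
    ultimately show ?thesis using Y.ends_in_segment[OF FY] by (elim disjE) simp_all
  next
    case False
    let ?P = "\<lambda>y u w. X.adj u w \<and> x \<in> X.seg u w \<and> y \<in> Y.seg (F u) (F w) \<and>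
        dY (F u) y = dX u x / dX u w * dY (F u) (F w)"
    have "0 \<le> dX u x / dX u w" "dX u x / dX u w \<le> 1"
      using X.segment_le(1)[OF x] D(7) by simp_all
    then have "0 \<le> dX u x / dX u w * dY (F u) (F w)" "dX u x / dX u w * dY (F u) (F w) \<le> dY (F u) (F w)"
      by (simp_all only: mult_nonneg_nonneg mult_left_le_one_le mdist_nonneg)
    then obtain y0 where "y0 \<in> Y.seg (F u) (F w)" "dY (F u) y0 = dX u x / dX u w * dY (F u) (F w)"
      using Y.segment_point[OF FY] by metis
    then have "\<exists>y u w. ?P y u w" using uw x by blast
    then have "\<exists>u w. ?P (SOME y. \<exists>u w. ?P y u w) u w" by (rule someI_ex)
    then obtain u' w' where P: "?P (extension F x) u' w'" using False by (auto simp: extension_def)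
    have "X.seg u' w' = X.seg u w"
      using X.edges_inter[of "X.seg u' w'" "X.seg u w" x] adjacent_edge P uw x False by metis
    then consider "u' = u" "w' = w" | "u' = w" "w' = u" using X.edge_ends_eq P uw by metis
    then show ?thesis
    proof cases
      case 1
      then show ?thesis using P by simp
    next
      case 2
      have ux: "dX u x = dX u w - dX w x" using x by (simp add: geod_seg_def mdist_commute)
      have "dY (F u) (extension F x) = dY (F u) (F w) - dX w x / dX u w * dY (F u) (F w)"
        using P 2 by (simp add: geod_seg_def mdist_commute)
      also have "\<dots> = dX u x / dX u w * dY (F u) (F w)"
        unfolding ux using D(7) by (simp add: diff_divide_distrib left_diff_distrib)
      finally show ?thesis using P 2 Y.segment_commute by blast
    qed
  qed
  then show "extension F x \<in> Y.seg (F u) (F w)"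
    "dY (F u) (extension F x) = dX u x / dX u w * dY (F u) (F w)" by auto
qed

lemma extension_vertex: "v \<in> vset X \<Longrightarrow> extension F v = F v"
  by (simp add: extension_def)

lemma extension_speed:
  assumes F: "vertex_map F" and uw: "X.adj u w"
  shows "has_speed X Y (extension F) (X.seg u w) (dY (F u) (F w) / dX u w)"
  unfolding has_speed_def
proof (intro ballI)
  fix x y assume xy: "x \<in> X.seg u w" "y \<in> X.seg u w"
  note D = X.adjD[OF uw]
  let ?l = "dY (F u) (F w) / dX u w"
  have FY: "F u \<in> pts Y" "F w \<in> pts Y" using vertex_mapD(1)[OF F] D by auto
  have "dY (extension F x) (extension F y) = \<bar>dY (F u) (extension F x) - dY (F u) (extension F y)\<bar>"
    by (rule Y.dist_on_segment[OF FY extension_on_edge(1)[OF F uw xy(1)] extension_on_edge(1)[OF F uw xy(2)]])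
  also have "\<dots> = \<bar>?l * (dX u x - dX u y)\<bar>"
  proof -
    have "dY (F u) (extension F x) = ?l * dX u x" "dY (F u) (extension F y) = ?l * dX u y"
      using extension_on_edge(2)[OF F uw xy(1)] extension_on_edge(2)[OF F uw xy(2)] by simp_all
    then show ?thesis by (simp only: right_diff_distrib)
  qed
  also have "\<dots> = ?l * \<bar>dX u x - dX u y\<bar>" by (simp add: abs_mult)
  also have "\<bar>dX u x - dX u y\<bar> = dX x y" using X.dist_on_segment[OF D(3,4) xy] by simp
  finally show "dY (extension F x) (extension F y) = ?l * dX x y" .
qed

lemma tree_map_extension:
  assumes F: "vertex_map F"
  shows "tree_map (extension F)"
  unfolding tree_map_def
proof (intro conjI ballI)
  show "extension F \<in> pts X \<rightarrow> pts Y"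
  proof
    fix x assume "x \<in> pts X"
    then show "extension F x \<in> pts Y"
    proof (cases rule: X.pts_cases)
      case 1
      then show ?thesis using extension_vertex vertex_mapD(1)[OF F] by simp
    next
      case (2 u w)
      then show ?thesis using extension_on_edge(1)[OF F] Y.seg_pts by blast
    qed
  qed
next
  fix h x assume h: "h \<in> carrier H" and "x \<in> pts X"
  then show "extension F (act X h x) = act Y h (extension F x)"
  proof (cases rule: X.pts_cases[OF \<open>x \<in> pts X\<close>])
    case 1
    then show ?thesis using extension_vertex vertex_mapD(2)[OF F h] X.act_vset[OF h] by simp
  next
    case (2 u w)
    note D = X.adjD[OF 2(1)]
    have FY: "F u \<in> pts Y" "F w \<in> pts Y" using vertex_mapD(1)[OF F] D by auto
    have hF: "F (act X h u) = act Y h (F u)" "F (act X h w) = act Y h (F w)"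
      using vertex_mapD(2)[OF F h] D by auto
    have adj: "X.adj (act X h u) (act X h w)" and hx: "act X h x \<in> X.seg (act X h u) (act X h w)"
      using X.act_adj[OF h 2(1)] X.act_in_seg[OF h D(3,4) 2(2)] by auto
    note ex = extension_on_edge[OF F 2(1,2)] and ehx = extension_on_edge[OF F adj hx, unfolded hF]
    have eY: "extension F x \<in> pts Y" using ex(1) Y.seg_pts by blast
    have "act Y h (extension F x) \<in> Y.seg (act Y h (F u)) (act Y h (F w))"
      by (rule Y.act_in_seg[OF h FY ex(1)])
    moreover have "dY (act Y h (F u)) (act Y h (extension F x)) = dY (F u) (extension F x)"
      by (rule Y.act_dist[OF h FY(1) eY])
    moreover have "\<dots> = dY (act Y h (F u)) (extension F (act X h x))"
      unfolding ehx(2) ex(2) using X.act_dist[OF h] Y.act_dist[OF h FY] D(3,4) X.seg_pts[OF 2(2)]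
      by simp
    ultimately show ?thesis
      using Y.segment_eqI[OF Y.act_closed[OF h FY(1)] Y.act_closed[OF h FY(2)] ehx(1)] by simp
  qed
next
  fix e assume "e \<in> edges X"
  then obtain u w where uw: "X.adj u w" "e = X.seg u w" by (rule edgesE)
  then show "\<exists>l \<ge> 0. has_speed X Y (extension F) e l"
    using extension_speed[OF F uw(1)] by (intro exI[of _ "dY (F u) (F w) / dX u w"]) simp
qed

text \<open>Within an edge both maps proceed proportionally along the segments between the images of
  the ends, so \<open>dist_convex\<close> bounds the displacement by that of the ends.\<close>

lemma tree_map_displacement:
  assumes f: "tree_map f" and g: "tree_map g"
    and le: "\<And>v. v \<in> vset X \<Longrightarrow> dY (f v) (g v) \<le> r" and x: "x \<in> pts X"
  shows "dY (f x) (g x) \<le> r"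
  using x
proof (cases rule: X.pts_cases)
  case (2 u w)
  note D = X.adjD[OF 2(1)]
  define t where "t = dX u x / dX u w"
  have t: "0 \<le> t" "t \<le> 1" using X.segment_le(1)[OF 2(2)] D(7) by (simp_all add: t_def)
  have *: "k u \<in> pts Y \<and> k w \<in> pts Y \<and> k x \<in> Y.seg (k u) (k w) \<and> dY (k u) (k x) = t * dY (k u) (k w)"
    if k: "tree_map k" for k
  proof -
    obtain l where l: "has_speed X Y k (X.seg u w) l"
      using k adjacent_edge[OF 2(1)] unfolding tree_map_def by blast
    have "dX u x + dX x w = dX u w" using 2(2) by (simp add: geod_seg_def)
    then have "l * dX u x + l * dX x w = l * dX u w" by (simp flip: distrib_left)
    moreover have "dY (k u) (k x) = l * dX u x" "dY (k x) (k w) = l * dX x w" "dY (k u) (k w) = l * dX u w"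
      using l D(8,9) 2(2) unfolding has_speed_def by blast+
    moreover have "k u \<in> pts Y" "k w \<in> pts Y" "k x \<in> pts Y" using k D x unfolding tree_map_def
      by auto
    ultimately show ?thesis using D(7) by (simp add: geod_seg_def t_def)
  qed
  have "dY (f x) (g x) \<le> max (dY (f u) (g u)) (dY (f w) (g w))"
    using *[OF f] *[OF g] t by (intro Y.dist_convex[where t = t]) auto
  then show ?thesis using le[OF D(1)] le[OF D(2)] by linarith
qed (rule le)

lemma edges_speed_Lipschitz:
  assumes f: "tree_map f" and le: "\<And>u w. X.adj u w \<Longrightarrow> dY (f u) (f w) \<le> L * dX u w"
    and x: "x \<in> pts X" "y \<in> pts X"
  shows "dY (f x) (f y) \<le> L * dX x y"
proof (rule X.Lipschitz_from_edges[OF _ _ x])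
  show "f x \<in> pts Y" if "x \<in> pts X" for x using f that by (auto simp: tree_map_def)
  fix u w x y assume uw: "X.adj u w" and xy: "x \<in> X.seg u w" "y \<in> X.seg u w"
  note D = X.adjD[OF uw]
  obtain l where l: "has_speed X Y f (X.seg u w) l"
    using f adjacent_edge[OF uw] unfolding tree_map_def by blast
  then have "dY (f u) (f w) = l * dX u w" "dY (f x) (f y) = l * dX x y"
    using D(8,9) xy unfolding has_speed_def by blast+
  moreover from this have "l \<le> L" using le[OF uw] D(7) by simp
  ultimately show "dY (f x) (f y) \<le> L * dX x y" by (simp add: mult_right_mono)
qed

text \<open>Straightness fixes the speed once the images of the ends are known, so tension can be
  tested at vertices.\<close>

lemma has_speed_iff:
  assumes f: "tree_map f" and uw: "X.adj u w"
  shows "has_speed X Y f (X.seg u w) l \<longleftrightarrow> dY (f u) (f w) = l * dX u w"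
proof
  note D = X.adjD[OF uw]
  show "has_speed X Y f (X.seg u w) l \<Longrightarrow> dY (f u) (f w) = l * dX u w"
    using D(8,9) unfolding has_speed_def by blast
  obtain l' where l': "has_speed X Y f (X.seg u w) l'"
    using f adjacent_edge[OF uw] unfolding tree_map_def by blast
  assume "dY (f u) (f w) = l * dX u w"
  moreover have "dY (f u) (f w) = l' * dX u w" using l' D(8,9) unfolding has_speed_def by blast
  ultimately have "l = l'" using D(7) by simp
  then show "has_speed X Y f (X.seg u w) l" using l' by simp
qed

text \<open>Lets maxima over all edges be taken for invariant quantities, although the tree itself
  may have infinitely many edges.\<close>

lemma finite_edge_values:
  fixes \<phi> :: "'x \<Rightarrow> 'x \<Rightarrow> real"
  assumes inv: "\<And>h u w. h \<in> carrier H \<Longrightarrow> X.adj u w \<Longrightarrow> \<phi> (act X h u) (act X h w) = \<phi> u w"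
    and sym: "\<And>u w. \<phi> u w = \<phi> w u"
  shows "finite {\<phi> u w | u w. X.adj u w}"
proof -
  have "\<exists>u w. X.adj u w \<and> X.seg u w \<in> E" if E: "E \<in> edge_orbits H X" for E
  proof -
    obtain e where e: "e \<in> edges X" "E = X.edge_orbit e" using E by (auto simp: X.edge_orbits_eq)
    obtain u w where "X.adj u w" "e = X.seg u w" using e(1) by (rule edgesE)
    then show ?thesis using X.edge_orbit_self[OF e(1)] e(2) by blast
  qed
  then obtain U W where UW: "\<And>E. E \<in> edge_orbits H X \<Longrightarrow> X.adj (U E) (W E) \<and> X.seg (U E) (W E) \<in> E"
    by metis
  have "{\<phi> u w | u w. X.adj u w} \<subseteq> (\<lambda>E. \<phi> (U E) (W E)) ` edge_orbits H X"
  proof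
    fix t assume "t \<in> {\<phi> u w | u w. X.adj u w}"
    then obtain u w where uw: "X.adj u w" "t = \<phi> u w" by blast
    define E where "E = X.edge_orbit (X.seg u w)"
    have e: "X.seg u w \<in> edges X" by (rule adjacent_edge[OF uw(1)])
    have E: "E \<in> edge_orbits H X" "X.seg u w \<in> E"
      using e X.edge_orbit_self by (auto simp: E_def X.edge_orbits_eq)
    have UWa: "X.adj (U E) (W E)" "X.seg (U E) (W E) \<in> E" using UW[OF E(1)] by auto
    obtain h where h: "h \<in> carrier H" "X.seg u w = act X h ` X.seg (U E) (W E)"
      using X.edge_orbits_trans[OF E(1) UWa(2) E(2)] by blast
    then have "X.seg u w = X.seg (act X h (U E)) (act X h (W E))"
      using X.act_seg[OF h(1) X.adjD(3,4)[OF UWa(1)]] by simp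
    then have "u = act X h (U E) \<and> w = act X h (W E) \<or> u = act X h (W E) \<and> w = act X h (U E)"
      using X.edge_ends_eq[OF uw(1) X.act_adj[OF h(1) UWa(1)]] by blast
    then have "t = \<phi> (U E) (W E)" using uw(2) inv[OF h(1) UWa(1)] sym by metis
    then show "t \<in> (\<lambda>E. \<phi> (U E) (W E)) ` edge_orbits H X" using E(1) by blast
  qed
  then show ?thesis using finite_orbits finite_surj by blast
qed

section \<open>Gates and the tension graph\<close>

text \<open>Adjacency in the subforest of the tree that lies over the subgraph \<open>S\<close> of
  the quotient.\<close>

definition adj_in :: "'x set set set \<Rightarrow> 'x \<Rightarrow> 'x \<Rightarrow> bool" where
  "adj_in S u w \<longleftrightarrow> X.adj u w \<and> X.seg u w \<in> \<Union>S"

lemma adj_in_commute: "adj_in S u w \<Longrightarrow> adj_in S w u"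
  by (auto simp: adj_in_def X.segment_commute[of w u] intro: X.adj_commute)

lemma adj_in_act:
  assumes "S \<subseteq> edge_orbits H X" "h \<in> carrier H" "adj_in S u w"
  shows "adj_in S (act X h u) (act X h w)"
proof -
  obtain E where E: "E \<in> S" "X.seg u w \<in> E" and uw: "X.adj u w" using assms
    by (auto simp: adj_in_def)
  have "act X h ` X.seg u w \<in> E" using X.edge_orbits_act E assms by blast
  then show ?thesis
    using E(1) X.act_seg[OF assms(2)] X.adjD(3,4)[OF uw] X.act_adj[OF assms(2) uw]
    by (auto simp: adj_in_def)
qed

text \<open>
  The germs at \<open>v\<close> of two edges with endpoints \<open>w\<close> and \<open>w'\<close> that are not collapsed lie in
  different gates if and only if the images of these edges meet in \<open>F v\<close> only.
\<close>

definition two_gated :: "('x \<Rightarrow> 'y) \<Rightarrow> 'x set set set \<Rightarrow> 'x \<Rightarrow> bool" where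
  "two_gated F S v \<longleftrightarrow> (\<exists>w w'. adj_in S v w \<and> adj_in S v w' \<and>
     dY (F w) (F w') = dY (F w) (F v) + dY (F v) (F w'))"

text \<open>Translates the metric form of having two gates into the germ condition: a point shared
  by the two images near \<open>f v\<close>, but different from it, would give a path from
  \<open>f w\<close> to \<open>f w'\<close> shorter than the one through \<open>f v\<close>.\<close>

lemma not_same_gate:
  assumes f: "tree_map f" and w: "X.adj v w" and w': "X.adj v w'"
    and l: "l > 0" "dY (f v) (f w) = l * dX v w" "dY (f v) (f w') = l * dX v w'"
    and gate: "dY (f w) (f w') = dY (f w) (f v) + dY (f v) (f w')"
  shows "\<not> same_gate X Y f v (X.seg v w) (X.seg v w')"
proof
  assume same: "same_gate X Y f v (X.seg v w) (X.seg v w')"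
  note D = X.adjD[OF w] and D' = X.adjD[OF w']
  have fY: "f x \<in> pts Y" if "x \<in> pts X" for x using f that by (auto simp: tree_map_def)
  show False
  proof (cases "X.seg v w = X.seg v w'")
    case True
    then have "w = w'" using X.edge_ends_eq[OF w w'] D by blast
    moreover have "dY (f w) (f w) = 0" using fY[OF D(4)] by simp
    ultimately have "dY (f v) (f w) = 0" using gate by (simp add: mdist_commute)
    then show False using l(2) D(7) \<open>l > 0\<close> by simp
  next
    case False
    then obtain r where r: "r > 0"
      and ball: "f ` X.seg v w \<inter> mball_of (met Y) (f v) r = f ` X.seg v w' \<inter> mball_of (met Y) (f v) r"
      using same unfolding same_gate_def by blast
    \<comment> \<open>Small enough for a point on the edge, and for its image, at distance at most
      \<open>r / 2\<close> from \<open>f v\<close>, to lie in the ball.\<close>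
    define s where "s = min (dX v w) (r / (2 * l))"
    have s: "0 < s" "s \<le> dX v w" "l * s < r"
      using D(7) r l(1) by (auto simp: s_def min_def field_simps)
    obtain x where x: "x \<in> X.seg v w" "dX v x = s"
      using X.segment_point[OF D(3,4), of s] s by auto
    have speed: "has_speed X Y f (X.seg v w) l" "has_speed X Y f (X.seg v w') l"
      using has_speed_iff[OF f w] has_speed_iff[OF f w'] l by auto
    have fx: "dY (f v) (f x) = l * s" "dY (f x) (f w) = l * dX x w"
      using speed(1) x D(8,9) unfolding has_speed_def by auto
    have xp: "x \<in> pts X" using x X.seg_pts by blast
    have "f x \<in> f ` X.seg v w \<inter> mball_of (met Y) (f v) r"
      using x(1) fx s(3) fY[OF D(3)] fY[OF xp] by simp
    then obtain x' where x': "x' \<in> X.seg v w'" "f x = f x'" unfolding ball by blast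
    have "dY (f v) (f x') = l * dX v x'" "dY (f x') (f w') = l * dX x' w'"
      using speed(2) x' D'(8,9) unfolding has_speed_def by auto
    moreover have "dX v x' + dX x' w' = dX v w'" "dX v x + dX x w = dX v w"
      using x' x by (auto simp: geod_seg_def)
    moreover have "dY (f w) (f w') \<le> dY (f w) (f x) + dY (f x) (f w')"
      by (intro mdist_triangle fY D(4) D'(4) xp)
    moreover from calculation have "l * dX v x' + l * dX x' w' = l * dX v w'" "l * dX v x + l * dX x w = l * dX v w"
      by (metis distrib_left)+
    moreover from calculation have "l * dX v x' = l * s" using fx(1) x'(2) by simp
    ultimately have "l * s \<le> 0"
      using gate l(2,3) fx x'(2) x(2) mdist_commute[of "met Y" "f w" "f v"] mdist_commute[of "met Y" "f w" "f x"]
      by simp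
    then show False using s(1) l(1) by (simp add: mult_le_0_iff)
  qed
qed

text \<open>
  At a vertex \<open>v\<close> of the core maximising the distance from \<open>F v\<close> to \<open>G v\<close>, one of the gates points
  away from \<open>G v\<close>; if \<open>G\<close> stretched less than \<open>F\<close>, the distance would grow along that edge.
\<close>

lemma core_stretch_le:
  assumes C: "C \<subseteq> edge_orbits H X" and F: "vertex_map F" and G: "vertex_map G"
    and speed: "\<And>u w. adj_in C u w \<Longrightarrow> dY (F u) (F w) = l * dX u w"
    and gates: "\<And>v w. adj_in C v w \<Longrightarrow> two_gated F C v"
    and nonempty: "C \<noteq> {}"
    and G_le: "\<And>u w. adj_in C u w \<Longrightarrow> dY (G u) (G w) \<le> L * dX u w"
  shows "l \<le> L"
proof -
  define VC where "VC = {v. \<exists>w. adj_in C v w}"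
  define D where "D v = dY (F v) (G v)" for v
  have Dact: "D (act X h v) = D v" if "h \<in> carrier H" "v \<in> vset X" for h v
    unfolding D_def using vertex_mapD[OF F] vertex_mapD[OF G] Y.act_dist that by simp
  \<comment> \<open>The maximum is formed over edges, because these fall into finitely many orbits
    and the displacement \<open>D\<close> is invariant.\<close>
  define M where "M = {max (D u) (D w) | u w. adj_in C u w}"
  have "finite {max (D u) (D w) | u w. X.adj u w}"
    using Dact X.adjD(1,2) by (intro finite_edge_values) (auto simp: max.commute)
  then have fin: "finite M" by (rule rev_finite_subset) (auto simp: M_def adj_in_def)
  obtain E where E: "E \<in> C" "E \<in> edge_orbits H X" using nonempty C by blast
  then obtain e where e: "e \<in> edges X" "E = X.edge_orbit e" by (auto simp: X.edge_orbits_eq)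
  then obtain x y where "X.adj x y" "e = X.seg x y" by (auto elim: edgesE)
  then have "adj_in C x y" using X.edge_orbit_self[OF e(1)] e(2) E(1) by (auto simp: adj_in_def)
  then have "M \<noteq> {}" by (auto simp: M_def)
  then have "Max M \<in> M" using fin by (rule Max_in[rotated])
  moreover have "\<exists>u w. adj_in C u w \<and> max (D u) (D w) = t" if "t \<in> M" for t
    using that by (auto simp: M_def)
  ultimately obtain u w0 where uw: "adj_in C u w0" "max (D u) (D w0) = Max M" by blast
  define v where "v = (if D u \<le> D w0 then w0 else u)"
  have v: "v \<in> VC" using uw(1) adj_in_commute by (auto simp: v_def VC_def)
  have v_max: "D x \<le> D v" if x: "x \<in> VC" for x
  proof -
    obtain y where "adj_in C x y" using x by (auto simp: VC_def)
    then have "max (D x) (D y) \<le> Max M" by (intro Max_ge[OF fin]) (auto simp: M_def)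
    also have "Max M = D v" using uw(2) by (auto simp: v_def max_def)
    finally show ?thesis by simp
  qed
  from v obtain w w' where w: "adj_in C v w" "adj_in C v w'"
    and ww: "dY (F w) (F w') = dY (F w) (F v) + dY (F v) (F w')"
    using gates unfolding VC_def two_gated_def by blast
  \<comment> \<open>\<open>F x\<close> lies beyond \<open>F v\<close> as seen from
    \<open>G v\<close>. As the distance to the image under \<open>G\<close> must not exceed
    \<open>D v\<close> at \<open>x\<close>, \<open>G\<close> has to keep up with the speed
    \<open>l\<close> along this edge.\<close>
  have step: "l \<le> L" if x: "adj_in C v x" "dY (F x) (F v) + D v \<le> dY (F x) (G v)" for x
  proof -
    have ax: "X.adj v x" using x(1) by (simp add: adj_in_def)
    note Dx = X.adjD[OF ax]
    have "dY (F x) (G v) \<le> dY (F x) (G x) + dY (G x) (G v)"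
      using vertex_mapD(1)[OF F] vertex_mapD(1)[OF G] Dx by (intro mdist_triangle) auto
    moreover have "dY (F x) (G x) \<le> D v" using v_max[of x] adj_in_commute[OF x(1)]
      by (auto simp: VC_def D_def)
    moreover have "dY (G x) (G v) \<le> L * dX v x" using G_le[OF x(1)] by (simp add: mdist_commute)
    moreover have "dY (F x) (F v) = l * dX v x" using speed[OF x(1)] by (simp add: mdist_commute)
    ultimately have "l * dX v x \<le> L * dX v x" using x(2) by linarith
    then show ?thesis using Dx(7) by simp
  qed
  have p: "v \<in> vset X" "w \<in> vset X" "w' \<in> vset X" using w X.adjD(1,2) unfolding adj_in_def by blast+
  \<comment> \<open>\<open>F v\<close> is between \<open>F w\<close> and \<open>F w'\<close>, so by
    the four-point condition the way from \<open>G v\<close> to at least one of them passes through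
    \<open>F v\<close>.\<close>
  have "dY (F w) (F w') + dY (F v) (G v) \<le> dY (F w) (F v) + dY (F w') (G v) \<or>
    dY (F w) (F w') + dY (F v) (G v) \<le> dY (F w) (G v) + dY (F w') (F v)"
    using p vertex_mapD(1)[OF F] vertex_mapD(1)[OF G] by (intro Y.four_point_le) auto
  then have "dY (F w') (F v) + D v \<le> dY (F w') (G v) \<or> dY (F w) (F v) + D v \<le> dY (F w) (G v)"
    using ww by (auto simp: D_def mdist_commute)
  then show ?thesis using step w by blast
qed

text \<open>With a single gate, the image of each edge of \<open>S\<close> at \<open>v\<close>
  shares a nondegenerate initial segment with that of the edge to \<open>w0\<close>. An element
  fixing \<open>v\<close> moves this edge to another such edge and fixes a point of the shared
  segment besides \<open>F v\<close>, so it is trivial. Then the star of \<open>v\<close> is finite,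
  and the initial segments have a common part of positive length \<open>r\<close>.\<close>

lemma one_gated_vertex:
  assumes S: "S \<subseteq> edge_orbits H X" and F: "vertex_map F"
    and w0: "adj_in S v w0" and one: "\<not> two_gated F S v"
  shows "stabilizer H (act X) v = {\<one>\<^bsub>H\<^esub>}"
    and "\<exists>r > 0. \<forall>s. 0 \<le> s \<and> s \<le> r \<longrightarrow> (\<exists>y. \<forall>w. adj_in S v w \<longrightarrow>
      y \<in> Y.seg (F v) (F w) \<and> dY (F v) y = s)"
proof -
  have vV: "v \<in> vset X" and w0V: "w0 \<in> vset X" using w0 X.adjD(1,2) by (auto simp: adj_in_def)
  have vp: "v \<in> pts X" using vV X.vset_pts by blast
  have FY: "F x \<in> pts Y" if "x \<in> vset X" for x using vertex_mapD(1)[OF F that] .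
  have gate: "\<exists>z. z \<in> Y.seg (F v) (F w0) \<and> z \<in> Y.seg (F v) (F w) \<and> z \<noteq> F v"
    if w: "adj_in S v w" for w
  proof -
    have wV: "w \<in> vset X" using w X.adjD by (auto simp: adj_in_def)
    obtain z where z: "z \<in> Y.seg (F w0) (F w)" "z \<in> Y.seg (F w0) (F v)" "z \<in> Y.seg (F w) (F v)"
      using Y.segment_proj[OF FY[OF w0V] FY[OF wV] FY[OF vV]] by metis
    have "z \<noteq> F v"
    proof
      assume "z = F v"
      then have "dY (F w0) (F w) = dY (F w0) (F v) + dY (F v) (F w)" using z(1)
        by (simp add: geod_seg_def)
      then show False using one w0 w unfolding two_gated_def by blast
    qed
    then show ?thesis using z Y.segment_commute by metis
  qed
  show stab: "stabilizer H (act X) v = {\<one>\<^bsub>H\<^esub>}"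
  proof (intro equalityI subsetI)
    fix h assume "h \<in> stabilizer H (act X) v"
    then have h: "h \<in> carrier H" "act X h v = v" by (auto simp: stabilizer_def)
    have "adj_in S v (act X h w0)" using adj_in_act[OF S h(1) w0] h(2) by simp
    then obtain z where z: "z \<in> Y.seg (F v) (F w0)" "z \<in> Y.seg (F v) (F (act X h w0))" "z \<noteq> F v"
      using gate by blast
    have zp: "z \<in> pts Y" using z Y.seg_pts by blast
    have hF: "act Y h (F v) = F v" "F (act X h w0) = act Y h (F w0)"
      using vertex_mapD(2)[OF F h(1)] vV w0V h(2) by metis+
    have hw0: "F (act X h w0) \<in> pts Y" using FY X.act_vset[OF h(1) w0V] by blast
    \<comment> \<open>This point and \<open>z\<close> lie on one segment at the same distance from
      \<open>F v\<close>, hence they are equal.\<close>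
    have "act Y h z \<in> Y.seg (F v) (F (act X h w0))"
      using Y.act_in_seg[OF h(1) FY[OF vV] FY[OF w0V] z(1)] hF by simp
    moreover have "dY (F v) (act Y h z) = dY (F v) z"
      using Y.act_dist[OF h(1) FY[OF vV] zp] hF by simp
    ultimately have "act Y h z = z"
      using Y.segment_eqI[OF FY[OF vV] hw0 _ z(2)] by blast
    then have "h = \<one>\<^bsub>H\<^esub>"
      using Y.act_eq_one_if_fixes_two[OF h(1) FY[OF vV] hF(1) zp] z(3) by blast
    then show "h \<in> {\<one>\<^bsub>H\<^esub>}" by simp
  next
    fix h assume "h \<in> {\<one>\<^bsub>H\<^esub>}"
    then show "h \<in> stabilizer H (act X) v" using X.act_one[OF vp] by (simp add: stabilizer_def)
  qed
  define N where "N = {w. adj_in S v w}"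
  have finN: "finite N"
    using X.finite_star[OF finite_orbits vV stab]
    by (rule rev_finite_subset) (auto simp: N_def adj_in_def)
  obtain z where z: "\<And>w. w \<in> N \<Longrightarrow> z w \<in> Y.seg (F v) (F w0) \<and> z w \<in> Y.seg (F v) (F w) \<and> z w \<noteq> F v"
    using gate unfolding N_def mem_Collect_eq by metis
  \<comment> \<open>Positivity of this minimum rests on finiteness of the star, hence on the trivial
    stabiliser.\<close>
  define r where "r = Min ((\<lambda>w. dY (F v) (z w)) ` N)"
  have w0N: "w0 \<in> N" using w0 by (simp add: N_def)
  have zpos: "dY (F v) (z w) > 0" if "w \<in> N" for w
    using z[OF that] FY[OF vV] Y.seg_pts by (simp add: order_less_le) (metis mdist_zero)
  have "r > 0" unfolding r_def using finN w0N zpos by (subst Min_gr_iff) auto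
  moreover have "\<exists>y. \<forall>w. adj_in S v w \<longrightarrow> y \<in> Y.seg (F v) (F w) \<and> dY (F v) y = s"
    if s: "0 \<le> s" "s \<le> r" for s
  proof -
    have sz: "s \<le> dY (F v) (z w)" if "w \<in> N" for w
    proof -
      have "r \<le> dY (F v) (z w)" unfolding r_def using finN that by (intro Min_le) auto
      then show ?thesis using s(2) by linarith
    qed
    have "s \<le> dY (F v) (F w0)"
      using sz[OF w0N] Y.segment_le(1) z[OF w0N] by (meson order_trans)
    then obtain y where y: "y \<in> Y.seg (F v) (F w0)" "dY (F v) y = s"
      using Y.segment_point[OF FY[OF vV] FY[OF w0V] s(1)] by metis
    have "y \<in> Y.seg (F v) (F w)" if w: "adj_in S v w" for w
    proof -
      have wN: "w \<in> N" using w by (simp add: N_def)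
      have wV: "w \<in> vset X" using w X.adjD by (auto simp: adj_in_def)
      have "dY y (z w) = \<bar>s - dY (F v) (z w)\<bar>"
        using Y.dist_on_segment[OF FY[OF vV] FY[OF w0V] y(1)] z[OF wN] y(2) by blast
      then have "y \<in> Y.seg (F v) (z w)"
        using sz[OF wN] y Y.seg_pts[OF y(1)] by (simp add: geod_seg_def)
      moreover have "Y.seg (F v) (z w) \<subseteq> Y.seg (F v) (F w)"
        using Y.segment_mono[OF FY[OF vV] FY[OF wV]] z[OF wN] by blast
      ultimately show ?thesis by blast
    qed
    then show ?thesis using y(2) by blast
  qed
  ultimately show "\<exists>r > 0. \<forall>s. 0 \<le> s \<and> s \<le> r \<longrightarrow> (\<exists>y. \<forall>w. adj_in S v w \<longrightarrow>
      y \<in> Y.seg (F v) (F w) \<and> dY (F v) y = s)" by blast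
qed

section \<open>Slowing down the edges outside the core\<close>

text \<open>When \<open>v\<close> has trivial stabiliser, the chosen \<open>h\<close> is the only
  one with \<open>x = act X h v\<close>, which makes the modified map equivariant.\<close>

definition move_orbit :: "('x \<Rightarrow> 'y) \<Rightarrow> 'x \<Rightarrow> 'y \<Rightarrow> 'x \<Rightarrow> 'y" where
  "move_orbit F v y x =
     (if \<exists>h \<in> carrier H. x = act X h v then act Y (SOME h. h \<in> carrier H \<and> x = act X h v) y else F x)"

lemma move_orbit_orbit:
  assumes stab: "stabilizer H (act X) v = {\<one>\<^bsub>H\<^esub>}" and v: "v \<in> pts X" and h: "h \<in> carrier H"
  shows "move_orbit F v y (act X h v) = act Y h y"
proof -
  define g where "g = (SOME g. g \<in> carrier H \<and> act X h v = act X g v)"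
  have g: "g \<in> carrier H \<and> act X h v = act X g v" unfolding g_def by (rule someI) (use h in simp)
  then have "act X (inv\<^bsub>H\<^esub> g \<otimes>\<^bsub>H\<^esub> h) v = v" using X.act_mult X.act_inv h v by simp
  then have "inv\<^bsub>H\<^esub> g \<otimes>\<^bsub>H\<^esub> h = \<one>\<^bsub>H\<^esub>" using stab g h by (auto simp: stabilizer_def)
  then have "g = h" using g h X.H.inv_equality[of "inv\<^bsub>H\<^esub> g" h] X.H.inv_comm[of "inv\<^bsub>H\<^esub> g" h]
    by (metis X.H.inv_closed X.H.inv_inv X.H.inv_equality)
  then show ?thesis using h unfolding move_orbit_def g_def[symmetric] by auto
qed

lemma move_orbit_other:
  "(\<And>h. h \<in> carrier H \<Longrightarrow> x \<noteq> act X h v) \<Longrightarrow> move_orbit F v y x = F x"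
  by (auto simp: move_orbit_def)

lemma vertex_map_move_orbit:
  assumes F: "vertex_map F" and stab: "stabilizer H (act X) v = {\<one>\<^bsub>H\<^esub>}" and v: "v \<in> pts X"
    and y: "y \<in> pts Y"
  shows "vertex_map (move_orbit F v y)"
  unfolding vertex_map_def
proof (intro conjI ballI)
  fix x assume "x \<in> vset X"
  then show "move_orbit F v y x \<in> pts Y"
    using move_orbit_orbit[OF stab v] move_orbit_other[of x v F y] Y.act_closed y vertex_mapD(1)[OF F]
    by (cases "\<exists>h \<in> carrier H. x = act X h v") auto
next
  fix g x assume g: "g \<in> carrier H" and x: "x \<in> vset X"
  have xp: "x \<in> pts X" using x X.vset_pts by blast
  show "move_orbit F v y (act X g x) = act Y g (move_orbit F v y x)"
  proof (cases "\<exists>h \<in> carrier H. x = act X h v")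
    case True
    then obtain h where h: "h \<in> carrier H" "x = act X h v" by blast
    then have "act X g x = act X (g \<otimes>\<^bsub>H\<^esub> h) v" using X.act_mult g v by simp
    then show ?thesis using h g move_orbit_orbit[OF stab v] Y.act_mult y by simp
  next
    case False
    have "act X g x \<noteq> act X h v" if h: "h \<in> carrier H" for h
    proof
      assume "act X g x = act X h v"
      then have "x = act X (inv\<^bsub>H\<^esub> g \<otimes>\<^bsub>H\<^esub> h) v" using X.act_inv[OF g xp] X.act_mult g h v by simp
      then show False using False g h by blast
    qed
    then show ?thesis using move_orbit_other False vertex_mapD(2)[OF F g x] by metis
  qed
qed

lemma slow_down_outside_core:
  assumes "finite S" and "S \<subseteq> edge_orbits H X" and F: "vertex_map F" and "l > 0"
    and speed: "\<And>u w. adj_in S u w \<Longrightarrow> dY (F u) (F w) = l * dX u w"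
  shows "\<exists>C \<subseteq> S. (\<forall>v w. adj_in C v w \<longrightarrow> two_gated F C v) \<and>
    (\<exists>\<eta>0 > 0. \<forall>\<eta>. 0 < \<eta> \<and> \<eta> \<le> \<eta>0 \<longrightarrow> (\<exists>G. vertex_map G \<and>
      (\<forall>v \<in> vset X. dY (F v) (G v) \<le> \<eta> * X.volume S) \<and>
      (\<forall>v \<in> vset X. (\<forall>w. \<not> adj_in S v w) \<longrightarrow> G v = F v) \<and>
      (\<forall>v w. adj_in C v w \<longrightarrow> G v = F v) \<and>
      (\<forall>u w. adj_in (S - C) u w \<longrightarrow> dY (G u) (G w) \<le> (l - \<eta>) * dX u w)))"
  using assms(1,2) speed
proof (induction S rule: finite_psubset_induct)
  case (psubset S)
  note S = \<open>S \<subseteq> edge_orbits H X\<close> and speedS = psubset.prems(2)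
  show ?case
  proof (cases "\<forall>v w. adj_in S v w \<longrightarrow> two_gated F S v")
    case True
    have "dY (F v) (F v) \<le> \<eta> * X.volume S" if "v \<in> vset X" "\<eta> > 0" for v \<eta>
    proof -
      have "dY (F v) (F v) = 0" using vertex_mapD(1)[OF F that(1)] by simp
      then show ?thesis using that(2) X.volume_nonneg[OF S] by simp
    qed
    then show ?thesis using True F
      by (intro exI[of _ S]) (auto intro!: exI[of _ 1] exI[of _ F] simp: adj_in_def)
  next
    case False
    then obtain v w0 where w0: "adj_in S v w0" and one: "\<not> two_gated F S v" by blast
    have vV: "v \<in> vset X" using w0 X.adjD by (auto simp: adj_in_def)
    have vp: "v \<in> pts X" using vV X.vset_pts by blast
    have FY: "F x \<in> pts Y" if "x \<in> vset X" for x using vertex_mapD(1)[OF F that] .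
    note stab = one_gated_vertex(1)[OF S F w0 one]
    obtain r where r: "r > 0" and toward: "\<And>s. 0 \<le> s \<Longrightarrow> s \<le> r \<Longrightarrow>
      \<exists>y. \<forall>w. adj_in S v w \<longrightarrow> y \<in> Y.seg (F v) (F w) \<and> dY (F v) y = s"
      using one_gated_vertex(2)[OF S F w0 one] by blast
    \<comment> \<open>All orbits of \<open>S\<close> with an edge at \<open>v\<close> are discarded,
      so no translate of \<open>v\<close> is incident to \<open>S'\<close>, and moving the orbit of
      \<open>v\<close> does not disturb what is achieved on \<open>S'\<close>.\<close>
    define S' where "S' = {E \<in> S. \<forall>w. \<not> (X.adj v w \<and> X.seg v w \<in> E)}"
    obtain E0 where E0: "E0 \<in> S" "X.seg v w0 \<in> E0" "X.adj v w0" using w0 by (auto simp: adj_in_def)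
    have "S' \<subset> S" using E0 unfolding S'_def by blast
    have S'S: "S' \<subseteq> edge_orbits H X" using S \<open>S' \<subset> S\<close> by blast
    have speed': "dY (F u) (F w) = l * dX u w" if "adj_in S' u w" for u w
      using speedS[of u w] that \<open>S' \<subset> S\<close> by (auto simp: adj_in_def)
    have off: "x \<noteq> act X h v" if h: "h \<in> carrier H" and xw: "adj_in S' x w" for h x w
    proof
      assume "x = act X h v"
      then have "adj_in S' v (act X (inv\<^bsub>H\<^esub> h) w)"
        using adj_in_act[OF S'S _ xw, of "inv\<^bsub>H\<^esub> h"] h X.act_inv[OF h vp] by simp
      then show False by (auto simp: adj_in_def S'_def)
    qed
    obtain C \<eta>1 where C: "C \<subseteq> S'" "\<forall>v w. adj_in C v w \<longrightarrow> two_gated F C v" and \<eta>1: "\<eta>1 > 0"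
      and IH: "\<And>\<eta>. 0 < \<eta> \<Longrightarrow> \<eta> \<le> \<eta>1 \<Longrightarrow> \<exists>G. vertex_map G \<and>
      (\<forall>v \<in> vset X. dY (F v) (G v) \<le> \<eta> * X.volume S') \<and>
      (\<forall>v \<in> vset X. (\<forall>w. \<not> adj_in S' v w) \<longrightarrow> G v = F v) \<and>
      (\<forall>v w. adj_in C v w \<longrightarrow> G v = F v) \<and>
      (\<forall>u w. adj_in (S' - C) u w \<longrightarrow> dY (G u) (G w) \<le> (l - \<eta>) * dX u w)"
      using psubset.IH[OF \<open>S' \<subset> S\<close> S'S speed'] by blast
    \<comment> \<open>This gap in volume pays for the loss of speed: each discarded orbit accounts
      for the length of its edges.\<close>
    have vol': "X.volume S' + dX x w \<le> X.volume S"
      if xw: "X.adj x w" "X.seg x w \<in> E" "E \<in> S - S'" for x w E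
    proof -
      have finS': "finite S'" using \<open>finite S\<close> \<open>S' \<subset> S\<close> finite_subset by blast
      have ES: "E \<in> edge_orbits H X" using S xw by blast
      have "X.volume (insert E S') \<le> X.volume S"
        using X.volume_mono[OF S _ \<open>finite S\<close>, of "insert E S'"] xw \<open>S' \<subset> S\<close> by blast
      moreover have "X.volume (insert E S') = the_elem (edge_length X ` E) + X.volume S'"
        using xw finS' by (simp add: X.volume_def)
      moreover have "the_elem (edge_length X ` E) = dX x w"
        using X.the_edge_length[OF ES xw(2)] X.edge_length_eq[OF xw(1)] by simp
      ultimately show ?thesis by simp
    qed
    have E0': "E0 \<in> S - S'" using E0 by (auto simp: S'_def)
    have volpos: "X.volume S > 0"
      using vol'[OF E0(3,2) E0'] X.adjD(7)[OF E0(3)] X.volume_nonneg[OF S'S] by linarith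
    \<comment> \<open>The move \<open>\<delta>\<close> is then at most \<open>r / 2\<close>. It
      stays inside the gate, and two translates of \<open>v\<close> joined by an edge of
      \<open>S\<close> do not pass each other, since the image of that edge has length at least
      \<open>r\<close>.\<close>
    define \<eta>0 where "\<eta>0 = min \<eta>1 (r / (2 * X.volume S))"
    have "\<eta>0 > 0" using \<eta>1 r volpos by (simp add: \<eta>0_def)
    moreover have "\<exists>G. vertex_map G \<and>
      (\<forall>v \<in> vset X. dY (F v) (G v) \<le> \<eta> * X.volume S) \<and>
      (\<forall>v \<in> vset X. (\<forall>w. \<not> adj_in S v w) \<longrightarrow> G v = F v) \<and>
      (\<forall>v w. adj_in C v w \<longrightarrow> G v = F v) \<and>
      (\<forall>u w. adj_in (S - C) u w \<longrightarrow> dY (G u) (G w) \<le> (l - \<eta>) * dX u w)" if \<eta>: "0 < \<eta>" "\<eta> \<le> \<eta>0" for \<eta>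
    proof -
      define \<delta> where "\<delta> = \<eta> * X.volume S"
      have \<delta>: "0 \<le> \<delta>" "2 * \<delta> \<le> r" using \<eta> volpos by (auto simp: \<delta>_def \<eta>0_def field_simps)
      obtain y where y: "\<And>w. adj_in S v w \<Longrightarrow> y \<in> Y.seg (F v) (F w)" "\<And>w. adj_in S v w \<Longrightarrow> dY (F v) y = \<delta>"
        using toward[of \<delta>] \<delta> r by auto
      have yp: "y \<in> pts Y" using y(1)[OF w0] Y.seg_pts by blast
      have "\<eta> \<le> \<eta>1" using \<eta> by (simp add: \<eta>0_def)
      then obtain G where G: "vertex_map G" "\<And>v. v \<in> vset X \<Longrightarrow> dY (F v) (G v) \<le> \<eta> * X.volume S'"
        and Gfix: "\<And>v. v \<in> vset X \<Longrightarrow> (\<forall>w. \<not> adj_in S' v w) \<Longrightarrow> G v = F v"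
        and GC: "\<And>v w. adj_in C v w \<Longrightarrow> G v = F v"
        and Gslow: "\<And>u w. adj_in (S' - C) u w \<Longrightarrow> dY (G u) (G w) \<le> (l - \<eta>) * dX u w"
        using IH[OF \<eta>(1)] by blast
      define G' where "G' = move_orbit G v y"
      have G': "vertex_map G'" unfolding G'_def by (rule vertex_map_move_orbit[OF G(1) stab vp yp])
      have G'orb: "G' (act X h v) = act Y h y" if "h \<in> carrier H" for h
        unfolding G'_def by (rule move_orbit_orbit[OF stab vp that])
      have G'oth: "G' x = G x" if "\<And>h. h \<in> carrier H \<Longrightarrow> x \<noteq> act X h v" for x
        unfolding G'_def by (rule move_orbit_other[OF that])
      have volS': "\<eta> * X.volume S' \<le> \<eta> * X.volume S"
        using X.volume_mono[OF S _ \<open>finite S\<close>, of S'] \<open>S' \<subset> S\<close> \<eta> by (intro mult_left_mono) auto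
      have disp: "dY (F x) (G' x) \<le> \<eta> * X.volume S" if x: "x \<in> vset X" for x
      proof (cases "\<exists>h \<in> carrier H. x = act X h v")
        case True
        then obtain h where h: "h \<in> carrier H" "x = act X h v" by blast
        then have "dY (F x) (G' x) = dY (F v) y"
          using G'orb vertex_mapD(2)[OF F h(1) vV] Y.act_dist[OF h(1) FY[OF vV] yp] by simp
        then show ?thesis using y(2)[OF w0] by (simp add: \<delta>_def)
      next
        case False
        then show ?thesis using G'oth G(2)[OF x] volS' by force
      qed
      have fix_off: "G' x = F x" if x: "x \<in> vset X" "\<forall>w. \<not> adj_in S x w" for x
      proof -
        have "x \<noteq> act X h v" if "h \<in> carrier H" for h
          using adj_in_act[OF S that w0] x(2) by blast
        moreover have "\<forall>w. \<not> adj_in S' x w" using x(2) \<open>S' \<subset> S\<close> by (auto simp: adj_in_def)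
        ultimately show ?thesis using G'oth Gfix x(1) by metis
      qed
      have fix_C: "G' x = F x" if xw: "adj_in C x w" for x w
      proof -
        have "adj_in S' x w" using xw C(1) by (auto simp: adj_in_def)
        then show ?thesis using off G'oth GC[OF xw] by metis
      qed
      \<comment> \<open>The move at \<open>v\<close> shortens the image by \<open>\<delta>\<close>,
        and the other end, if outside the orbit of \<open>v\<close>, gives back at most
        \<open>\<eta> * X.volume S'\<close>. The difference is at least
        \<open>\<eta> * dX v w\<close>.\<close>
      have star: "dY y (G' w) \<le> (l - \<eta>) * dX v w" if w: "adj_in S v w"
        and E: "X.seg v w \<in> E" "E \<in> S - S'" for w E
      proof -
        have vw: "X.adj v w" using w by (simp add: adj_in_def)
        note D = X.adjD[OF vw]
        have yw: "dY (F v) y = \<delta>" "dY y (F w) = l * dX v w - \<delta>"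
          using y[OF w] speedS[OF w] by (auto simp: geod_seg_def)
        have vol: "\<eta> * X.volume S' + \<eta> * dX v w \<le> \<delta>"
          using mult_left_mono[OF vol'[OF vw E]] \<eta> by (simp add: \<delta>_def distrib_left)
        show ?thesis
        proof (cases "\<exists>g \<in> carrier H. w = act X g v")
          \<comment> \<open>Both ends of the edge lie in the orbit of \<open>v\<close> and move
            towards each other along the image, by \<open>2 * \<delta>\<close> in total and without
            crossing.\<close>
          case True
          then obtain g where g: "g \<in> carrier H" "w = act X g v" by blast
          have Fw: "F w = act Y g (F v)" using g vertex_mapD(2)[OF F g(1) vV] by simp
          have "adj_in S (act X (inv\<^bsub>H\<^esub> g) w) (act X (inv\<^bsub>H\<^esub> g) v)"
            using adj_in_act[OF S _ adj_in_commute[OF w]] g by simp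
          then have gv: "adj_in S v (act X (inv\<^bsub>H\<^esub> g) v)" using g X.act_inv vp by simp
          let ?u = "act X (inv\<^bsub>H\<^esub> g) v"
          have uV: "?u \<in> vset X" using X.act_vset g vV by simp
          have gFu: "act Y g (F ?u) = F v"
            using vertex_mapD(2)[OF F g(1) uV] X.act_inv'[OF g(1) vp] by simp
          have gy: "act Y g y \<in> Y.seg (F w) (F v)"
            using Y.act_in_seg[OF g(1) FY[OF vV] FY[OF uV] y(1)[OF gv]] gFu Fw by simp
          have "dY (F w) (act Y g y) = \<delta>"
            using Y.act_dist[OF g(1) FY[OF vV] yp] Fw yw(1) by simp
          then have "dY (F v) (act Y g y) = l * dX v w - \<delta>"
            using gy speedS[OF w] by (simp add: geod_seg_def mdist_commute)
          moreover have "act Y g y \<in> Y.seg (F v) (F w)" using gy Y.segment_commute by blast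
          ultimately have "dY y (act Y g y) = \<bar>\<delta> - (l * dX v w - \<delta>)\<bar>"
            using Y.dist_on_segment[OF FY[OF D(1)] FY[OF D(2)] y(1)[OF w]] yw(1) by simp
          also have "\<dots> \<le> l * dX v w - \<delta>"
          proof -
            obtain y' where "y' \<in> Y.seg (F v) (F w)" "dY (F v) y' = r" using toward[of r] r w
              by auto
            then have "r \<le> l * dX v w" using Y.segment_le(1) speedS[OF w] by metis
            then show ?thesis using \<delta> by linarith
          qed
          also have "\<dots> \<le> (l - \<eta>) * dX v w"
          proof -
            have "0 \<le> \<eta> * X.volume S'" using \<eta> X.volume_nonneg[OF S'S] by simp
            then show ?thesis using vol by (simp add: left_diff_distrib)
          qed
          finally show ?thesis using G'orb[OF g(1)] g by simp
        next
          case False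
          then have "G' w = G w" using G'oth by blast
          moreover have "dY y (G w) \<le> dY y (F w) + dY (F w) (G w)"
            using yp FY[OF D(2)] vertex_mapD(1)[OF G(1) D(2)] by (intro mdist_triangle)
          ultimately show ?thesis using yw(2) vol G(2)[OF D(2)] by (simp add: left_diff_distrib)
        qed
      qed
      have slow: "dY (G' u) (G' w) \<le> (l - \<eta>) * dX u w" if uw: "adj_in (S - C) u w" for u w
      proof -
        obtain E where E: "E \<in> S" "E \<notin> C" "X.seg u w \<in> E" and auw: "X.adj u w" using uw
          by (auto simp: adj_in_def)
        show ?thesis
        proof (cases "E \<in> S'")
          case True
          then have a: "adj_in (S' - C) u w" "adj_in S' u w" using E auw by (auto simp: adj_in_def)
          then have "G' u = G u" "G' w = G w" using G'oth off adj_in_commute by metis+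
          then show ?thesis using Gslow[OF a(1)] by simp
        next
          case False
          then obtain x where x: "X.adj v x" "X.seg v x \<in> E" using E by (auto simp: S'_def)
          have EX: "E \<in> edge_orbits H X" using E S by blast
          obtain h where h: "h \<in> carrier H" "X.seg u w = act X h ` X.seg v x"
            using X.edge_orbits_trans[OF EX x(2) E(3)] by blast
          note Dx = X.adjD[OF x(1)]
          have "X.seg u w = X.seg (act X h v) (act X h x)" using h X.act_seg[OF h(1) Dx(3,4)]
            by simp
          then have uw': "u = act X h v \<and> w = act X h x \<or> u = act X h x \<and> w = act X h v"
            using X.edge_ends_eq[OF auw X.act_adj[OF h(1) x(1)]] by blast
          have "adj_in S v x" using x E by (auto simp: adj_in_def)
          then have "dY y (G' x) \<le> (l - \<eta>) * dX v x" using star[of x E] x E False by blast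
          moreover have "dY (act Y h y) (act Y h (G' x)) = dY y (G' x)"
            by (rule Y.act_dist[OF h(1) yp vertex_mapD(1)[OF G' Dx(2)]])
          ultimately have "dY (G' (act X h v)) (G' (act X h x)) \<le> (l - \<eta>) * dX (act X h v) (act X h x)"
            using G'orb[OF h(1)] vertex_mapD(2)[OF G' h(1) Dx(2)] X.act_dist[OF h(1) Dx(3,4)]
            by simp
          then show ?thesis using uw' by (auto simp: mdist_commute)
        qed
      qed
      show ?thesis using G' disp fix_off fix_C slow by blast
    qed
    ultimately show ?thesis using C \<open>S' \<subset> S\<close> by (intro exI[of _ C]) blast
  qed
qed

abbreviation stretch :: "('x \<Rightarrow> 'y) \<Rightarrow> 'x \<Rightarrow> 'x \<Rightarrow> real" where
  "stretch F u w \<equiv> dY (F u) (F w) / dX u w"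

lemma stretch_act:
  assumes F: "vertex_map F" and h: "h \<in> carrier H" and uw: "X.adj u w"
  shows "stretch F (act X h u) (act X h w) = stretch F u w"
proof -
  note D = X.adjD[OF uw]
  show ?thesis
    using vertex_mapD(2)[OF F h] vertex_mapD(1)[OF F] D X.act_dist[OF h] Y.act_dist[OF h] by simp
qed

lemma finite_stretches:
  assumes F: "vertex_map F"
  shows "finite {stretch F u w | u w. X.adj u w}"
  using stretch_act[OF F] by (intro finite_edge_values) (auto simp: mdist_commute)

lemma tree_map_Lipschitz:
  assumes f: "tree_map f"
  shows "\<exists>L. \<forall>x \<in> pts X. \<forall>y \<in> pts X. dY (f x) (f y) \<le> L * dX x y"
proof -
  define L where "L = Max (insert 0 {stretch f u w | u w. X.adj u w})"
  have fin: "finite (insert 0 {stretch f u w | u w. X.adj u w})"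
    using finite_stretches[OF tree_map_vertex_map[OF f]] by simp
  have "dY (f u) (f w) \<le> L * dX u w" if uw: "X.adj u w" for u w
  proof -
    have "stretch f u w \<le> L" unfolding L_def using uw by (intro Max_ge fin) blast
    then show ?thesis using X.adjD(7)[OF uw] by (simp add: divide_le_eq)
  qed
  then show ?thesis using edges_speed_Lipschitz[OF f] by blast
qed

text \<open>The core is formed inside the tension graph. The slower edges have finitely many speeds,
  hence a gap below \<open>l\<close>, and a small move of their ends cannot use it up.\<close>

lemma tension_step:
  assumes f: "tree_map f" and l: "l > 0" and le: "\<And>u w. X.adj u w \<Longrightarrow> dY (f u) (f w) \<le> l * dX u w"
  shows "\<exists>C \<subseteq> edge_orbits H X.
    (\<forall>u w. adj_in C u w \<longrightarrow> dY (f u) (f w) = l * dX u w) \<and>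
    (\<forall>v w. adj_in C v w \<longrightarrow> two_gated f C v) \<and>
    (\<exists>\<eta>0 > 0. \<forall>\<eta>. 0 < \<eta> \<and> \<eta> \<le> \<eta>0 \<longrightarrow> (\<exists>g. tree_map g \<and>
      (\<forall>x \<in> pts X. dY (f x) (g x) \<le> \<eta> * X.volume (edge_orbits H X)) \<and>
      (\<forall>v w. adj_in C v w \<longrightarrow> g v = f v) \<and>
      (\<forall>u w. X.adj u w \<and> \<not> adj_in C u w \<longrightarrow> dY (g u) (g w) \<le> (l - \<eta>) * dX u w)))"
proof -
  note F = tree_map_vertex_map[OF f]
  define S where "S = {E \<in> edge_orbits H X. \<exists>u w. X.adj u w \<and> X.seg u w \<in> E \<and> stretch f u w = l}"
  have S: "S \<subseteq> edge_orbits H X" by (auto simp: S_def)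
  have finS: "finite S" using S finite_orbits by (rule finite_subset)
  have speed: "dY (f u) (f w) = l * dX u w" if "adj_in S u w" for u w
  proof -
    obtain E x y where uw: "X.adj u w" "X.seg u w \<in> E" and E: "E \<in> edge_orbits H X"
      and xy: "X.adj x y" "X.seg x y \<in> E" "stretch f x y = l"
      using \<open>adj_in S u w\<close> by (auto simp: adj_in_def S_def)
    obtain h where h: "h \<in> carrier H" "X.seg u w = act X h ` X.seg x y"
      using X.edge_orbits_trans[OF E xy(2) uw(2)] by blast
    then have "X.seg u w = X.seg (act X h x) (act X h y)"
      using X.act_seg[OF h(1) X.adjD(3,4)[OF xy(1)]] by simp
    then have "u = act X h x \<and> w = act X h y \<or> u = act X h y \<and> w = act X h x"
      using X.edge_ends_eq[OF uw(1) X.act_adj[OF h(1) xy(1)]] by blast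
    then have "stretch f u w = l" using stretch_act[OF F h(1) xy(1)] xy(3)
      by (auto simp: mdist_commute)
    then show ?thesis using X.adjD(7)[OF uw(1)] by (simp add: field_simps)
  qed
  obtain C \<eta>1 where C: "C \<subseteq> S" "\<forall>v w. adj_in C v w \<longrightarrow> two_gated f C v" and \<eta>1: "\<eta>1 > 0"
    and slow: "\<And>\<eta>. 0 < \<eta> \<Longrightarrow> \<eta> \<le> \<eta>1 \<Longrightarrow> \<exists>G. vertex_map G \<and>
      (\<forall>v \<in> vset X. dY (f v) (G v) \<le> \<eta> * X.volume S) \<and>
      (\<forall>v \<in> vset X. (\<forall>w. \<not> adj_in S v w) \<longrightarrow> G v = f v) \<and>
      (\<forall>v w. adj_in C v w \<longrightarrow> G v = f v) \<and>
      (\<forall>u w. adj_in (S - C) u w \<longrightarrow> dY (G u) (G w) \<le> (l - \<eta>) * dX u w)"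
    using slow_down_outside_core[OF finS S F l speed] by blast
  obtain c where c: "c > 0" "\<And>u w. u \<in> vset X \<Longrightarrow> w \<in> vset X \<Longrightarrow> u \<noteq> w \<Longrightarrow> c \<le> dX u w"
    using X.vertex_separation[OF finite_orbits] by blast
  \<comment> \<open>The speeds strictly below \<open>l\<close>. The inserted 0 keeps the maximum
    \<open>\<mu>\<close> defined, and it is below \<open>l\<close> because \<open>l\<close> is
    positive.\<close>
  define R where "R = insert 0 ({stretch f u w | u w. X.adj u w} \<inter> {..<l})"
  have finR: "finite R" using finite_stretches[OF F] by (simp add: R_def)
  define \<mu> where "\<mu> = Max R"
  have \<mu>: "\<mu> < l" unfolding \<mu>_def using finR l by (subst Max_less_iff) (auto simp: R_def)
  define V where "V = X.volume (edge_orbits H X)"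
  have V: "0 \<le> V" unfolding V_def by (rule X.volume_nonneg) simp
  have VS: "X.volume S \<le> V" unfolding V_def by (rule X.volume_mono[OF order_refl S finite_orbits])
  \<comment> \<open>Moving both ends by at most \<open>\<eta> * V\<close> raises the speed of an
    edge of length at least \<open>c\<close> by at most \<open>2 * \<eta> * V / c\<close>. The bound
    solves \<open>\<mu> + 2 * \<eta> * V / c \<le> l - \<eta>\<close> for
    \<open>\<eta>\<close>.\<close>
  define \<eta>0 where "\<eta>0 = min \<eta>1 ((l - \<mu>) / (1 + 2 * V / c))"
  have den: "1 + 2 * V / c > 0" using V c(1) by (simp add: add_pos_nonneg)
  have "\<eta>0 > 0" using \<eta>1 \<mu> den by (simp add: \<eta>0_def)
  moreover have "\<exists>g. tree_map g \<and>
      (\<forall>x \<in> pts X. dY (f x) (g x) \<le> \<eta> * V) \<and>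
      (\<forall>v w. adj_in C v w \<longrightarrow> g v = f v) \<and>
      (\<forall>u w. X.adj u w \<and> \<not> adj_in C u w \<longrightarrow> dY (g u) (g w) \<le> (l - \<eta>) * dX u w)"
    if \<eta>: "0 < \<eta>" "\<eta> \<le> \<eta>0" for \<eta>
  proof -
    have "\<eta> \<le> \<eta>1" using \<eta> by (simp add: \<eta>0_def)
    then obtain G where G: "vertex_map G"
      and disp: "\<And>v. v \<in> vset X \<Longrightarrow> dY (f v) (G v) \<le> \<eta> * X.volume S"
      and GC: "\<And>v w. adj_in C v w \<Longrightarrow> G v = f v"
      and Gslow: "\<And>u w. adj_in (S - C) u w \<Longrightarrow> dY (G u) (G w) \<le> (l - \<eta>) * dX u w"
      using slow[OF \<eta>(1)] by blast
    have disp': "dY (f v) (G v) \<le> \<eta> * V" if "v \<in> vset X" for v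
      using disp[OF that] mult_left_mono[OF VS, of \<eta>] \<eta> by linarith
    define g where "g = extension G"
    have gv: "g v = G v" if "v \<in> vset X" for v using extension_vertex[OF that] by (simp add: g_def)
    have g: "tree_map g" unfolding g_def by (rule tree_map_extension[OF G])
    have "dY (f x) (g x) \<le> \<eta> * V" if "x \<in> pts X" for x
      by (rule tree_map_displacement[OF f g _ that]) (use disp' gv in simp)
    moreover have "g v = f v" if "adj_in C v w" for v w
      using GC[OF that] gv that X.adjD(1) by (auto simp: adj_in_def)
    moreover have "dY (g u) (g w) \<le> (l - \<eta>) * dX u w" if uw: "X.adj u w" "\<not> adj_in C u w" for u w
    proof (cases "adj_in S u w")
      case True
      then have "adj_in (S - C) u w" using uw by (auto simp: adj_in_def)
      then show ?thesis using Gslow gv X.adjD(1,2)[OF uw(1)] by simp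
    next
      case False
      note D = X.adjD[OF uw(1)]
      have e: "X.seg u w \<in> edges X" by (rule adjacent_edge[OF uw(1)])
      have "stretch f u w \<noteq> l"
      proof
        assume "stretch f u w = l"
        then have "X.edge_orbit (X.seg u w) \<in> S"
          using uw(1) e X.edge_orbit_self[OF e] by (auto simp: S_def X.edge_orbits_eq)
        then show False using False uw(1) X.edge_orbit_self[OF e] by (auto simp: adj_in_def)
      qed
      moreover have "stretch f u w \<le> l" using le[OF uw(1)] D(7) by (simp add: divide_le_eq)
      ultimately have "stretch f u w \<in> R" using uw(1) by (auto simp: R_def)
      then have "stretch f u w \<le> \<mu>" unfolding \<mu>_def by (rule Max_ge[OF finR])
      then have fuw: "dY (f u) (f w) \<le> \<mu> * dX u w" using D(7) by (simp add: divide_le_eq)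
      have pY: "f u \<in> pts Y" "f w \<in> pts Y" "G u \<in> pts Y" "G w \<in> pts Y"
        using vertex_mapD(1)[OF F] vertex_mapD(1)[OF G] D by auto
      have "dY (G u) (G w) \<le> dY (f u) (G u) + dY (f u) (f w) + dY (f w) (G w)"
        using mdist_triangle[OF pY(3,1,4)] mdist_triangle[OF pY(1,2,4)] mdist_commute[of "met Y" "G u" "f u"] by linarith
      also have "\<dots> \<le> 2 * \<eta> * V + \<mu> * dX u w" using disp'[OF D(1)] disp'[OF D(2)] fuw by linarith
      also have "2 * \<eta> * V \<le> \<eta> * (2 * V / c) * dX u w"
      proof -
        have "\<eta> * (2 * V / c) * c \<le> \<eta> * (2 * V / c) * dX u w"
          using c(2)[OF D(1,2,5)] c(1) V \<eta>(1) by (intro mult_left_mono) auto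
        then show ?thesis using c(1) by simp
      qed
      finally have 1: "dY (G u) (G w) \<le> (\<eta> * (2 * V / c) + \<mu>) * dX u w" by (simp add: distrib_right)
      have "\<eta> \<le> (l - \<mu>) / (1 + 2 * V / c)" using \<eta> by (simp add: \<eta>0_def)
      then have "\<eta> * (1 + 2 * V / c) \<le> l - \<mu>" using den by (simp add: le_divide_eq)
      then have "\<eta> * (2 * V / c) + \<mu> \<le> l - \<eta>" unfolding distrib_left by linarith
      then have "(\<eta> * (2 * V / c) + \<mu>) * dX u w \<le> (l - \<eta>) * dX u w" by (rule mult_right_mono) simp
      then show ?thesis using 1 gv D(1,2) by simp
    qed
    ultimately show ?thesis using g by blast
  qed
  ultimately have "\<exists>\<eta>0 > 0. \<forall>\<eta>. 0 < \<eta> \<and> \<eta> \<le> \<eta>0 \<longrightarrow> (\<exists>g. tree_map g \<and>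
      (\<forall>x \<in> pts X. dY (f x) (g x) \<le> \<eta> * V) \<and>
      (\<forall>v w. adj_in C v w \<longrightarrow> g v = f v) \<and>
      (\<forall>u w. X.adj u w \<and> \<not> adj_in C u w \<longrightarrow> dY (g u) (g w) \<le> (l - \<eta>) * dX u w))" by blast
  moreover have "\<forall>u w. adj_in C u w \<longrightarrow> dY (f u) (f w) = l * dX u w"
    using speed C(1) by (auto simp: adj_in_def)
  moreover have "C \<subseteq> edge_orbits H X" using C(1) S by blast
  ultimately show ?thesis using C(2) unfolding V_def by blast
qed

section \<open>Pointwise limits of straight maps\<close>

lemma dist_tendsto:
  assumes "\<And>n. x n \<in> pts Y" "\<And>n. y n \<in> pts Y" "p \<in> pts Y" "q \<in> pts Y"
    and "(\<lambda>n. dY (x n) p) \<longlonglongrightarrow> 0" "(\<lambda>n. dY (y n) q) \<longlonglongrightarrow> 0"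
  shows "(\<lambda>n. dY (x n) (y n)) \<longlonglongrightarrow> dY p q"
proof (rule LIM_zero_cancel, rule Lim_null_comparison)
  show "(\<lambda>n. dY (x n) p + dY (y n) q) \<longlonglongrightarrow> 0" using tendsto_add[OF assms(5,6)] by simp
  show "\<forall>\<^sub>F n in sequentially. norm (dY (x n) (y n) - dY p q) \<le> dY (x n) p + dY (y n) q"
  proof (rule always_eventually, intro allI)
    fix n
    show "norm (dY (x n) (y n) - dY p q) \<le> dY (x n) p + dY (y n) q"
      using mdist_triangle[of "x n" "met Y" p "y n"] mdist_triangle[of p "met Y" q "y n"]
        mdist_triangle[of p "met Y" "x n" q] mdist_triangle[of "x n" "met Y" "y n" q] assms(1-4)
        mdist_commute[of "met Y" p "x n"] mdist_commute[of "met Y" q "y n"]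
          by (simp add: abs_le_iff)
  qed
qed

text \<open>Distances between images converge, and the speed on an edge is a quotient of such a
  distance by the length of the edge, so constant speed survives in the limit.\<close>

lemma tree_map_limit:
  assumes F: "\<And>n. tree_map (F n)" and g: "\<And>x. x \<in> pts X \<Longrightarrow> g x \<in> pts Y"
    and lim: "\<And>x. x \<in> pts X \<Longrightarrow> (\<lambda>n. dY (F n x) (g x)) \<longlonglongrightarrow> 0"
  shows "tree_map g"
proof -
  have FY: "F n x \<in> pts Y" if "x \<in> pts X" for n x using F[of n] that by (auto simp: tree_map_def)
  have dlim: "(\<lambda>n. dY (F n x) (F n y)) \<longlonglongrightarrow> dY (g x) (g y)" if "x \<in> pts X" "y \<in> pts X" for x y
    using that by (intro dist_tendsto FY g lim)
  have "g (act X h x) = act Y h (g x)" if h: "h \<in> carrier H" and x: "x \<in> pts X" for h x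
  proof -
    have hx: "act X h x \<in> pts X" by (rule X.act_closed[OF h x])
    have "(\<lambda>n. dY (act Y h (F n x)) (act Y h (g x))) \<longlonglongrightarrow> 0"
      using lim[OF x] Y.act_dist[OF h FY[OF x] g[OF x]] by simp
    then have "(\<lambda>n. dY (F n (act X h x)) (act Y h (g x))) \<longlonglongrightarrow> 0"
      using F h x by (simp add: tree_map_def)
    then have "(\<lambda>n. dY (F n (act X h x)) (F n (act X h x))) \<longlonglongrightarrow> dY (g (act X h x)) (act Y h (g x))"
      using g[OF hx] Y.act_closed[OF h g[OF x]] by (intro dist_tendsto FY lim hx) auto
    moreover have "dY (F n (act X h x)) (F n (act X h x)) = 0" for n using FY[OF hx] by simp
    ultimately have "dY (g (act X h x)) (act Y h (g x)) = 0" by (simp add: LIMSEQ_const_iff)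
    then show ?thesis using g[OF hx] Y.act_closed[OF h g[OF x]] by simp
  qed
  moreover have "\<exists>l \<ge> 0. has_speed X Y g e l" if e: "e \<in> edges X" for e
  proof -
    obtain u w where uw: "X.adj u w" "e = X.seg u w" using e by (rule edgesE)
    note D = X.adjD[OF uw(1)]
    have "dY (g x) (g y) = stretch g u w * dX x y" if xy: "x \<in> e" "y \<in> e" for x y
    proof -
      have p: "x \<in> pts X" "y \<in> pts X" using xy uw X.seg_pts by auto
      have "dY (F n x) (F n y) = stretch (F n) u w * dX x y" for n
      proof -
        obtain l where l: "has_speed X Y (F n) e l" using F[of n] e unfolding tree_map_def by blast
        then have "dY (F n u) (F n w) = l * dX u w" "dY (F n x) (F n y) = l * dX x y"
          using D(8,9) uw(2) xy unfolding has_speed_def by blast+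
        then show ?thesis using D(7) by simp
      qed
      moreover have "(\<lambda>n. stretch (F n) u w * dX x y) \<longlonglongrightarrow> stretch g u w * dX x y"
        using D by (intro tendsto_intros dlim) auto
      ultimately have "(\<lambda>n. dY (F n x) (F n y)) \<longlonglongrightarrow> stretch g u w * dX x y" by simp
      then show ?thesis using dlim[OF p] LIMSEQ_unique by blast
    qed
    then show ?thesis by (intro exI[of _ "stretch g u w"]) (simp add: has_speed_def)
  qed
  ultimately show ?thesis using g by (auto simp: tree_map_def)
qed

end

section \<open>Maps between forests\<close>

locale forest_pair =
  fixes \<Gamma> :: "nat \<Rightarrow> ('v, 'e, 'g) graph_of_groups"
    and X :: "nat \<Rightarrow> (('v, 'e, 'g) letter list set, 'x) gtree"
    and Y :: "nat \<Rightarrow> (('v, 'e, 'g) letter list set, 'y) gtree"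
    and k :: nat
  assumes k: "k \<ge> 1"
    and gog: "\<And>i. i \<in> {1..k} \<Longrightarrow> connected_finite_gog (\<Gamma> i)"
    and X: "X \<in> outer_space k \<Gamma>"
    and Y: "Y \<in> outer_space k \<Gamma>"
begin

abbreviation H where "H i \<equiv> pi1 (\<Gamma> i)"

lemma finite_edge_orbits:
  assumes "i \<in> {1..k}"
  shows "finite (edge_orbits (H i) (X i))" "finite (edge_orbits (H i) (Y i))"
  using assms gog X Y finite_gog.finite_edge_orbits finite_gog.intro unfolding outer_space_def
  by blast+

lemma action:
  assumes "i \<in> {1..k}"
  shows "tree_action (X i) (H i)" "tree_action (Y i) (H i)"
proof -
  have "X i \<in> outer_space_component (\<Gamma> i)" "Y i \<in> outer_space_component (\<Gamma> i)"
    using assms X Y by (auto simp: outer_space_def)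
  then show "tree_action (X i) (H i)" "tree_action (Y i) (H i)"
    by (auto simp: outer_space_component_def intro!: tree_action.intro simplicial_tree.intro tree_action_axioms.intro)
qed

lemma pair: "i \<in> {1..k} \<Longrightarrow> tree_pair (X i) (Y i) (H i)"
  using action finite_edge_orbits by (intro tree_pair.intro tree_pair_axioms.intro) auto

definition lipschitz_consts :: "(nat \<Rightarrow> 'x \<Rightarrow> 'y) \<Rightarrow> real set" where
  "lipschitz_consts f = {L. 0 \<le> L \<and> (\<forall>i \<in> {1..k}. \<forall>a \<in> pts (X i). \<forall>b \<in> pts (X i).
     tdist (Y i) (f i a) (f i b) \<le> L * tdist (X i) a b)}"

lemma Lip_eq: "Lip k X Y f = Inf (lipschitz_consts f)"
  by (simp add: Lip_def lipschitz_consts_def)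

lemma bdd_below_lipschitz_consts: "bdd_below (lipschitz_consts f)"
  by (rule bdd_belowI[of _ 0]) (simp add: lipschitz_consts_def)

lemma Lip_le:
  assumes "0 \<le> L" "\<And>i a b. i \<in> {1..k} \<Longrightarrow> a \<in> pts (X i) \<Longrightarrow> b \<in> pts (X i) \<Longrightarrow>
    tdist (Y i) (f i a) (f i b) \<le> L * tdist (X i) a b"
  shows "Lip k X Y f \<le> L"
  unfolding Lip_eq using bdd_below_lipschitz_consts assms
  by (intro cInf_lower) (auto simp: lipschitz_consts_def)

lemma lipschitz_consts_nonempty:
  assumes "O_map k \<Gamma> X Y f"
  shows "lipschitz_consts f \<noteq> {}"
proof -
  have "\<exists>B>0. \<forall>a \<in> pts (X i). \<forall>b \<in> pts (X i). tdist (Y i) (f i a) (f i b) \<le> B * tdist (X i) a b"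
    if "i \<in> {1..k}" for i
    using assms that unfolding O_map_def Lipschitz_continuous_map_pos by blast
  then obtain B where B: "\<And>i. i \<in> {1..k} \<Longrightarrow> B i > 0 \<and>
    (\<forall>a \<in> pts (X i). \<forall>b \<in> pts (X i). tdist (Y i) (f i a) (f i b) \<le> B i * tdist (X i) a b)" by metis
  have "tdist (Y i) (f i a) (f i b) \<le> sum B {1..k} * tdist (X i) a b"
    if i: "i \<in> {1..k}" and ab: "a \<in> pts (X i)" "b \<in> pts (X i)" for i a b
  proof -
    have "B i \<le> sum B {1..k}" using i B by (intro member_le_sum) (auto intro: less_imp_le)
    then have "B i * tdist (X i) a b \<le> sum B {1..k} * tdist (X i) a b"
      by (rule mult_right_mono) simp
    then show ?thesis using B[OF i] ab by (meson order_trans)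
  qed
  moreover have "0 \<le> sum B {1..k}" using B by (intro sum_nonneg) (auto intro: less_imp_le)
  ultimately have "sum B {1..k} \<in> lipschitz_consts f" by (auto simp: lipschitz_consts_def)
  then show ?thesis by blast
qed

text \<open>The infimum in \<open>Lip\<close> is itself a Lipschitz constant, as one sees after
  dividing by the distance; for an O-map it is taken over a nonempty set.\<close>

lemma Lip_bound:
  assumes f: "O_map k \<Gamma> X Y f" and i: "i \<in> {1..k}" and ab: "a \<in> pts (X i)" "b \<in> pts (X i)"
  shows "tdist (Y i) (f i a) (f i b) \<le> Lip k X Y f * tdist (X i) a b"
proof (cases "tdist (X i) a b = 0")
  case True
  obtain L where "L \<in> lipschitz_consts f" using lipschitz_consts_nonempty[OF f] by blast
  then have "tdist (Y i) (f i a) (f i b) \<le> L * tdist (X i) a b" using i ab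
    by (simp add: lipschitz_consts_def)
  then show ?thesis using True by simp
next
  case False
  then have pos: "tdist (X i) a b > 0" by (simp add: order_less_le)
  have "tdist (Y i) (f i a) (f i b) / tdist (X i) a b \<le> Lip k X Y f"
    unfolding Lip_eq
  proof (rule cInf_greatest[OF lipschitz_consts_nonempty[OF f]])
    fix L assume "L \<in> lipschitz_consts f"
    then have "tdist (Y i) (f i a) (f i b) \<le> L * tdist (X i) a b" using i ab
      by (simp add: lipschitz_consts_def)
    then show "tdist (Y i) (f i a) (f i b) / tdist (X i) a b \<le> L" using pos
      by (simp add: divide_le_eq)
  qed
  then show ?thesis using pos by (simp add: divide_le_eq)
qed

lemma Lip_nonneg: "O_map k \<Gamma> X Y f \<Longrightarrow> 0 \<le> Lip k X Y f"
  unfolding Lip_eq using lipschitz_consts_nonempty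
  by (intro cInf_greatest) (auto simp: lipschitz_consts_def)

lemma Lambda_le: "O_map k \<Gamma> X Y f \<Longrightarrow> Lambda k \<Gamma> X Y \<le> Lip k X Y f"
  unfolding Lambda_def using Lip_nonneg by (intro cInf_lower bdd_belowI[of _ 0]) auto

lemma le_Lambda:
  assumes "O_map k \<Gamma> X Y f" "\<And>h. O_map k \<Gamma> X Y h \<Longrightarrow> c \<le> Lip k X Y h"
  shows "c \<le> Lambda k \<Gamma> X Y"
  unfolding Lambda_def using assms by (intro cInf_greatest) auto

abbreviation tmap where "tmap i \<equiv> tree_pair.tree_map (X i) (Y i) (H i)"

lemma straight_O_map: "straight k \<Gamma> X Y f \<Longrightarrow> O_map k \<Gamma> X Y f"
  by (simp add: straight_def)

lemma straight_iff: "straight k \<Gamma> X Y f \<longleftrightarrow> (\<forall>i \<in> {1..k}. tmap i (f i))"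
proof
  assume "straight k \<Gamma> X Y f"
  then show "\<forall>i \<in> {1..k}. tmap i (f i)"
    unfolding straight_def O_map_def Lipschitz_continuous_map_def
    by (simp add: tree_pair.tree_map_def[OF pair])
next
  assume *: "\<forall>i \<in> {1..k}. tmap i (f i)"
  have "Lipschitz_continuous_map (met (X i)) (met (Y i)) (f i)" if i: "i \<in> {1..k}" for i
    unfolding Lipschitz_continuous_map_def
    using tree_pair.tree_map_Lipschitz[OF pair[OF i]] * i
    by (simp add: tree_pair.tree_map_def[OF pair])
  then show "straight k \<Gamma> X Y f"
    using * unfolding straight_def O_map_def by (simp add: tree_pair.tree_map_def[OF pair])
qed

lemma O_map_vertex_map:
  assumes "O_map k \<Gamma> X Y f" "i \<in> {1..k}"
  shows "tree_pair.vertex_map (X i) (Y i) (H i) (f i)"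
proof -
  interpret tree_pair "X i" "Y i" "H i" using pair assms by blast
  show ?thesis using assms X.vset_pts
    unfolding vertex_map_def O_map_def Lipschitz_continuous_map_def by blast
qed

abbreviation V where "V i \<equiv> (\<Sum>E \<in> edge_orbits (H i) (X i). the_elem (edge_length (X i) ` E))"

lemma V_nonneg: "i \<in> {1..k} \<Longrightarrow> 0 \<le> V i"
proof -
  assume i: "i \<in> {1..k}"
  interpret tree_action "X i" "H i" using action[OF i] by blast
  show ?thesis using volume_nonneg[OF order_refl] by (simp add: volume_def)
qed

lemma V_le_vol: "i \<in> {1..k} \<Longrightarrow> V i \<le> vol k \<Gamma> X"
  unfolding vol_def using V_nonneg by (intro member_le_sum) auto

lemma vol_nonneg: "0 \<le> vol k \<Gamma> X"
  unfolding vol_def by (rule sum_nonneg) (rule V_nonneg)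

abbreviation adjC where "adjC i \<equiv> tree_pair.adj_in (X i)"

text \<open>A certificate that \<open>f\<close> cannot be improved: for straight \<open>f\<close>,
  as soon as one of the sets \<open>C i\<close> is nonempty, \<open>core_stretch_le\<close> bounds
  \<open>Lambda k \<Gamma> X Y\<close> from below by \<open>Lip k X Y f\<close>.\<close>

definition core :: "(nat \<Rightarrow> 'x \<Rightarrow> 'y) \<Rightarrow> (nat \<Rightarrow> 'x set set set) \<Rightarrow> bool" where
  "core f C \<longleftrightarrow> (\<forall>i \<in> {1..k}. C i \<subseteq> edge_orbits (H i) (X i) \<and>
     (\<forall>u w. adjC i (C i) u w \<longrightarrow> tdist (Y i) (f i u) (f i w) = Lip k X Y f * tdist (X i) u w) \<and>
     (\<forall>v w. adjC i (C i) v w \<longrightarrow> tree_pair.two_gated (X i) (Y i) (f i) (C i) v))"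

definition slowed ::
  "(nat \<Rightarrow> 'x set set set) \<Rightarrow> real \<Rightarrow> (nat \<Rightarrow> 'x \<Rightarrow> 'y) \<Rightarrow> (nat \<Rightarrow> 'x \<Rightarrow> 'y) \<Rightarrow> bool" where
  "slowed C \<eta> f g \<longleftrightarrow> (\<forall>i \<in> {1..k}. tmap i (g i) \<and>
     (\<forall>x \<in> pts (X i). tdist (Y i) (f i x) (g i x) \<le> \<eta> * V i) \<and>
     (\<forall>v w. adjC i (C i) v w \<longrightarrow> g i v = f i v) \<and>
     (\<forall>u w. adjacent (X i) u w \<and> \<not> adjC i (C i) u w \<longrightarrow>
        tdist (Y i) (g i u) (g i w) \<le> (Lip k X Y f - \<eta>) * tdist (X i) u w))"

lemma slowedD:
  assumes "slowed C \<eta> f g"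
  shows "straight k \<Gamma> X Y g"
    and "\<And>i x. 0 < \<eta> \<Longrightarrow> i \<in> {1..k} \<Longrightarrow> x \<in> pts (X i) \<Longrightarrow>
      tdist (Y i) (f i x) (g i x) \<le> \<eta> * vol k \<Gamma> X"
    and "\<And>i v w. i \<in> {1..k} \<Longrightarrow> adjC i (C i) v w \<Longrightarrow> g i v = f i v"
    and "\<And>i u w. i \<in> {1..k} \<Longrightarrow> adjacent (X i) u w \<Longrightarrow> \<not> adjC i (C i) u w \<Longrightarrow>
      tdist (Y i) (g i u) (g i w) \<le> (Lip k X Y f - \<eta>) * tdist (X i) u w"
proof -
  fix i x assume \<eta>: "0 < \<eta>" and i: "i \<in> {1..k}" and x: "x \<in> pts (X i)"
  have "tdist (Y i) (f i x) (g i x) \<le> \<eta> * V i" using assms i x by (simp add: slowed_def)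
  also have "\<dots> \<le> \<eta> * vol k \<Gamma> X" using V_le_vol[OF i] \<eta> by (intro mult_left_mono) auto
  finally show "tdist (Y i) (f i x) (g i x) \<le> \<eta> * vol k \<Gamma> X" .
next
  show "straight k \<Gamma> X Y g" using assms by (simp add: slowed_def straight_iff)
next
  fix i v w assume "i \<in> {1..k}" "adjC i (C i) v w"
  then show "g i v = f i v" using assms unfolding slowed_def by blast
next
  fix i u w assume "i \<in> {1..k}" "adjacent (X i) u w" "\<not> adjC i (C i) u w"
  then show "tdist (Y i) (g i u) (g i w) \<le> (Lip k X Y f - \<eta>) * tdist (X i) u w"
    using assms unfolding slowed_def by blast
qed

text \<open>All components are measured against the global constant \<open>Lip k X Y f\<close>, so
  the core is empty in a component whose edges are all slower. The common threshold is the least of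
  those of the components.\<close>

lemma forest_tension_step:
  assumes f: "straight k \<Gamma> X Y f" and pos: "Lip k X Y f > 0"
  obtains C \<eta>0 where "core f C" "\<eta>0 > 0" "\<And>\<eta>. 0 < \<eta> \<Longrightarrow> \<eta> \<le> \<eta>0 \<Longrightarrow> \<exists>g. slowed C \<eta> f g"
proof -
  let ?l = "Lip k X Y f"
  define P where "P i C \<longleftrightarrow> C \<subseteq> edge_orbits (H i) (X i) \<and>
      (\<forall>u w. adjC i C u w \<longrightarrow> tdist (Y i) (f i u) (f i w) = ?l * tdist (X i) u w) \<and>
      (\<forall>v w. adjC i C v w \<longrightarrow> tree_pair.two_gated (X i) (Y i) (f i) C v)" for i C
  define Q where "Q i C \<eta> g \<longleftrightarrow> tmap i g \<and>
      (\<forall>x \<in> pts (X i). tdist (Y i) (f i x) (g x) \<le> \<eta> * V i) \<and>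
      (\<forall>v w. adjC i C v w \<longrightarrow> g v = f i v) \<and>
      (\<forall>u w. adjacent (X i) u w \<and> \<not> adjC i C u w \<longrightarrow>
         tdist (Y i) (g u) (g w) \<le> (?l - \<eta>) * tdist (X i) u w)" for i C \<eta> g
  have "\<exists>C \<eta>0. P i C \<and> \<eta>0 > 0 \<and> (\<forall>\<eta>. 0 < \<eta> \<and> \<eta> \<le> \<eta>0 \<longrightarrow> (\<exists>g. Q i C \<eta> g))" if i: "i \<in> {1..k}" for i
  proof -
    interpret tree_pair "X i" "Y i" "H i" by (rule pair[OF i])
    have fi: "tree_map (f i)" using f i straight_iff by blast
    have "tdist (Y i) (f i u) (f i w) \<le> ?l * tdist (X i) u w" if "X.adj u w" for u w
      using Lip_bound[OF straight_O_map[OF f] i] X.adjD(3,4)[OF that] by blast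
    from tension_step[OF fi pos this] show ?thesis
      unfolding P_def Q_def X.volume_def by blast
  qed
  then obtain C \<eta>1 where C: "\<And>i. i \<in> {1..k} \<Longrightarrow> P i (C i)" and \<eta>1: "\<And>i. i \<in> {1..k} \<Longrightarrow> \<eta>1 i > 0"
    and ex: "\<And>i \<eta>. i \<in> {1..k} \<Longrightarrow> 0 < \<eta> \<Longrightarrow> \<eta> \<le> \<eta>1 i \<Longrightarrow> \<exists>g. Q i (C i) \<eta> g"
    by metis
  define \<eta>0 where "\<eta>0 = Min (\<eta>1 ` {1..k})"
  show thesis
  proof (rule that)
    show "core f C" using C by (simp add: core_def P_def)
    show "\<eta>0 > 0" unfolding \<eta>0_def using k \<eta>1 by (subst Min_gr_iff) auto
    fix \<eta> :: real assume \<eta>: "0 < \<eta>" "\<eta> \<le> \<eta>0"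
    have "\<exists>g. Q i (C i) \<eta> g" if i: "i \<in> {1..k}" for i
    proof (rule ex[OF i \<eta>(1)])
      have "\<eta>0 \<le> \<eta>1 i" unfolding \<eta>0_def using i by (intro Min_le) auto
      then show "\<eta> \<le> \<eta>1 i" using \<eta>(2) by linarith
    qed
    then obtain g where "\<And>i. i \<in> {1..k} \<Longrightarrow> Q i (C i) \<eta> (g i)" by metis
    then show "\<exists>g. slowed C \<eta> f g" unfolding slowed_def Q_def by blast
  qed
qed

lemma straight_Lip_le:
  assumes g: "straight k \<Gamma> X Y g" and "0 \<le> L"
    and le: "\<And>i u w. i \<in> {1..k} \<Longrightarrow> adjacent (X i) u w \<Longrightarrow> tdist (Y i) (g i u) (g i w) \<le> L * tdist (X i) u w"
  shows "Lip k X Y g \<le> L"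
proof (rule Lip_le[OF \<open>0 \<le> L\<close>])
  fix i a b assume i: "i \<in> {1..k}" and ab: "a \<in> pts (X i)" "b \<in> pts (X i)"
  interpret tree_pair "X i" "Y i" "H i" by (rule pair[OF i])
  show "tdist (Y i) (g i a) (g i b) \<le> L * tdist (X i) a b"
    using edges_speed_Lipschitz[of "g i" L, OF _ _ ab] g i straight_iff le by blast
qed

lemma d_inf_le:
  assumes "\<And>i x. i \<in> {1..k} \<Longrightarrow> x \<in> pts (X i) \<Longrightarrow> tdist (Y i) (f i x) (g i x) \<le> r"
  shows "d_inf k X Y f g \<le> r"
  unfolding d_inf_def
proof (rule cSUP_least)
  \<comment> \<open>A bound for all values passes to a supremum of reals only over a nonempty index
    set; \<open>k \<ge> 1\<close> provides a point.\<close>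
  have 1: "1 \<in> {1..k}" using k by simp
  interpret tree_action "X 1" "H 1" by (rule action(1)[OF 1])
  show "(SIGMA i:{1..k}. pts (X i)) \<noteq> {}" using 1 nonempty by blast
qed (use assms in auto)

section \<open>Descent to a weakly optimal map\<close>

text \<open>A nonempty core in one component would bound the Lipschitz constants of all O-maps from
  below by that of \<open>f\<close>, against \<open>gt\<close>. So every edge is slowed down, and
  since \<open>Lip\<close> drops by at least \<open>\<eta>\<close>, the displacement bound
  \<open>\<eta> * vol k \<Gamma> X\<close> takes the required form.\<close>

lemma improve:
  assumes f: "straight k \<Gamma> X Y f" and gt: "Lambda k \<Gamma> X Y < Lip k X Y f"
  shows "\<exists>g. straight k \<Gamma> X Y g \<and> Lip k X Y g < Lip k X Y f \<and>
    (\<forall>i \<in> {1..k}. \<forall>x \<in> pts (X i).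
       tdist (Y i) (f i x) (g i x) \<le> vol k \<Gamma> X * (Lip k X Y f - Lip k X Y g))"
proof -
  let ?l = "Lip k X Y f"
  note fO = straight_O_map[OF f]
  have pos: "?l > 0" using gt le_Lambda[OF fO Lip_nonneg] by linarith
  obtain C \<eta>0 where C: "core f C" and \<eta>0: "\<eta>0 > 0"
    and ex: "\<And>\<eta>. 0 < \<eta> \<Longrightarrow> \<eta> \<le> \<eta>0 \<Longrightarrow> \<exists>g. slowed C \<eta> f g"
    by (rule forest_tension_step[OF f pos]) blast
  have empty: "C i = {}" if i: "i \<in> {1..k}" for i
  proof (rule ccontr)
    assume ne: "C i \<noteq> {}"
    interpret tree_pair "X i" "Y i" "H i" by (rule pair[OF i])
    have Ci: "C i \<subseteq> edge_orbits (H i) (X i)" "\<And>u w. adj_in (C i) u w \<Longrightarrow> dY (f i u) (f i w) = ?l * dX u w"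
      "\<And>v w. adj_in (C i) v w \<Longrightarrow> two_gated (f i) (C i) v"
      using C i unfolding core_def by blast+
    have "?l \<le> Lip k X Y h" if h: "O_map k \<Gamma> X Y h" for h
    proof (rule core_stretch_le[OF Ci(1) O_map_vertex_map[OF fO i] O_map_vertex_map[OF h i] Ci(2,3) ne])
      fix u w assume "adj_in (C i) u w"
      then have "X.adj u w" by (simp add: adj_in_def)
      then show "tdist (Y i) (h i u) (h i w) \<le> Lip k X Y h * tdist (X i) u w"
        using Lip_bound[OF h i] X.adjD(3,4) by blast
    qed
    then have "?l \<le> Lambda k \<Gamma> X Y" by (rule le_Lambda[OF fO])
    then show False using gt by simp
  qed
  \<comment> \<open>Capped by \<open>?l\<close>, because \<open>?l - \<eta>\<close> has to be
    non-negative to count as a constant in \<open>Lip\<close>.\<close>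
  define \<eta> where "\<eta> = min \<eta>0 ?l"
  have \<eta>: "0 < \<eta>" "\<eta> \<le> \<eta>0" "\<eta> \<le> ?l" using \<eta>0 pos by (auto simp: \<eta>_def)
  obtain g where "slowed C \<eta> f g" using ex[OF \<eta>(1,2)] by blast
  note g = slowedD(1)[OF this] slowedD(2)[OF this \<eta>(1)] slowedD(4)[OF this]
  have "\<not> adjC i (C i) u w" if i: "i \<in> {1..k}" for i u w
    using empty[OF i] tree_pair.adj_in_def[OF pair[OF i]] by simp
  then have Lg: "Lip k X Y g \<le> ?l - \<eta>"
    using g(3) \<eta>(3) by (intro straight_Lip_le[OF g(1)]) auto
  have "tdist (Y i) (f i x) (g i x) \<le> vol k \<Gamma> X * (?l - Lip k X Y g)"
    if "i \<in> {1..k}" "x \<in> pts (X i)" for i x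
  proof -
    have "\<eta> * vol k \<Gamma> X \<le> (?l - Lip k X Y g) * vol k \<Gamma> X"
      using Lg vol_nonneg by (intro mult_right_mono) auto
    then show ?thesis using g(2)[OF that] by (simp add: mult.commute)
  qed
  then show ?thesis using g(1) Lg \<eta>(1) by (intro exI[of _ g]) auto
qed

text \<open>The preorder of the variational principle: displacement is paid for by a drop of
  \<open>Lip\<close>, at the price \<open>vol k \<Gamma> X\<close>. The costs telescope, which gives
  transitivity.\<close>

definition descends :: "(nat \<Rightarrow> 'x \<Rightarrow> 'y) \<Rightarrow> (nat \<Rightarrow> 'x \<Rightarrow> 'y) \<Rightarrow> bool" where
  "descends f g \<longleftrightarrow> straight k \<Gamma> X Y g \<and> Lip k X Y g \<le> Lip k X Y f \<and>
     (\<forall>i \<in> {1..k}. \<forall>x \<in> pts (X i).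
        tdist (Y i) (f i x) (g i x) \<le> vol k \<Gamma> X * (Lip k X Y f - Lip k X Y g))"

lemma straight_closed: "straight k \<Gamma> X Y f \<Longrightarrow> i \<in> {1..k} \<Longrightarrow> x \<in> pts (X i) \<Longrightarrow> f i x \<in> pts (Y i)"
  unfolding straight_def O_map_def Lipschitz_continuous_map_def by blast

lemma descends_refl: "straight k \<Gamma> X Y f \<Longrightarrow> descends f f"
  using straight_closed by (simp add: descends_def mdist_self)

lemma descends_trans:
  assumes f: "straight k \<Gamma> X Y f" and "descends f g" "descends g h"
  shows "descends f h"
  unfolding descends_def
proof (intro conjI ballI)
  fix i x assume ix: "i \<in> {1..k}" "x \<in> pts (X i)"
  have "tdist (Y i) (f i x) (h i x) \<le> tdist (Y i) (f i x) (g i x) + tdist (Y i) (g i x) (h i x)"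
    using assms ix straight_closed unfolding descends_def by (intro mdist_triangle) blast+
  also have "\<dots> \<le> vol k \<Gamma> X * (Lip k X Y f - Lip k X Y g) + vol k \<Gamma> X * (Lip k X Y g - Lip k X Y h)"
    using assms ix unfolding descends_def by (intro add_mono) blast+
  finally show "tdist (Y i) (f i x) (h i x) \<le> vol k \<Gamma> X * (Lip k X Y f - Lip k X Y h)"
    by (simp add: algebra_simps)
qed (use assms in \<open>auto simp: descends_def\<close>)

text \<open>The infimum of \<open>Lip\<close> over the maps below \<open>f\<close> is not known to
  be attained, so only half of the possible drop is asked for. If no drop is possible,
  \<open>f\<close> itself serves.\<close>

lemma good_descent:
  assumes f: "straight k \<Gamma> X Y f"
  shows "\<exists>g. descends f g \<and> (\<forall>h. descends f h \<longrightarrow> Lip k X Y g \<le> (Lip k X Y f + Lip k X Y h) / 2)"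
proof -
  let ?I = "Inf (Lip k X Y ` {h. descends f h})"
  have nonneg: "0 \<le> Lip k X Y h" if "descends f h" for h
    using that Lip_nonneg straight_O_map by (simp add: descends_def)
  then have I: "?I \<le> Lip k X Y h" if "descends f h" for h
    using that by (intro cInf_lower bdd_belowI[of _ 0]) auto
  show ?thesis
  proof (cases "?I < Lip k X Y f")
    case True
    then have "?I < (Lip k X Y f + ?I) / 2" by simp
    then obtain g where g: "descends f g" "Lip k X Y g < (Lip k X Y f + ?I) / 2"
      using cInf_lessD[of "Lip k X Y ` {h. descends f h}"] descends_refl[OF f] by blast
    have "Lip k X Y g \<le> (Lip k X Y f + Lip k X Y h) / 2" if "descends f h" for h
      using g(2) I[OF that] by simp
    then show ?thesis using g(1) by blast
  next
    case False
    then show ?thesis using I descends_refl[OF f] by (intro exI[of _ f]) fastforce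
  qed
qed

text \<open>
  The variational principle of Caristi and Ekeland, for the complete space of straight maps and
  the function \<^term>\<open>Lip k X Y\<close>.
\<close>

lemma weakly_optimal_below:
  assumes f: "straight k \<Gamma> X Y f"
  shows "\<exists>g. descends f g \<and> Lip k X Y g = Lambda k \<Gamma> X Y"
proof -
  let ?L = "Lip k X Y" and ?v = "vol k \<Gamma> X"
  \<comment> \<open>Dependent choice of a descending sequence from \<open>f\<close> that takes at
    least half of the available drop at each stage.\<close>
  have "\<exists>F. \<forall>n. (straight k \<Gamma> X Y (F n) \<and> (n = 0 \<longrightarrow> F n = f)) \<and>
    (descends (F n) (F (Suc n)) \<and> (\<forall>h. descends (F n) h \<longrightarrow> ?L (F (Suc n)) \<le> (?L (F n) + ?L h) / 2))"
  proof (rule dependent_nat_choice)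
    show "\<exists>g. straight k \<Gamma> X Y g \<and> ((0::nat) = 0 \<longrightarrow> g = f)" using f by blast
    fix g and n :: nat assume "straight k \<Gamma> X Y g \<and> (n = 0 \<longrightarrow> g = f)"
    then show "\<exists>g'. (straight k \<Gamma> X Y g' \<and> (Suc n = 0 \<longrightarrow> g' = f)) \<and>
      (descends g g' \<and> (\<forall>h. descends g h \<longrightarrow> ?L g' \<le> (?L g + ?L h) / 2))"
      using good_descent[of g] by (auto simp: descends_def)
  qed
  then obtain F where F: "\<And>n. straight k \<Gamma> X Y (F n)" "F 0 = f" "\<And>n. descends (F n) (F (Suc n))"
    and best: "\<And>n h. descends (F n) h \<Longrightarrow> ?L (F (Suc n)) \<le> (?L (F n) + ?L h) / 2" by metis
  have chain: "descends (F n) (F m)" if "n \<le> m" for n m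
    using that
  proof (induction m rule: dec_induct)
    case base
    then show ?case by (rule descends_refl[OF F(1)])
  next
    case (step m)
    then show ?case using descends_trans[OF F(1)] F(3) by blast
  qed
  have "decseq (\<lambda>n. ?L (F n))" using chain by (auto simp: decseq_def descends_def)
  then obtain l where l: "(\<lambda>n. ?L (F n)) \<longlonglongrightarrow> l" "\<And>n. l \<le> ?L (F n)"
    using decseq_convergent[of "\<lambda>n. ?L (F n)" 0] Lip_nonneg straight_O_map F(1) by metis
  \<comment> \<open>All displacement from stage \<open>n\<close> on is paid for by the remaining
    drop to \<open>l\<close>, so the sequence is uniformly Cauchy.\<close>
  have near: "tdist (Y i) (F n i x) (F m i x) \<le> ?v * (?L (F n) - l)"
    if "n \<le> m" "i \<in> {1..k}" "x \<in> pts (X i)" for n m i x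
  proof -
    have "tdist (Y i) (F n i x) (F m i x) \<le> ?v * (?L (F n) - ?L (F m))"
      using chain[OF that(1)] that by (simp add: descends_def)
    also have "\<dots> \<le> ?v * (?L (F n) - l)" using l(2)[of m] vol_nonneg by (intro mult_left_mono) auto
    finally show ?thesis .
  qed
  have lim0: "(\<lambda>n. ?v * (?L (F n) - l)) \<longlonglongrightarrow> 0"
    using tendsto_mult[OF tendsto_const[of ?v] LIM_zero[OF l(1)]] by simp
  have "\<exists>z \<in> pts (Y i). (\<lambda>n. tdist (Y i) (F n i x) z) \<longlonglongrightarrow> 0" if i: "i \<in> {1..k}"
    and x: "x \<in> pts (X i)" for i x
  proof -
    interpret tree_action "Y i" "H i" by (rule action(2)[OF i])
    show ?thesis
    proof (rule tree_complete[OF finite_edge_orbits(2)[OF i]])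
      show "F n i x \<in> pts (Y i)" for n using straight_closed F(1) i x by blast
      fix e :: real assume "e > 0"
      then obtain N where N: "\<And>n. n \<ge> N \<Longrightarrow> ?v * (?L (F n) - l) < e"
        using order_tendstoD(2)[OF lim0] unfolding eventually_sequentially by blast
      have "tdist (Y i) (F n i x) (F m i x) < e" if "n \<ge> N" "m \<ge> N" for n m
      proof (cases "n \<le> m")
        case True
        then show ?thesis using near[OF _ i x] N[OF that(1)] by fastforce
      next
        case False
        then show ?thesis
          using near[OF _ i x, of m n] N[OF that(2)] mdist_commute[of "met (Y i)" "F n i x"]
          by fastforce
      qed
      then show "\<exists>N. \<forall>n \<ge> N. \<forall>m \<ge> N. tdist (Y i) (F n i x) (F m i x) < e" by blast
    qed
  qed
  then obtain g where g: "\<And>i x. i \<in> {1..k} \<Longrightarrow> x \<in> pts (X i) \<Longrightarrow> g i x \<in> pts (Y i)"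
    "\<And>i x. i \<in> {1..k} \<Longrightarrow> x \<in> pts (X i) \<Longrightarrow> (\<lambda>n. tdist (Y i) (F n i x) (g i x)) \<longlonglongrightarrow> 0" by metis
  have gs: "straight k \<Gamma> X Y g"
    unfolding straight_iff
  proof
    fix i assume i: "i \<in> {1..k}"
    show "tmap i (g i)"
      by (rule tree_pair.tree_map_limit[OF pair[OF i], of "\<lambda>n. F n i"]) (use F(1) straight_iff i g in auto)
  qed
  have dlim: "(\<lambda>m. tdist (Y i) (F m i x) (F m i y)) \<longlonglongrightarrow> tdist (Y i) (g i x) (g i y)"
    if i: "i \<in> {1..k}" and xy: "x \<in> pts (X i)" "y \<in> pts (X i)" for i x y
    by (rule tree_pair.dist_tendsto[OF pair[OF i]]) (use straight_closed F(1) g i xy in auto)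
  have "0 \<le> l" using LIMSEQ_le_const[OF l(1), of 0] Lip_nonneg straight_O_map F(1) by blast
  have Lg: "?L g \<le> l"
  proof (rule Lip_le[OF \<open>0 \<le> l\<close>])
    fix i a b assume i: "i \<in> {1..k}" and ab: "a \<in> pts (X i)" "b \<in> pts (X i)"
    have "(\<lambda>n. ?L (F n) * tdist (X i) a b) \<longlonglongrightarrow> l * tdist (X i) a b" by (intro tendsto_intros l)
    then show "tdist (Y i) (g i a) (g i b) \<le> l * tdist (X i) a b"
      using Lip_bound[OF straight_O_map[OF F(1)] i ab] by (intro LIMSEQ_le[OF dlim[OF i ab]]) auto
  qed
  \<comment> \<open>\<open>Lip\<close> is lower semicontinuous, so the limit is paid for as well and
    lies below every member of the sequence.\<close>
  have below: "descends (F n) g" for n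
    unfolding descends_def
  proof (intro conjI ballI)
    show "?L g \<le> ?L (F n)" using Lg l(2)[of n] by linarith
    fix i x assume i: "i \<in> {1..k}" and x: "x \<in> pts (X i)"
    have FY: "F m i x \<in> pts (Y i)" for m using straight_closed F(1) i x by blast
    have "(\<lambda>m. tdist (Y i) (F n i x) (F m i x)) \<longlonglongrightarrow> tdist (Y i) (F n i x) (g i x)"
      by (rule tree_pair.dist_tendsto[OF pair[OF i]]) (use FY g i x in \<open>auto simp: mdist_self\<close>)
    then have "tdist (Y i) (F n i x) (g i x) \<le> ?v * (?L (F n) - l)"
      using near[OF _ i x, of n] by (intro LIMSEQ_le_const2) auto
    also have "\<dots> \<le> ?v * (?L (F n) - ?L g)" using Lg vol_nonneg by (intro mult_left_mono) auto
    finally show "tdist (Y i) (F n i x) (g i x) \<le> ?v * (?L (F n) - ?L g)" .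
  qed (rule gs)
  have "\<not> Lambda k \<Gamma> X Y < ?L g"
  proof
    assume "Lambda k \<Gamma> X Y < ?L g"
    \<comment> \<open>\<open>h\<close> lies below all \<open>F n\<close>, so the halving rule yields
      \<open>l \<le> (l + ?L h) / 2\<close> in the limit, that is \<open>l \<le> ?L h\<close>,
      whereas \<open>?L h < ?L g \<le> l\<close>.\<close>
    then obtain h where h: "straight k \<Gamma> X Y h" "?L h < ?L g" "descends g h"
      using improve[OF gs] unfolding descends_def by (meson less_imp_le)
    have "?L (F (Suc n)) \<le> (?L (F n) + ?L h) / 2" for n
      using best descends_trans[OF F(1) below h(3)] by blast
    moreover have "(\<lambda>n. (?L (F n) + ?L h) / 2) \<longlonglongrightarrow> (l + ?L h) / 2" by (intro tendsto_intros l) simp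
    ultimately have "l \<le> (l + ?L h) / 2"
      using LIMSEQ_le[OF LIMSEQ_Suc[OF l(1)]] by blast
    then show False using h(2) Lg by simp
  qed
  then have "?L g = Lambda k \<Gamma> X Y" using Lambda_le[OF straight_O_map[OF gs]] by linarith
  then show ?thesis using below[of 0] F(2) by auto
qed

section \<open>Optimal maps near a weakly optimal one\<close>

text \<open>Every edge has speed 0 and so belongs to the tension graph, and a degenerate germ forms
  a gate of its own. Two edges at a vertex therefore suffice, and minimality provides the
  second.\<close>

lemma optimal_of_Lip_zero:
  assumes \<phi>: "straight k \<Gamma> X Y \<phi>" and zero: "Lip k X Y \<phi> = 0"
  shows "optimal k \<Gamma> X Y \<phi>"
  unfolding optimal_def
proof (intro conjI ballI impI)
  fix i v assume i: "i \<in> {1..k}" and v: "v \<in> vset (X i)" "v \<in> \<Union>(tension_edges k X Y \<phi> i)"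
  interpret tree_pair "X i" "Y i" "H i" by (rule pair[OF i])
  have min: "minimal_action (H i) (X i)" using X i
    by (simp add: outer_space_def outer_space_component_def)
  obtain e where e: "e \<in> edges (X i)" "v \<in> e" using v(2) by (auto simp: tension_edges_def)
  obtain w where w: "X.adj v w" "e = X.seg v w" using X.edge_at_vertex[OF e v(1)] .
  obtain w' where w': "X.adj v w'" "w' \<noteq> w" using X.two_edges_at_vertex[OF min w(1)] by blast
  have const: "\<phi> i a = \<phi> i b" if "a \<in> pts (X i)" "b \<in> pts (X i)" for a b
  proof -
    have "tdist (Y i) (\<phi> i a) (\<phi> i b) \<le> 0" using Lip_bound[OF straight_O_map[OF \<phi>] i that] zero
      by simp
    then have "tdist (Y i) (\<phi> i a) (\<phi> i b) = 0" by (simp add: order_antisym)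
    then show ?thesis using straight_closed[OF \<phi> i] that by simp
  qed
  have tension: "X.seg v x \<in> tension_edges k X Y \<phi> i" if x: "X.adj v x" for x
  proof -
    have "\<phi> i a = \<phi> i b" "\<phi> i b \<in> pts (Y i)" if "a \<in> X.seg v x" "b \<in> X.seg v x" for a b
      using const that X.seg_pts straight_closed[OF \<phi> i] by blast+
    then have "has_speed (X i) (Y i) (\<phi> i) (X.seg v x) 0" unfolding has_speed_def
      by (metis mdist_zero mult_zero_left)
    then show ?thesis using zero adjacent_edge[OF x] by (simp add: tension_edges_def)
  qed
  have "X.seg v w \<noteq> X.seg v w'" using X.edge_ends_eq[OF w(1) w'(1)] w'(2) X.adjD(5)[OF w(1)]
    by blast
  moreover have "\<phi> i ` X.seg v w = {\<phi> i v}"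
    using const X.adjD(3,8)[OF w(1)] X.seg_pts by blast
  ultimately have "\<not> same_gate (X i) (Y i) (\<phi> i) v (X.seg v w) (X.seg v w')"
    by (simp add: same_gate_def)
  then show "\<exists>e \<in> tension_edges k X Y \<phi> i. \<exists>e' \<in> tension_edges k X Y \<phi> i.
    v \<in> e \<and> v \<in> e' \<and> \<not> same_gate (X i) (Y i) (\<phi> i) v e e'"
    using tension[OF w(1)] tension[OF w'(1)] X.adjD(8)[OF w(1)] X.adjD(8)[OF w'(1)] by blast
qed (rule \<phi>)

text \<open>The Lipschitz constant of \<open>\<phi>\<close> is minimal and cannot drop, while edges
  outside the core become strictly slower. So every tension edge of \<open>g\<close> lies in the
  core, where \<open>g\<close> agrees with \<open>\<phi>\<close> at the vertices and inherits its
  two gates.\<close>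

lemma optimal_near_weakly_optimal:
  assumes wo: "weakly_optimal k \<Gamma> X Y \<phi>" and \<epsilon>: "\<epsilon> > 0"
  shows "\<exists>g. optimal k \<Gamma> X Y g \<and> d_inf k X Y g \<phi> < \<epsilon>"
proof -
  let ?l = "Lip k X Y \<phi>"
  have \<phi>: "straight k \<Gamma> X Y \<phi>" and l: "?l = Lambda k \<Gamma> X Y" using wo
    by (auto simp: weakly_optimal_def)
  note \<phi>O = straight_O_map[OF \<phi>]
  show ?thesis
  proof (cases "?l = 0")
    case True
    have "d_inf k X Y \<phi> \<phi> \<le> 0" using straight_closed[OF \<phi>]
      by (intro d_inf_le) (simp add: mdist_self)
    then show ?thesis using optimal_of_Lip_zero[OF \<phi> True] \<epsilon> by fastforce
  next
    case False
    then have pos: "?l > 0" using Lip_nonneg[OF \<phi>O] by simp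
    obtain C \<eta>0 where core: "core \<phi> C" and \<eta>0: "\<eta>0 > 0"
      and ex: "\<And>\<eta>. 0 < \<eta> \<Longrightarrow> \<eta> \<le> \<eta>0 \<Longrightarrow> \<exists>g. slowed C \<eta> \<phi> g"
      by (rule forest_tension_step[OF \<phi> pos]) blast
    have C: "\<And>i u w. i \<in> {1..k} \<Longrightarrow> adjC i (C i) u w \<Longrightarrow> tdist (Y i) (\<phi> i u) (\<phi> i w) = ?l * tdist (X i) u w"
      "\<And>i v w. i \<in> {1..k} \<Longrightarrow> adjC i (C i) v w \<Longrightarrow> tree_pair.two_gated (X i) (Y i) (\<phi> i) (C i) v"
      using core unfolding core_def by blast+
    \<comment> \<open>Makes the displacement \<open>\<eta> * vol k \<Gamma> X\<close> smaller than
      \<open>\<epsilon>\<close>; the added 1 keeps the denominator positive for volume 0.\<close>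
    define \<eta> where "\<eta> = min \<eta>0 (\<epsilon> / (2 * (vol k \<Gamma> X + 1)))"
    have v: "0 < 2 * (vol k \<Gamma> X + 1)" using vol_nonneg by simp
    have \<eta>: "0 < \<eta>" "\<eta> \<le> \<eta>0" "\<eta> \<le> \<epsilon> / (2 * (vol k \<Gamma> X + 1))" using \<eta>0 \<epsilon> v by (auto simp: \<eta>_def)
    have small: "\<eta> * vol k \<Gamma> X < \<epsilon>"
    proof -
      have "\<eta> * (2 * (vol k \<Gamma> X + 1)) \<le> \<epsilon>" using \<eta>(3) v by (simp add: le_divide_eq)
      moreover have "0 \<le> \<eta> * vol k \<Gamma> X" using \<eta>(1) vol_nonneg by simp
      ultimately show ?thesis using \<eta>(1) by (simp add: algebra_simps)
    qed
    obtain g where "slowed C \<eta> \<phi> g" using ex[OF \<eta>(1,2)] by blast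
    note g = slowedD(1)[OF this] slowedD(2)[OF this \<eta>(1)] and gC = slowedD(3)[OF this]
      and slow = slowedD(4)[OF this]
    have onC: "tdist (Y i) (g i u) (g i w) = ?l * tdist (X i) u w" if i: "i \<in> {1..k}"
      and uw: "adjC i (C i) u w" for i u w
      using gC[OF i uw] gC[OF i tree_pair.adj_in_commute[OF pair[OF i] uw]] C(1)[OF i uw] by simp
    have Lg: "Lip k X Y g = ?l"
    proof (rule antisym)
      show "?l \<le> Lip k X Y g" unfolding l by (rule Lambda_le[OF straight_O_map[OF g(1)]])
      show "Lip k X Y g \<le> ?l"
      proof (rule straight_Lip_le[OF g(1) less_imp_le[OF pos]])
        fix i u w assume i: "i \<in> {1..k}" and uw: "adjacent (X i) u w"
        show "tdist (Y i) (g i u) (g i w) \<le> ?l * tdist (X i) u w"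
        proof (cases "adjC i (C i) u w")
          case False
          have "(?l - \<eta>) * tdist (X i) u w \<le> ?l * tdist (X i) u w" using \<eta>(1)
            by (intro mult_right_mono) auto
          then show ?thesis using slow[OF i uw False] by linarith
        qed (simp add: onC[OF i])
      qed
    qed
    have "optimal k \<Gamma> X Y g"
      unfolding optimal_def
    proof (intro conjI ballI impI)
      fix i v assume i: "i \<in> {1..k}" and v: "v \<in> vset (X i)" "v \<in> \<Union>(tension_edges k X Y g i)"
      interpret tree_pair "X i" "Y i" "H i" by (rule pair[OF i])
      have gi: "tree_map (g i)" using g(1) i straight_iff by blast
      obtain e where e: "e \<in> edges (X i)" "v \<in> e" "has_speed (X i) (Y i) (g i) e ?l"
        using v(2) Lg by (auto simp: tension_edges_def)
      obtain w where w: "X.adj v w" "e = X.seg v w" using X.edge_at_vertex[OF e(1,2) v(1)] .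
      have "dY (g i v) (g i w) = ?l * dX v w" using e(3) w has_speed_iff[OF gi w(1)] by simp
      moreover have "(?l - \<eta>) * dX v w < ?l * dX v w" using \<eta>(1) X.adjD(7)[OF w(1)]
        by (intro mult_strict_right_mono) auto
      \<comment> \<open>Outside the core the speed is at most \<open>?l - \<eta>\<close>, so an edge
        of speed \<open>?l\<close> lies in the core.\<close>
      ultimately have "adj_in (C i) v w" using slow[OF i w(1)] by fastforce
      then obtain x y where xy: "adj_in (C i) v x" "adj_in (C i) v y"
        and gate: "dY (\<phi> i x) (\<phi> i y) = dY (\<phi> i x) (\<phi> i v) + dY (\<phi> i v) (\<phi> i y)"
        using C(2)[OF i] unfolding two_gated_def by blast
      have adj: "X.adj v x" "X.adj v y" using xy by (auto simp: adj_in_def)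
      have "g i x = \<phi> i x" "g i y = \<phi> i y" "g i v = \<phi> i v"
        using gC[OF i] xy adj_in_commute by blast+
      then have "\<not> same_gate (X i) (Y i) (g i) v (X.seg v x) (X.seg v y)"
        using gate onC[OF i xy(1)] onC[OF i xy(2)] pos
        by (intro not_same_gate[OF gi adj, of ?l]) auto
      moreover have "X.seg v z \<in> tension_edges k X Y g i" if "adj_in (C i) v z" "X.adj v z" for z
        using has_speed_iff[OF gi that(2)] onC[OF i that(1)] adjacent_edge[OF that(2)] Lg
        by (simp add: tension_edges_def)
      ultimately show "\<exists>e \<in> tension_edges k X Y g i. \<exists>e' \<in> tension_edges k X Y g i.
        v \<in> e \<and> v \<in> e' \<and> \<not> same_gate (X i) (Y i) (g i) v e e'"
        using xy adj X.adjD(8)[OF adj(1)] X.adjD(8)[OF adj(2)] by blast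
    qed (rule g(1))
    moreover have "d_inf k X Y g \<phi> \<le> \<eta> * vol k \<Gamma> X"
      using g(2) by (intro d_inf_le) (simp add: mdist_commute)
    ultimately show ?thesis using small by (intro exI[of _ g]) auto
  qed
qed

end

theorem theorem3p15:
  fixes \<Gamma> :: "nat \<Rightarrow> ('v, 'e, 'g) graph_of_groups"
    and X :: "nat \<Rightarrow> (('v, 'e, 'g) letter list set, 'x) gtree"
    and Y :: "nat \<Rightarrow> (('v, 'e, 'g) letter list set, 'y) gtree"
    and f :: "nat \<Rightarrow> 'x \<Rightarrow> 'y"
    and k :: nat
  assumes "k \<ge> 1"
    and "\<And>i. i \<in> {1..k} \<Longrightarrow> connected_finite_gog (\<Gamma> i)"
    and "\<And>i. i \<in> {1..k} \<Longrightarrow> carrier (pi1 (\<Gamma> i)) \<noteq> {\<one>\<^bsub>pi1 (\<Gamma> i)\<^esub>}"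
    and "X \<in> outer_space k \<Gamma>"
    and "Y \<in> outer_space k \<Gamma>"
    and "straight k \<Gamma> X Y f"
  shows "(\<exists>g0. weakly_optimal k \<Gamma> X Y g0 \<and>
            d_inf k X Y f g0 \<le> vol k \<Gamma> X * (Lip k X Y f - Lambda k \<Gamma> X Y)) \<and>
         (\<forall>\<phi>. weakly_optimal k \<Gamma> X Y \<phi> \<longrightarrow>
            (\<forall>\<epsilon>>0. \<exists>g. optimal k \<Gamma> X Y g \<and> d_inf k X Y g \<phi> < \<epsilon>))"
proof -
  interpret forest_pair \<Gamma> X Y k
    using assms by unfold_locales
  \<comment> \<open>Since \<open>g0\<close> attains \<open>Lambda k \<Gamma> X Y\<close>, the price
    recorded in \<open>descends f g0\<close> is exactly the bound claimed.\<close>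
  obtain g0 where g0: "descends f g0" "Lip k X Y g0 = Lambda k \<Gamma> X Y"
    using weakly_optimal_below[OF assms(6)] by blast
  then have "weakly_optimal k \<Gamma> X Y g0" by (simp add: weakly_optimal_def descends_def)
  moreover have "d_inf k X Y f g0 \<le> vol k \<Gamma> X * (Lip k X Y f - Lambda k \<Gamma> X Y)"
    using g0 by (intro d_inf_le) (simp add: descends_def)
  ultimately show ?thesis using optimal_near_weakly_optimal by blast
qed

end
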